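(* Let $\sigma > 1$ and let $f$ be a real-valued, $1$-periodic function that is symmetric (that is, $f(t) = f(1-t)$) and $\alpha$-Hölder continuous for some $0 < \alpha \leq 1$. Let $C, D\in\mathbb{R}$ be the constants for which $$ \frac1{F_n^\sigma} \sum_{m = 1}^{F_n-1} \frac{f(m/F_n)}{\left|\sin(\pi m/F_n)\right|^\sigma} \cdot \frac{f(F_{n-1}m/F_n)}{\left|\sin(\pi F_{n-1}m/F_n)\right|^\sigma} = Cn + D + O\left(\frac{n^2}{\phi^{\min\{\alpha, \sigma-1\} n/2}}\right) $$ as $n\to\infty$. Then $$ C = 2\,\frac{f(0)^2\, 5^{\sigma/2}}{\pi^{2\sigma}} \sum_{i=1}^\infty \frac1{\eta_i^\sigma} = 2 f(0)^2\, \frac{5^{\sigma / 2}}{\pi^{2\sigma}}\, \zeta_{\mathbb{Q}(\sqrt5)}(\sigma) $$ and $$ D = 2\sum_{i=1}^\infty \left(\delta_{f, \sigma}(i) + \delta_{f, \sigma}^*(i) - \frac{f(0)^2\, 5^{\sigma/2}}{\pi^{2\sigma}} \cdot \frac{\mu_i+1}{\eta_i^\sigma}\right). $$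
   Context: $(F_n)_n$ are the Fibonacci numbers $F_0=0$, $F_1=1$, $F_n=F_{n-1}+F_{n-2}$, $\phi = \frac{1+\sqrt5}{2}$, and $\mathbb{N}=\{1,2,3,\dots\}$. A $1$-periodic function $f$ (identified with $f:[0,1)\to\mathbb{R}$) is called $\alpha$-Hölder continuous if there is $L_f\ge 0$ with $|f(x)-f(y)|\le L_f|x-y|^\alpha$ for all $x,y\in[0,1)$. The Wythoff array $(W_{i,k})$, $i \in\mathbb{N}$, is given by $W_{i,1}=\lfloor\phi\lfloor\phi i\rfloor\rfloor$, $W_{i,2}=\lfloor\phi^2\lfloor\phi i\rfloor\rfloor$ and $W_{i,k}=W_{i,k-1}+W_{i,k-2}$, where the recurrence is used to define $W_{i,k}$ for all $k\in\mathbb{Z}$. Set $w_+(i)=\phi^{-2}W_{i,1}+\phi^{-1}W_{i,2}$, $w_-(i)=\phi^2W_{i,1}-\phi W_{i,2}$, $w_+^*(i)=-w_-(i)$ and $\eta_i=-w_+(i)w_-(i)$ (a positive integer). Let $\mu_i=\lfloor\log_\phi(2w_+(i))\rfloor$; equivalently, $\mu_i\in\mathbb{N}$ is the unique number such that for all $n,k\in\mathbb{N}$ one has $W_{i,k}<\frac12F_n$ if and only if $n-k>\mu_i$. For $m>\mu_i$ define the dual array by $W^*_{i,m}=(-1)^{m}W_{i,-m}$. Define $$ \delta_{f, \sigma}(i) = \sum_{k=1}^\infty \left(\frac{f(0)}{\pi^\sigma W_{i, k}^\sigma} \frac{f(w_+^*(i) \phi^{-k})}{\sin(\pi w_+^*(i)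 \phi^{-k})^\sigma} - \frac{f(0)^2 5^{\sigma/2}}{\pi^{2\sigma} \eta_i^\sigma}\right), $$ $$ \delta_{f, \sigma}^*(i) = \sum_{j=1}^\infty \left(\frac{f(w_+(i) \phi^{-(\mu_i+j)})}{\sin(\pi w_+(i) \phi^{-(\mu_i+j)})^\sigma} \frac{f(0)}{\pi^\sigma (W_{i, \mu_i+j}^* )^\sigma} - \frac{f(0)^2 5^{\sigma/2}}{\pi^{2\sigma} \eta_i^\sigma}\right) $$ (both series converge). Finally, $\zeta_{\mathbb{Q}(\sqrt5)}(\sigma)=\sum_{0\ne I\subseteq\mathbb{Z}[\phi]}\#(\mathbb{Z}[\phi]/I)^{-\sigma}$ is the Dedekind zeta function of $\mathbb{Q}(\sqrt5)$, the sum running over all non-zero ideals of its ring of integers $\mathbb{Z}[\phi]$. *)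

theory Defs
  imports
    "HOL-Analysis.Analysis"
    "HOL-Library.Landau_Symbols"
    "HOL-Number_Theory.Fib"
    "HOL-Algebra.QuotRing"
begin

definition phi :: real where
  "phi = (1 + sqrt 5) / 2"

definition holder :: "real \<Rightarrow> (real \<Rightarrow> real) \<Rightarrow> bool" where
  "holder \<alpha> f \<longleftrightarrow>
     (\<exists>L\<ge>0. \<forall>x\<in>{0..<1}. \<forall>y\<in>{0..<1}. \<bar>f x - f y\<bar> \<le> L * \<bar>x - y\<bar> powr \<alpha>)"

text \<open>Below, row indices \<open>i :: nat\<close> are only meaningful for \<open>i \<ge> 1\<close>. The columns of the
  Wythoff array are indexed by all integers; for \<open>k \<le> 0\<close> the recurrence is run backwards.\<close>

function wythoff :: "nat \<Rightarrow> int \<Rightarrow> int" where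
  "wythoff i k =
     (if k = 1 then \<lfloor>phi * of_int \<lfloor>phi * real i\<rfloor>\<rfloor>
      else if k = 2 then \<lfloor>phi ^ 2 * of_int \<lfloor>phi * real i\<rfloor>\<rfloor>
      else if k > 2 then wythoff i (k - 1) + wythoff i (k - 2)
      else wythoff i (k + 2) - wythoff i (k + 1))"
  by pat_completeness auto
termination
  by (relation "Wellfounded.measure (\<lambda>(i, k). nat \<bar>2 * k - 3\<bar>)") auto

declare wythoff.simps [simp del]

lemma wythoff_1: "wythoff i 1 = \<lfloor>phi * of_int \<lfloor>phi * real i\<rfloor>\<rfloor>"
  and wythoff_2: "wythoff i 2 = \<lfloor>phi ^ 2 * of_int \<lfloor>phi * real i\<rfloor>\<rfloor>"
  by (subst wythoff.simps; simp)+

lemma wythoff_rec: "wythoff i k = wythoff i (k - 1) + wythoff i (k - 2)"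
proof (cases "k > 2")
  case True
  then show ?thesis by (subst wythoff.simps) simp
next
  case False
  have "wythoff i (k - 2) = wythoff i k - wythoff i (k - 1)"
    using False by (subst wythoff.simps) simp
  then show ?thesis by simp
qed

definition w_plus :: "nat \<Rightarrow> real" where
  "w_plus i = of_int (wythoff i 1) / phi ^ 2 + of_int (wythoff i 2) / phi"

definition w_minus :: "nat \<Rightarrow> real" where
  "w_minus i = phi ^ 2 * of_int (wythoff i 1) - phi * of_int (wythoff i 2)"

definition w_plus_dual :: "nat \<Rightarrow> real" where
  "w_plus_dual i = - w_minus i"

definition eta :: "nat \<Rightarrow> real" where
  "eta i = - w_plus i * w_minus i"

definition mu :: "nat \<Rightarrow> nat" where
  "mu i = nat \<lfloor>log phi (2 * w_plus i)\<rfloor>"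

definition wythoff_dual :: "nat \<Rightarrow> nat \<Rightarrow> int" where
  "wythoff_dual i m = (-1) ^ m * wythoff i (- int m)"

lemma phi_gt_1: "phi > 1"
  by (simp add: phi_def)

text \<open>The conversion to \<open>nat\<close> in the definition of \<open>mu\<close> does not truncate.\<close>

lemma int_mu:
  assumes "i \<ge> 1"
  shows "int (mu i) = \<lfloor>log phi (2 * w_plus i)\<rfloor>"
proof -
  have phi2: "phi ^ 2 = phi + 1"
    by (simp add: phi_def power2_eq_square field_simps)
  have "1 \<le> phi * real i"
    using phi_gt_1 assms mult_mono[of 1 phi 1 "real i"] by simp
  then have a: "1 \<le> \<lfloor>phi * real i\<rfloor>" by simp
  then have r: "1 \<le> real_of_int \<lfloor>phi * real i\<rfloor>" by linarith
  have b1: "1 \<le> wythoff i 1"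
    using phi_gt_1 r mult_mono[of 1 phi 1 "real_of_int \<lfloor>phi * real i\<rfloor>"]
    by (simp add: wythoff_1)
  have b2: "1 \<le> wythoff i 2"
    using phi_gt_1 phi2 r mult_mono[of 1 "phi ^ 2" 1 "real_of_int \<lfloor>phi * real i\<rfloor>"]
    by (simp add: wythoff_2)
  have "1 = 1 / phi ^ 2 + 1 / phi"
    using phi2 phi_gt_1 by (simp add: field_simps power2_eq_square)
  also have "\<dots> \<le> w_plus i"
    unfolding w_plus_def using b1 b2 phi_gt_1
    by (intro add_mono divide_right_mono) auto
  finally have "0 \<le> log phi (2 * w_plus i)"
    using phi_gt_1 by simp
  then show ?thesis by (simp add: mu_def)
qed

definition delta_term :: "(real \<Rightarrow> real) \<Rightarrow> real \<Rightarrow> nat \<Rightarrow> nat \<Rightarrow> real" where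
  "delta_term f \<sigma> i k =
     f 0 / (pi powr \<sigma> * of_int (wythoff i (int k)) powr \<sigma>)
       * (f (w_plus_dual i / phi ^ k) / sin (pi * (w_plus_dual i / phi ^ k)) powr \<sigma>)
     - f 0 ^ 2 * 5 powr (\<sigma> / 2) / (pi powr (2 * \<sigma>) * eta i powr \<sigma>)"

definition delta :: "(real \<Rightarrow> real) \<Rightarrow> real \<Rightarrow> nat \<Rightarrow> real" where
  "delta f \<sigma> i = (\<Sum>k. delta_term f \<sigma> i (Suc k))"

definition delta_dual_term :: "(real \<Rightarrow> real) \<Rightarrow> real \<Rightarrow> nat \<Rightarrow> nat \<Rightarrow> real" where
  "delta_dual_term f \<sigma> i j =
     f (w_plus i / phi ^ (mu i + j)) / sin (pi * (w_plus i / phi ^ (mu i + j))) powr \<sigma>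
       * (f 0 / (pi powr \<sigma> * of_int (wythoff_dual i (mu i + j)) powr \<sigma>))
     - f 0 ^ 2 * 5 powr (\<sigma> / 2) / (pi powr (2 * \<sigma>) * eta i powr \<sigma>)"

definition delta_dual :: "(real \<Rightarrow> real) \<Rightarrow> real \<Rightarrow> nat \<Rightarrow> real" where
  "delta_dual f \<sigma> i = (\<Sum>j. delta_dual_term f \<sigma> i (Suc j))"

definition Z_phi :: "real ring" where
  "Z_phi = \<lparr>carrier = {of_int a + of_int b * phi | a b. True},
            monoid.mult = (*), one = 1, zero = 0, add = (+)\<rparr>"

lemma cring_Z_phi: "cring Z_phi"
proof -
  have phi2: "phi * phi = phi + 1"
    by (simp add: phi_def power2_eq_square field_simps)
  have mult: "\<exists>a b. x * y = of_int a + of_int b * phi"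
    if xy: "x = of_int a + of_int b * phi" "y = of_int c + of_int d * phi" for x y :: real and a b c d
  proof -
    have "x * y = of_int a * of_int c + (of_int a * of_int d + of_int b * of_int c) * phi
                  + of_int b * of_int d * (phi * phi)"
      by (simp add: xy algebra_simps)
    also have "\<dots> = of_int (a * c + b * d) + of_int (a * d + b * c + b * d) * phi"
      by (simp add: phi2 algebra_simps)
    finally show ?thesis by blast
  qed
  have add: "\<exists>a b. x + y = of_int a + of_int b * phi"
    if xy: "x = of_int a + of_int b * phi" "y = of_int c + of_int d * phi" for x y :: real and a b c d
    by (rule exI[of _ "a + c"], rule exI[of _ "b + d"]) (simp add: xy algebra_simps)
  have neg: "\<exists>y\<in>carrier Z_phi. y + x = 0" if "x \<in> carrier Z_phi" for x
  proof -
    from that obtain a b where "x = of_int a + of_int b * phi" by (auto simp: Z_phi_def)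
    then have "of_int (- a) + of_int (- b) * phi + x = 0" by simp
    moreover have "of_int (- a) + of_int (- b) * phi \<in> carrier Z_phi"
      unfolding Z_phi_def by (simp only: partial_object.simps) blast
    ultimately show ?thesis by blast
  qed
  have zero: "\<exists>a b. (0::real) = of_int a + of_int b * phi"
    by (rule exI[of _ 0], rule exI[of _ 0]) simp
  have one: "\<exists>a b. (1::real) = of_int a + of_int b * phi"
    by (rule exI[of _ 1], rule exI[of _ 0]) simp
  show ?thesis
  proof (rule cringI)
    show "abelian_group Z_phi"
    proof (rule abelian_groupI)
      show "\<exists>y\<in>carrier Z_phi. y \<oplus>\<^bsub>Z_phi\<^esub> x = \<zero>\<^bsub>Z_phi\<^esub>" if "x \<in> carrier Z_phi" for x
        using neg[OF that] by (simp add: Z_phi_def)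
    qed (use add zero in \<open>auto simp: Z_phi_def\<close>)
    show "comm_monoid Z_phi"
      by (rule comm_monoidI) (use mult one in \<open>auto simp: Z_phi_def\<close>)
  qed (auto simp: Z_phi_def algebra_simps)
qed

definition nonzero_ideals :: "('a, 'b) ring_scheme \<Rightarrow> 'a set set" where
  "nonzero_ideals R = {I. ideal I R \<and> I \<noteq> {\<zero>\<^bsub>R\<^esub>}}"

definition ideal_norm :: "('a, 'b) ring_scheme \<Rightarrow> 'a set \<Rightarrow> nat" where
  "ideal_norm R I = card (carrier (R Quot I))"

definition dedekind_zeta_sqrt5 :: "real \<Rightarrow> real" where
  "dedekind_zeta_sqrt5 \<sigma> = (\<Sum>\<^sub>\<infinity>I\<in>nonzero_ideals Z_phi. real (ideal_norm Z_phi I) powr (- \<sigma>))"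

definition fib_sum :: "(real \<Rightarrow> real) \<Rightarrow> real \<Rightarrow> nat \<Rightarrow> real" where
  "fib_sum f \<sigma> n =
     1 / real (fib n) powr \<sigma> *
     (\<Sum>m = 1..fib n - 1.
        f (real m / real (fib n)) / \<bar>sin (pi * real m / real (fib n))\<bar> powr \<sigma>
        * (f (real (fib (n - 1)) * real m / real (fib n))
           / \<bar>sin (pi * real (fib (n - 1)) * real m / real (fib n))\<bar> powr \<sigma>))"

end

theory Submission
  imports Defs "HOL-Real_Asymp.Real_Asymp"
begin

text \<open>
  Every positive integer occurs exactly once in the Wythoff array, so the summation indices of
  the Fibonacci sum can be sorted by the row \<open>i\<close> and the column \<open>k\<close> in which they occur. With \<open>n = k + m\<close>,
  the multiplication by \<open>F\<^bsub>n-1\<^esub>\<close> modulo \<open>F\<^sub>n\<close> turns \<open>W\<^bsub>i,k\<^esub>\<close> into the dual entry \<open>W\<^sup>*\<^bsub>i,m\<^esub>\<close> up to sign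
  (\<open>fib_wythoff\<close>), and \<open>2 W\<^bsub>i,k\<^esub> \<le> F\<^sub>n\<close> is the same as \<open>m > mu i\<close>, up to a possible tie in the middle
  (\<open>wythoff_le_half\<close>, \<open>wythoff_ge_half\<close>). As the sum is invariant under \<open>r \<mapsto> F\<^sub>n - r\<close>, it is twice the
  sum over all entries with \<open>k + mu i < n\<close>, plus a middle term that tends to 0 (\<open>fib_sum_wsum\<close>).

  Within a row, \<open>W\<^bsub>i,k\<^esub> W\<^sup>*\<^bsub>i,m\<^esub> / F\<^sub>n\<close> is close to \<open>eta i / sqrt 5\<close>, so that a summand is close to the constant
  \<open>c i = f(0)\<^sup>2 5\<^bsup>\<sigma>/2\<^esup> / (\<pi>\<^bsup>2\<sigma>\<^esup> eta(i)\<^sup>\<sigma>)\<close> unless \<open>k\<close> or \<open>m - mu i\<close> is small. The error decays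
  geometrically from both ends of the row, with a constant proportional to \<open>1 / eta(i)\<^sup>\<sigma>\<close> and otherwise
  independent of the row (\<open>summand_bound\<close>). Hence the row contributes \<open>n - mu i - 1\<close> times \<open>c i\<close> plus
  a deviation that converges to \<open>delta i + delta_dual i\<close>, one series for each end
  (\<open>two_sided_tannery\<close>, \<open>row_analysis\<close>). As \<open>eta i\<close> grows at least linearly and \<open>mu i\<close> only
  logarithmically, the deviations may be summed over all rows under the limit, which gives
  \<open>fib_sum_asymptotics\<close>. Two expansions \<open>C n + D\<close> with error \<open>o(1)\<close> have the same coefficients.

  For the zeta function, the row \<open>i\<close> is matched with the ideal of \<open>\<int>[\<phi>]\<close> generated by \<open>w_minus i\<close>, an
  element of norm \<open>- eta i\<close>. The ring is Euclidean, hence every nonzero ideal is principal; the units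
  \<open>\<plusminus> \<phi>\<^sup>l\<close> allow exactly one negative generator whose norm is negative and whose absolute value lies
  between \<open>\<phi>\<^bsup>-2\<^esup>\<close> and 1, and these normalised generators are the \<open>w_minus i\<close> (\<open>row_ideal_bij\<close>). The index of a principal
  ideal is the absolute value of the norm (\<open>ideal_norm_pid\<close>).
\<close>

section \<open>The golden ratio and its conjugate\<close>

text \<open>The conjugate of \<open>phi\<close>.\<close>

definition psi :: real where "psi = 1 - phi"

lemma phi_sq: "phi * phi = phi + 1"
  by (simp add: phi_def power2_eq_square field_simps)

lemma phi_pow2: "phi ^ 2 = phi + 1"
  by (simp add: power2_eq_square phi_sq)

lemma psi_sq: "psi * psi = psi + 1"
  by (simp add: psi_def algebra_simps phi_sq)

lemma phi_psi: "phi * psi = -1"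
  by (simp add: psi_def algebra_simps phi_sq)

lemma phi_sq_left: "phi * (phi * x) = phi * x + x"
  by (simp add: mult.assoc[symmetric] phi_sq algebra_simps)

lemma sqrt5_eq: "sqrt 5 = 2 * phi - 1"
  by (simp add: phi_def field_simps)

lemma phi_bounds: "1.618 < phi" "phi < 1.6181"
proof -
  have "2.236 < sqrt (5::real)" by (rule real_less_rsqrt) (simp add: power2_eq_square)
  then show "1.618 < phi" by (simp add: phi_def)
  have "sqrt (5::real) < 2.2362" by (rule real_less_lsqrt) (simp_all add: power2_eq_square)
  then show "phi < 1.6181" by (simp add: phi_def)
qed

lemma phi_pos [simp]: "phi > 0" "phi \<ge> 0" "phi \<noteq> 0"
  using phi_gt_1 by auto

lemma inverse_phi: "1 / phi = phi - 1"
  using phi_sq by (simp add: field_simps)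

lemma inverse_phi2: "1 / phi ^ 2 = 2 - phi"
proof -
  have "(2 - phi) * phi ^ 2 = 1" by (simp add: phi_pow2 algebra_simps phi_sq)
  then show ?thesis by (simp add: field_simps)
qed

lemma psi_eq: "psi = - 1 / phi"
  using phi_psi by (simp add: field_simps)

lemma abs_psi: "\<bar>psi\<bar> = 1 / phi"
  by (simp add: psi_eq)

lemma psi_pow: "psi ^ k = (-1) ^ k / phi ^ k"
  unfolding psi_eq by (simp only: power_divide)

lemma psi_nonzero [simp]: "psi \<noteq> 0"
  by (simp add: psi_eq)

lemma abs_psi_pow: "\<bar>psi ^ k\<bar> = 1 / phi ^ k"
  by (simp add: power_abs abs_psi power_divide)

lemma phi_irrational:
  assumes "real_of_int a + real_of_int b * phi = 0"
  shows "a = 0 \<and> b = 0"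
proof -
  have "b = 0"
  proof (rule ccontr)
    assume b: "b \<noteq> 0"
    have "sqrt 5 * real_of_int b = of_int (- 2 * a - b)"
      using assms by (simp add: sqrt5_eq algebra_simps)
    then have "(sqrt 5 * real_of_int b)\<^sup>2 = (of_int (- 2 * a - b))\<^sup>2" by simp
    then have "real_of_int (5 * b\<^sup>2) = real_of_int ((- 2 * a - b)\<^sup>2)"
      by (simp add: power_mult_distrib)
    then have e: "5 * b\<^sup>2 = (2 * a + b)\<^sup>2"
      unfolding of_int_eq_iff by (simp add: power2_eq_square algebra_simps)
    have "b\<^sup>2 dvd (2 * a + b)\<^sup>2" using e by (metis dvd_triv_right)
    then have "b dvd 2 * a + b" by simp
    then obtain c where "2 * a + b = b * c" by blast
    with e b have c: "5 = c ^ 2" by (simp add: power_mult_distrib)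
    have "\<bar>c\<bar> \<le> 2 \<or> \<bar>c\<bar> \<ge> 3" by linarith
    then show False
    proof
      assume "\<bar>c\<bar> \<le> 2"
      then have "\<bar>c\<bar>^2 \<le> 2^2" by (intro power_mono) auto
      with c show False by simp
    next
      assume "\<bar>c\<bar> \<ge> 3"
      then have "\<bar>c\<bar>^2 \<ge> 3^2" by (intro power_mono) auto
      with c show False by simp
    qed
  qed
  with assms show ?thesis by simp
qed

section \<open>Rows of the Wythoff array\<close>

lemma wythoff_add2: "wythoff i (k + 2) = wythoff i (k + 1) + wythoff i k"
  using wythoff_rec[of i "k + 2"] by (simp add: algebra_simps)

lemma wythoff_0: "wythoff i 0 = \<lfloor>phi * real i\<rfloor>"
proof -
  have "phi ^ 2 * of_int \<lfloor>phi * real i\<rfloor> = phi * of_int \<lfloor>phi * real i\<rfloor> + of_int \<lfloor>phi * real i\<rfloor>"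
    by (simp add: phi_pow2 algebra_simps)
  then show ?thesis
    using wythoff_add2[of i 0] by (simp add: wythoff_1 wythoff_2)
qed

lemma wythoff_1_floor: "wythoff i 1 = \<lfloor>phi * of_int (wythoff i 0)\<rfloor>"
  by (simp add: wythoff_0 wythoff_1)

lemma w_plus_dual_eq: "w_plus_dual i = phi * of_int (wythoff i 0) - of_int (wythoff i 1)"
  and w_plus_eq: "w_plus i = of_int (wythoff i 1) + (phi - 1) * of_int (wythoff i 0)"
proof -
  have w2: "wythoff i 2 = wythoff i 1 + wythoff i 0" using wythoff_add2[of i 0] by simp
  show "w_plus_dual i = phi * of_int (wythoff i 0) - of_int (wythoff i 1)"
    by (simp add: w_plus_dual_def w_minus_def w2 phi_pow2 algebra_simps)
  have "w_plus i = (1 / phi^2) * of_int (wythoff i 1) + (1 / phi) * of_int (wythoff i 2)"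
    by (simp add: w_plus_def)
  then show "w_plus i = of_int (wythoff i 1) + (phi - 1) * of_int (wythoff i 0)"
    unfolding inverse_phi2 inverse_phi by (simp add: w2 algebra_simps)
qed

lemma phi_frac_pos:
  assumes "i \<noteq> 0"
  shows "real_of_int \<lfloor>phi * of_int i\<rfloor> < phi * of_int i"
proof -
  have "real_of_int \<lfloor>phi * of_int i\<rfloor> \<noteq> phi * of_int i"
    using phi_irrational[of "- \<lfloor>phi * of_int i\<rfloor>" i] assms by (auto simp: algebra_simps)
  then show ?thesis by (meson of_int_floor_le order_less_le)
qed

lemma wythoff_0_ge: "wythoff i 0 \<ge> int i"
  unfolding wythoff_0 le_floor_iff using phi_gt_1 by (simp add: mult_le_cancel_right1)

lemma wythoff_1_ge: "wythoff i 1 \<ge> int i"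
proof -
  have "real i \<le> of_int (wythoff i 0)" using wythoff_0_ge[of i] by linarith
  also have "\<dots> \<le> phi * of_int (wythoff i 0)"
    using phi_gt_1 wythoff_0_ge[of i] by (simp add: mult_le_cancel_right1)
  finally show ?thesis unfolding wythoff_1_floor le_floor_iff by simp
qed

lemma w_plus_dual_bounds:
  assumes "i \<ge> 1"
  shows "1 / phi ^ 2 < w_plus_dual i" "w_plus_dual i < 1" "w_plus_dual i > 0"
    and wythoff_1_eq: "wythoff i 1 = wythoff i 0 + int i - 1"
proof -
  define a where "a = wythoff i 0"
  have a1: "of_int a < phi * real i" using phi_frac_pos[of "int i"] assms by (simp add: a_def wythoff_0)
  have a2: "phi * real i < of_int a + 1" by (simp add: a_def wythoff_0)
  define e where "e = phi * real i - of_int a"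
  have e: "0 < e" "e < 1" using a1 a2 by (auto simp: e_def)
  have "phi * of_int a = phi * phi * real i - phi * e" by (simp add: e_def algebra_simps)
  also have "\<dots> = of_int (a + int i - 1) + (1 - (phi - 1) * e)"
    by (simp add: phi_sq algebra_simps e_def)
  finally have pa: "phi * of_int a = of_int (a + int i - 1) + (1 - (phi - 1) * e)" .
  have "(phi - 1) * e < (phi - 1) * 1" using e phi_gt_1 by (intro mult_strict_left_mono) auto
  moreover have "(phi - 1) * e > 0" using e phi_gt_1 by simp
  ultimately have b: "1 - (phi - 1) * e > 2 - phi" "1 - (phi - 1) * e < 1" by auto
  have w1: "wythoff i 1 = a + int i - 1"
    unfolding wythoff_1_floor a_def[symmetric] pa
    by (rule floor_unique) (use b phi_bounds in auto)
  then have w: "w_plus_dual i = 1 - (phi - 1) * e"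
    using pa by (simp add: w_plus_dual_eq a_def)
  show "1 / phi ^ 2 < w_plus_dual i" "w_plus_dual i < 1" "w_plus_dual i > 0"
    using b phi_bounds by (auto simp: w inverse_phi2)
  show "wythoff i 1 = wythoff i 0 + int i - 1" using w1 a_def by simp
qed

lemma w_plus_ge: "w_plus i \<ge> phi * real i"
proof -
  have "real i \<le> of_int (wythoff i 0)" "real i \<le> of_int (wythoff i 1)"
    using wythoff_0_ge[of i] wythoff_1_ge[of i] by linarith+
  then have "real i + (phi - 1) * real i \<le> w_plus i"
    unfolding w_plus_eq using phi_gt_1 by (intro add_mono mult_left_mono) auto
  then show ?thesis by (simp add: algebra_simps)
qed

lemma w_plus_ge_phi: "i \<ge> 1 \<Longrightarrow> w_plus i \<ge> phi"
  using order_trans[OF mult_left_mono[of 1 "real i" phi] w_plus_ge[of i]] by simp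

lemma w_plus_le: "w_plus i \<le> 5 * real i"
proof -
  have a: "real_of_int (wythoff i 0) \<le> phi * real i" by (simp add: wythoff_0)
  have b: "real_of_int (wythoff i 1) \<le> phi * of_int (wythoff i 0)" by (simp add: wythoff_1_floor)
  have "w_plus i \<le> (2 * phi - 1) * of_int (wythoff i 0)"
    using b unfolding w_plus_eq by (simp add: algebra_simps)
  also have "\<dots> \<le> (2 * phi - 1) * (phi * real i)"
    using a phi_gt_1 by (intro mult_left_mono) auto
  also have "\<dots> = (phi + 2) * real i" by (simp add: algebra_simps phi_sq_left)
  also have "\<dots> \<le> 5 * real i" using phi_bounds by (intro mult_right_mono) auto
  finally show ?thesis .
qed

lemma eta_eq: "eta i = w_plus i * w_plus_dual i"
  by (simp add: eta_def w_plus_dual_def)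

text \<open>By its first two columns a row is an element of \<open>\<int>[\<phi>]\<close>, and the condition for a pair to start a row
  is that its conjugate lies in a window of ratio \<open>phi ^ 2\<close> (and that the signs are right). The row
  number is read off in column -1, which contains \<open>i - 1\<close>; the window makes \<open>phi * i\<close> exceed the
  entry in column 0 by less than 1, so that the floor comes out right.\<close>

lemma row_exists:
  fixes b c :: int
  assumes v: "1 / phi ^ 2 < phi * of_int b - of_int c" "phi * of_int b - of_int c \<le> 1"
    and pos: "b > 0 \<or> c > 0"
  shows "\<exists>i\<ge>1. wythoff i 0 = b \<and> wythoff i 1 = c"
proof -
  define v where "v = phi * of_int b - of_int c"
  \<comment> \<open>the entry in column -1, plus 1\<close>
  define j where "j = c - b + 1"
  have phij: "phi * of_int j = of_int b + phi * (1 - v)"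
  proof -
    have "phi * v = phi * phi * of_int b - phi * of_int c" by (simp add: v_def algebra_simps)
    then show ?thesis by (simp add: j_def phi_sq algebra_simps)
  qed
  have "v \<le> 1" "v > 2 - phi" using v by (auto simp: v_def inverse_phi2)
  have l: "phi * (1 - v) \<ge> 0" using \<open>v \<le> 1\<close> by simp
  have "phi * (1 - v) < phi * (phi - 1)" using \<open>v > 2 - phi\<close> by (intro mult_strict_left_mono) auto
  then have u: "phi * (1 - v) < 1" by (simp add: algebra_simps phi_sq)
  have fl: "\<lfloor>phi * of_int j\<rfloor> = b" by (rule floor_unique) (use phij l u in auto)
  have j1: "j \<ge> 1"
  proof (rule ccontr)
    assume "\<not> j \<ge> 1"
    then have "phi * of_int j \<le> 0" by (simp add: mult_nonneg_nonpos)
    then have b0: "b \<le> 0" using phij l by linarith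
    then have "phi * of_int b \<le> 0" by (simp add: mult_nonneg_nonpos)
    then have "real_of_int c < 0" using \<open>v > 2 - phi\<close> phi_bounds by (simp add: v_def)
    with b0 pos show False by simp
  qed
  let ?i = "nat j"
  have i: "?i \<ge> 1" and ri: "real ?i = of_int j" using j1 by auto
  have w0: "wythoff ?i 0 = b" by (simp add: wythoff_0 ri fl)
  with wythoff_1_eq[OF i] have "wythoff ?i 1 = c" using j1 by (simp add: j_def)
  with w0 i show ?thesis by blast
qed

lemma row_inj:
  assumes "i \<ge> 1" "j \<ge> 1" "w_plus_dual i = w_plus_dual j"
  shows "i = j"
proof -
  have "of_int (wythoff j 1 - wythoff i 1) + of_int (wythoff i 0 - wythoff j 0) * phi = 0"
    using assms(3) by (simp add: w_plus_dual_eq algebra_simps)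
  from phi_irrational[OF this] have "wythoff i 1 = wythoff j 1" "wythoff i 0 = wythoff j 0" by auto
  with wythoff_1_eq[OF assms(1)] wythoff_1_eq[OF assms(2)] show ?thesis by linarith
qed

lemma wythoff_closed: "sqrt 5 * of_int (wythoff i (int k)) = w_plus i * phi ^ k + w_plus_dual i * psi ^ k"
proof (induction k rule: fib.induct)
  case 1
  show ?case by (simp add: sqrt5_eq w_plus_eq w_plus_dual_eq algebra_simps)
next
  case 2
  show ?case by (simp add: sqrt5_eq w_plus_eq w_plus_dual_eq psi_def algebra_simps phi_sq)
next
  case (3 k)
  have "wythoff i (int (Suc (Suc k))) = wythoff i (int (Suc k)) + wythoff i (int k)"
    using wythoff_add2[of i "int k"] by (simp add: algebra_simps)
  then have "sqrt 5 * of_int (wythoff i (int (Suc (Suc k)))) =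
     sqrt 5 * of_int (wythoff i (int (Suc k))) + sqrt 5 * of_int (wythoff i (int k))"
    by (simp add: algebra_simps)
  also have "\<dots> = w_plus i * (phi + 1) * phi ^ k + w_plus_dual i * (psi + 1) * psi ^ k"
    unfolding 3 by (simp add: algebra_simps)
  also have "\<dots> = w_plus i * phi ^ Suc (Suc k) + w_plus_dual i * psi ^ Suc (Suc k)"
    unfolding phi_sq[symmetric] psi_sq[symmetric] by (simp add: algebra_simps)
  finally show ?case .
qed

lemma wythoff_dual_add2:
  "wythoff_dual i (Suc (Suc m)) = wythoff_dual i (Suc m) + wythoff_dual i m"
  using wythoff_add2[of i "- int (Suc (Suc m))"] by (simp add: wythoff_dual_def algebra_simps)

text \<open>Running a row backwards exchanges \<open>phi\<close> and \<open>psi\<close> up to sign, hence also \<open>w_plus\<close> and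
  \<open>w_plus_dual\<close>. The sign in the dual array is the one that makes this exchange exact.\<close>

lemma wythoff_dual_closed:
  "sqrt 5 * of_int (wythoff_dual i m) = w_plus_dual i * phi ^ m + w_plus i * psi ^ m"
proof (induction m rule: fib.induct)
  case 1
  show ?case by (simp add: sqrt5_eq w_plus_eq w_plus_dual_eq wythoff_dual_def algebra_simps)
next
  case 2
  have "wythoff i 1 = wythoff i 0 + wythoff i (-1)" using wythoff_add2[of i "-1"] by simp
  then have "real_of_int (wythoff i 1) = of_int (wythoff i 0) + of_int (wythoff i (-1))" by simp
  then show ?case
    by (simp add: sqrt5_eq w_plus_eq w_plus_dual_eq psi_def algebra_simps phi_sq phi_sq_left wythoff_dual_def)
next
  case (3 k)
  have "sqrt 5 * of_int (wythoff_dual i (Suc (Suc k))) =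
     sqrt 5 * of_int (wythoff_dual i (Suc k)) + sqrt 5 * of_int (wythoff_dual i k)"
    by (simp add: algebra_simps wythoff_dual_add2)
  also have "\<dots> = w_plus_dual i * (phi + 1) * phi ^ k + w_plus i * (psi + 1) * psi ^ k"
    unfolding 3 by (simp add: algebra_simps)
  also have "\<dots> = w_plus_dual i * phi ^ Suc (Suc k) + w_plus i * psi ^ Suc (Suc k)"
    unfolding phi_sq[symmetric] psi_sq[symmetric] by (simp add: algebra_simps)
  finally show ?case .
qed

lemma fib_closed: "sqrt 5 * real (fib n) = phi ^ n - psi ^ n"
proof (induction n rule: fib.induct)
  case 2 show ?case by (simp add: sqrt5_eq psi_def)
next
  case (3 n)
  have "sqrt 5 * real (fib (Suc (Suc n))) = sqrt 5 * real (fib (Suc n)) + sqrt 5 * real (fib n)"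
    by (simp add: algebra_simps)
  also have "\<dots> = (phi + 1) * phi ^ n - (psi + 1) * psi ^ n"
    unfolding 3 by (simp add: algebra_simps)
  also have "\<dots> = phi ^ Suc (Suc n) - psi ^ Suc (Suc n)"
    unfolding phi_sq[symmetric] psi_sq[symmetric] by (simp add: algebra_simps)
  finally show ?case .
qed simp

text \<open>Multiplication by \<open>phi\<close> almost shifts the row by one column. The defect is a pure power of \<open>psi\<close>;
  its sign and size reveal the column, and after that the row.\<close>

lemma wythoff_conj:
  "phi * of_int (wythoff i (int k)) - of_int (wythoff i (int k + 1)) = w_plus_dual i * psi ^ k"
proof -
  have "sqrt 5 * (phi * of_int (wythoff i (int k)) - of_int (wythoff i (int k + 1)))
     = phi * (w_plus i * phi ^ k + w_plus_dual i * psi ^ k) - (w_plus i * phi ^ Suc k + w_plus_dual i * psi ^ Suc k)"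
    unfolding wythoff_closed[symmetric] by (simp add: algebra_simps)
  also have "\<dots> = sqrt 5 * (w_plus_dual i * psi ^ k)"
    by (simp add: sqrt5_eq psi_def algebra_simps)
  finally show ?thesis by simp
qed

section \<open>Every positive integer occurs exactly once\<close>

text \<open>The defects of all rows and columns lie in an open interval of length 1. Hence an entry determines
  its right neighbour.\<close>

lemma wythoff_conj_window:
  assumes "i \<ge> 1" "k \<ge> 1"
  shows "1 - phi < w_plus_dual i * psi ^ k" "w_plus_dual i * psi ^ k < 2 - phi"
proof -
  note w = w_plus_dual_bounds[OF assms(1)]
  have "w_plus_dual i * psi ^ k > 1 - phi \<and> w_plus_dual i * psi ^ k < 2 - phi"
  proof (cases "even k")
    case True
    with assms(2) have "k \<ge> 2" by (cases "k = 1") auto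
    have "1 / phi ^ k \<le> 1 / phi ^ 2"
      using \<open>k \<ge> 2\<close> phi_gt_1 by (intro divide_left_mono power_increasing) auto
    moreover have "w_plus_dual i * (1 / phi ^ k) < 1 * (1 / phi ^ k)"
      using w by (intro mult_strict_right_mono) auto
    moreover have "w_plus_dual i * (1 / phi ^ k) > 0" using w by simp
    ultimately show ?thesis using True phi_gt_1 by (simp add: psi_pow inverse_phi2)
  next
    case False
    have "1 / phi ^ k \<le> 1 / phi ^ 1"
      using assms phi_gt_1 by (intro divide_left_mono power_increasing) auto
    moreover have "w_plus_dual i * (1 / phi ^ k) < 1 * (1 / phi ^ k)"
      using w by (intro mult_strict_right_mono) auto
    moreover have "w_plus_dual i * (1 / phi ^ k) > 0" using w by simp
    ultimately show ?thesis using False phi_bounds by (simp add: psi_pow inverse_phi)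
  qed
  then show "1 - phi < w_plus_dual i * psi ^ k" "w_plus_dual i * psi ^ k < 2 - phi" by auto
qed

text \<open>Equal signs force exponents of equal parity, and the window of \<open>w_plus_dual\<close> has ratio \<open>phi ^ 2\<close>, which
  is too small for exponents that differ by 2 or more.\<close>

lemma conj_power_index_eq:
  assumes "i \<ge> 1" "j \<ge> 1" "w_plus_dual i * psi ^ k = w_plus_dual j * psi ^ l" "k \<le> l"
  shows "k = l"
proof (rule ccontr)
  assume "k \<noteq> l"
  define d where "d = l - k"
  have d: "l = k + d" "d \<ge> 1" using \<open>k \<noteq> l\<close> assms(4) by (auto simp: d_def)
  have "psi ^ k \<noteq> 0" by (simp add: psi_eq)
  with assms(3) d have e: "w_plus_dual i = w_plus_dual j * psi ^ d" by (simp add: power_add)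
  note wi = w_plus_dual_bounds[OF assms(1)] and wj = w_plus_dual_bounds[OF assms(2)]
  have "even d"
  proof (rule ccontr)
    assume "odd d"
    then have "psi ^ d < 0" by (simp add: psi_pow)
    with e wi wj show False by (metis mult_pos_neg order_less_asym)
  qed
  with d have "d \<ge> 2" by (cases "d = 1") auto
  then have "1 / phi ^ d \<le> 1 / phi ^ 2"
    using phi_gt_1 by (intro divide_left_mono power_increasing) auto
  moreover have "w_plus_dual j * (1 / phi ^ d) < 1 * (1 / phi ^ d)"
    using wj by (intro mult_strict_right_mono) auto
  ultimately show False using e wi \<open>even d\<close> by (simp add: psi_pow)
qed

lemma wythoff_inj:
  assumes "i \<ge> 1" "j \<ge> 1" "k \<ge> 1" "l \<ge> 1" "wythoff i (int k) = wythoff j (int l)"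
  shows "i = j \<and> k = l"
proof -
  define d where "d = wythoff j (int l + 1) - wythoff i (int k + 1)"
  have "of_int d = w_plus_dual i * psi ^ k - w_plus_dual j * psi ^ l"
    unfolding d_def wythoff_conj[symmetric] using assms(5) by simp
  then have "real_of_int d < 1" "real_of_int d > - 1"
    using wythoff_conj_window[OF assms(1,3)] wythoff_conj_window[OF assms(2,4)] by linarith+
  then have "d = 0" by linarith
  then have e: "w_plus_dual i * psi ^ k = w_plus_dual j * psi ^ l"
    using \<open>of_int d = _\<close> by simp
  then have kl: "k = l"
    using conj_power_index_eq[OF assms(1,2) e] conj_power_index_eq[OF assms(2,1) e[symmetric]] by linarith
  moreover have "psi ^ k \<noteq> 0" by (simp add: psi_eq)
  ultimately have "w_plus_dual i = w_plus_dual j" using e by simp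
  with row_inj[OF assms(1,2)] kl show ?thesis by simp
qed

text \<open>Going back \<open>k\<close> columns from an arbitrary pair of neighbours. The second clause transports
  positivity in the contrapositive form, as positive entries may have non-positive predecessors.\<close>

lemma wythoff_backwards:
  fixes c d :: int and k :: nat
  shows "\<exists>a b :: int. phi * of_int c - of_int d = (phi * of_int a - of_int b) * psi ^ k
     \<and> (a \<le> 0 \<and> b \<le> 0 \<longrightarrow> c \<le> 0 \<and> d \<le> 0)
     \<and> (\<forall>i. wythoff i 0 = a \<and> wythoff i 1 = b \<longrightarrow> wythoff i (int k) = c \<and> wythoff i (int k + 1) = d)"
proof (induction k arbitrary: c d)
  case 0
  show ?case by (rule exI[of _ c], rule exI[of _ d]) (intro conjI allI impI; simp)
next
  case (Suc k)
  from Suc.IH[of "d - c" c] obtain a b where ab: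
    "phi * of_int (d - c) - of_int c = (phi * of_int a - of_int b) * psi ^ k"
    "a \<le> 0 \<and> b \<le> 0 \<longrightarrow> d - c \<le> 0 \<and> c \<le> 0"
    "\<forall>i. wythoff i 0 = a \<and> wythoff i 1 = b \<longrightarrow> wythoff i (int k) = d - c \<and> wythoff i (int k + 1) = c"
    by (elim exE conjE) (rule that)
  have "phi * of_int c - of_int d = (phi * of_int (d - c) - of_int c) * psi"
    by (simp add: psi_def algebra_simps phi_sq phi_sq_left)
  also have "\<dots> = (phi * of_int a - of_int b) * psi ^ Suc k"
    unfolding ab(1) by simp
  finally have 1: "phi * of_int c - of_int d = (phi * of_int a - of_int b) * psi ^ Suc k" .
  have "wythoff i (int (Suc k)) = c \<and> wythoff i (int (Suc k) + 1) = d"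
    if "wythoff i 0 = a \<and> wythoff i 1 = b" for i
  proof -
    have k: "wythoff i (int k) = d - c" "wythoff i (int k + 1) = c" using spec[OF ab(3), of i] that by auto
    have "int (Suc k) = int k + 1" "int (Suc k) + 1 = int k + 2" by auto
    then show ?thesis using k wythoff_add2[of i "int k"] by presburger
  qed
  moreover have "c \<le> 0 \<and> d \<le> 0" if "a \<le> 0 \<and> b \<le> 0" using ab(2) that by linarith
  ultimately show ?case using 1 by (intro exI[of _ a] exI[of _ b] conjI allI impI) auto
qed

lemma geometric_window:
  fixes q e :: real
  assumes "0 < q" "q < 1" "0 < e" "e \<le> 1"
  shows "\<exists>l. q ^ Suc l < e \<and> e \<le> q ^ l"
proof -
  obtain n where n: "q ^ n < e" using real_arch_pow_inv[OF assms(3,2)] by blast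
  define l where "l = (LEAST n. q ^ n < e)"
  have l: "q ^ l < e" unfolding l_def by (rule LeastI) (rule n)
  with assms have "l \<noteq> 0" by (cases l) auto
  then obtain l' where l': "l = Suc l'" by (cases l) auto
  have "\<not> q ^ l' < e" using not_less_Least[of l' "\<lambda>n. q ^ n < e"] l' by (simp add: l_def)
  with l l' show ?thesis by auto
qed

text \<open>The right neighbour \<open>d\<close> of \<open>m\<close> is chosen so that the defect falls into the window of length 1. The
  column \<open>k\<close> is then found from the size and the sign of the defect, and \<open>k\<close> steps back give the
  beginning of a row.\<close>

lemma wythoff_surj:
  fixes m :: int
  assumes "m \<ge> 1"
  shows "\<exists>i k. i \<ge> 1 \<and> k \<ge> 1 \<and> wythoff i (int k) = m"
proof -
  \<comment> \<open>the half-open window for the defect of \<open>m\<close> and \<open>d\<close> has length 1 and upper end \<open>2 - phi = 1 / phi ^ 2\<close>\<close>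
  define d where "d = \<lceil>phi * of_int m - (2 - phi)\<rceil>"
  define e where "e = phi * of_int m - of_int d"
  have e: "1 - phi < e" "e \<le> 2 - phi" unfolding e_def d_def by linarith+
  have e0: "e \<noteq> 0" using phi_irrational[of "-d" m] assms by (auto simp: e_def algebra_simps)
  define Q where "Q = 1 / phi ^ 2"
  have Q: "0 < Q" "Q < 1" using phi_bounds unfolding Q_def inverse_phi2 by auto
  have "\<exists>k\<ge>1. 1 / phi ^ 2 < e / psi ^ k \<and> e / psi ^ k \<le> 1"
  proof (cases "e > 0")
    case True
    have "e / Q \<le> 1" using e Q by (simp add: Q_def inverse_phi2)
    with geometric_window[OF Q, of "e / Q"] True Q obtain l where l: "Q ^ Suc l < e / Q" "e / Q \<le> Q ^ l"
      by auto
    have p: "psi ^ (2 * Suc l) = Q * Q ^ l"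
      unfolding psi_pow power_mult by (simp add: Q_def power_divide)
    have "Q * Q ^ l > 0" using Q by simp
    then have "Q < e / (Q * Q ^ l) \<and> e / (Q * Q ^ l) \<le> 1" using l Q by (simp add: field_simps)
    then show ?thesis using p by (intro exI[of _ "2 * Suc l"]) (simp add: Q_def)
  next
    case False
    with e0 have en: "e < 0" by simp
    have "- e * phi \<le> (phi - 1) * phi" using e by (intro mult_right_mono) auto
    then have "- e * phi \<le> 1" by (simp add: algebra_simps phi_sq)
    moreover have "- e * phi > 0" using en by (simp add: mult_neg_pos)
    ultimately obtain l where l: "Q ^ Suc l < - e * phi" "- e * phi \<le> Q ^ l"
      using geometric_window[OF Q] by blast
    have p: "psi ^ Suc (2 * l) = - (Q ^ l) / phi"
      unfolding power_Suc psi_pow power_mult by (simp add: Q_def power_divide psi_eq)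
    have "Q ^ l > 0" using Q by simp
    then have "Q < e / (- (Q ^ l) / phi) \<and> e / (- (Q ^ l) / phi) \<le> 1" using l Q by (simp add: field_simps)
    then show ?thesis unfolding p[symmetric] by (intro exI[of _ "Suc (2 * l)"]) (simp add: Q_def)
  qed
  then obtain k where k: "k \<ge> 1" "1 / phi ^ 2 < e / psi ^ k" "e / psi ^ k \<le> 1" by blast
  obtain a b where ab:
    "phi * of_int m - of_int d = (phi * of_int a - of_int b) * psi ^ k"
    "a \<le> 0 \<and> b \<le> 0 \<longrightarrow> m \<le> 0 \<and> d \<le> 0"
    "\<forall>i. wythoff i 0 = a \<and> wythoff i 1 = b \<longrightarrow> wythoff i (int k) = m \<and> wythoff i (int k + 1) = d"
    using wythoff_backwards[of m d k] by (elim exE conjE) (rule that)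
  have "psi ^ k \<noteq> 0" by (simp add: psi_eq)
  then have "e / psi ^ k = phi * of_int a - of_int b" using ab(1) by (simp add: e_def)
  then obtain i where "i \<ge> 1" "wythoff i 0 = a" "wythoff i 1 = b"
    using row_exists[of a b] k ab(2) assms by auto
  with ab(3) k show ?thesis by blast
qed

section \<open>Comparison with Fibonacci numbers\<close>

text \<open>The identity of d'Ocagne for a row in place of the Fibonacci numbers. Modulo \<open>F\<^sub>n\<close> with \<open>n = Suc (k + m)\<close>
  it says that \<open>F\<^bsub>n-1\<^esub>\<close> times an entry is the dual entry up to sign.\<close>

lemma fib_wythoff:
  "int (fib (k + m)) * wythoff i (int k + 1) - int (fib (Suc (k + m))) * wythoff i (int k)
     = (-1) ^ Suc k * wythoff_dual i m"
proof -
  have "(sqrt 5 * real (fib (k + m))) * (sqrt 5 * of_int (wythoff i (int (Suc k))))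
      - (sqrt 5 * real (fib (Suc (k + m)))) * (sqrt 5 * of_int (wythoff i (int k)))
      = (-1) ^ Suc k * sqrt 5 * (sqrt 5 * of_int (wythoff_dual i m))"
  proof -
    have pk: "phi ^ k * psi ^ k = (-1) ^ k" by (simp add: power_mult_distrib[symmetric] phi_psi)
    have "(phi ^ (k + m) - psi ^ (k + m)) * (w_plus i * phi ^ Suc k + w_plus_dual i * psi ^ Suc k)
      - (phi ^ Suc (k + m) - psi ^ Suc (k + m)) * (w_plus i * phi ^ k + w_plus_dual i * psi ^ k)
      = (phi ^ k * psi ^ k) * (psi - phi) * (w_plus_dual i * phi ^ m + w_plus i * psi ^ m)"
      by (simp add: power_add algebra_simps)
    also have "psi - phi = - sqrt 5" by (simp add: psi_def sqrt5_eq)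
    finally show ?thesis unfolding fib_closed wythoff_closed wythoff_dual_closed pk by simp
  qed
  moreover have "(sqrt 5 * a) * (sqrt 5 * b) - (sqrt 5 * c) * (sqrt 5 * d) = 5 * (a * b - c * d)"
    for a b c d :: real by (simp add: algebra_simps flip: mult.assoc)
  moreover have "e * sqrt 5 * (sqrt 5 * d) = 5 * (e * d)" for d e :: real
    by (simp add: algebra_simps flip: mult.assoc)
  ultimately have "real (fib (k + m)) * of_int (wythoff i (int (Suc k))) - real (fib (Suc (k + m))) * of_int (wythoff i (int k))
      = (-1) ^ Suc k * of_int (wythoff_dual i m)"
    by simp
  then have "real_of_int (int (fib (k + m)) * wythoff i (int k + 1) - int (fib (Suc (k + m))) * wythoff i (int k))
     = real_of_int ((-1) ^ Suc k * wythoff_dual i m)"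
    by (simp add: algebra_simps)
  then show ?thesis unfolding of_int_eq_iff .
qed

lemma mu_bounds:
  assumes "i \<ge> 1"
  shows "phi ^ mu i \<le> 2 * w_plus i" "2 * w_plus i < phi ^ Suc (mu i)"
proof -
  have p: "2 * w_plus i > 0" using w_plus_ge_phi[OF assms] phi_gt_1 by linarith
  have l: "phi powr (log phi (2 * w_plus i)) = 2 * w_plus i" using p phi_gt_1 by simp
  have m: "real (mu i) = of_int \<lfloor>log phi (2 * w_plus i)\<rfloor>" using int_mu[OF assms] by linarith
  have "phi powr real (mu i) \<le> phi powr (log phi (2 * w_plus i))"
    using phi_gt_1 m by (intro powr_mono) linarith+
  then show "phi ^ mu i \<le> 2 * w_plus i" unfolding l by (simp add: powr_realpow)
  have "phi powr (log phi (2 * w_plus i)) < phi powr real (Suc (mu i))"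
    using phi_gt_1 m by (intro powr_less_mono) linarith+
  then show "2 * w_plus i < phi ^ Suc (mu i)" unfolding l by (subst (asm) powr_realpow) auto
qed

lemma mu_ge_2: "i \<ge> 1 \<Longrightarrow> mu i \<ge> 2"
proof (rule ccontr)
  assume i: "i \<ge> 1" and "\<not> mu i \<ge> 2"
  then have "phi ^ Suc (mu i) \<le> phi ^ 2" using phi_gt_1 by (intro power_increasing) auto
  with mu_bounds(2)[OF i] w_plus_ge_phi[OF i] show False using phi_bounds by (simp add: phi_pow2)
qed

lemma wythoff_pos:
  assumes "i \<ge> 1" shows "wythoff i (int k) > 0"
proof (induction k rule: fib.induct)
  case 1 then show ?case using wythoff_0_ge[of i] assms by simp
next
  case 2 then show ?case using wythoff_1_ge[of i] assms by simp
next
  case (3 k)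
  then show ?case using wythoff_add2[of i "int k"] by (simp add: algebra_simps)
qed

lemma fib_le_wythoff:
  assumes "i \<ge> 1" shows "int (fib (Suc k)) \<le> wythoff i (int k)"
proof (induction k rule: fib.induct)
  case 1 then show ?case using wythoff_0_ge[of i] assms by simp
next
  case 2 then show ?case using wythoff_1_ge[of i] assms by simp
next
  case (3 k)
  have "wythoff i (int (Suc (Suc k))) = wythoff i (int (Suc k)) + wythoff i (int k)"
    using wythoff_add2[of i "int k"] by (simp add: algebra_simps)
  with 3 show ?case by simp
qed

lemma twice_wythoff_minus_fib:
  "sqrt 5 * of_int (2 * wythoff i (int k) - int (fib (k + m)))
     = (2 * w_plus i - phi ^ m) * phi ^ k + (2 * w_plus_dual i + psi ^ m) * psi ^ k"
proof -
  have "sqrt 5 * of_int (2 * wythoff i (int k) - int (fib (k + m)))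
     = 2 * (sqrt 5 * of_int (wythoff i (int k))) - sqrt 5 * real (fib (k + m))"
    by (simp add: algebra_simps)
  then show ?thesis unfolding wythoff_closed fib_closed by (simp add: algebra_simps power_add)
qed

text \<open>The number \<open>2 * wythoff i k - fib (k + m)\<close> is an integer and, times \<open>sqrt 5\<close>, differs from
  \<open>(2 * w_plus i - phi ^ m) * phi ^ k\<close> by less than \<open>sqrt 5\<close>. Hence its sign is governed by
  comparing \<open>m\<close> with \<open>mu i\<close>.\<close>

lemma half_error_bound:
  assumes "i \<ge> 1" "k \<ge> 1"
  shows "\<bar>(2 * w_plus_dual i + psi ^ m) * psi ^ k\<bar> < sqrt 5"
proof -
  have "1 / phi ^ m \<le> 1" using phi_gt_1 by (simp add: one_le_power)
  then have "\<bar>psi ^ m\<bar> \<le> 1" by (simp add: abs_psi_pow)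
  then have a: "\<bar>2 * w_plus_dual i + psi ^ m\<bar> \<le> 3"
    using w_plus_dual_bounds[OF assms(1)] by linarith
  have "1 / phi ^ k \<le> 1 / phi ^ 1"
    using assms phi_gt_1 by (intro divide_left_mono power_increasing) auto
  then have b: "\<bar>psi ^ k\<bar> \<le> phi - 1" unfolding abs_psi_pow by (simp add: inverse_phi)
  have "\<bar>(2 * w_plus_dual i + psi ^ m) * psi ^ k\<bar> \<le> 3 * (phi - 1)"
    unfolding abs_mult using a b by (intro mult_mono) auto
  also have "\<dots> < sqrt 5" using phi_bounds by (simp add: sqrt5_eq)
  finally show ?thesis .
qed

lemma wythoff_le_half:
  assumes "i \<ge> 1" "k \<ge> 1" "m > mu i"
  shows "2 * wythoff i (int k) \<le> int (fib (k + m))"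
proof (rule ccontr)
  assume "\<not> ?thesis"
  then have "1 \<le> 2 * wythoff i (int k) - int (fib (k + m))" by simp
  then have "sqrt 5 * 1 \<le> sqrt 5 * real_of_int (2 * wythoff i (int k) - int (fib (k + m)))"
    by (intro mult_left_mono) auto
  moreover have "phi ^ Suc (mu i) \<le> phi ^ m" using phi_gt_1 assms by (intro power_increasing) auto
  then have "(2 * w_plus i - phi ^ m) * phi ^ k \<le> 0"
    using mu_bounds[OF assms(1)] by (simp add: mult_nonpos_nonneg)
  ultimately show False
    unfolding twice_wythoff_minus_fib using half_error_bound[OF assms(1,2), of m] by linarith
qed

lemma wythoff_ge_half:
  assumes "i \<ge> 1" "k \<ge> 1" "n \<le> k + mu i"
  shows "int (fib n) \<le> 2 * wythoff i (int k)"
proof (cases "n \<le> k")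
  case True
  then have "fib n \<le> fib (Suc k)" by (intro fib_mono) simp
  with fib_le_wythoff[OF assms(1), of k] wythoff_pos[OF assms(1), of k] show ?thesis by linarith
next
  case False
  define m where "m = n - k"
  have m: "n = k + m" "m \<le> mu i" using False assms by (auto simp: m_def)
  show ?thesis
  proof (rule ccontr)
    assume "\<not> ?thesis"
    then have "2 * wythoff i (int k) - int (fib (k + m)) \<le> - 1" by (simp add: m)
    then have "real_of_int (2 * wythoff i (int k) - int (fib (k + m))) \<le> - 1" by linarith
    then have "sqrt 5 * real_of_int (2 * wythoff i (int k) - int (fib (k + m))) \<le> sqrt 5 * (- 1)"
      by (intro mult_left_mono) auto
    moreover have "phi ^ m \<le> phi ^ mu i" using phi_gt_1 m by (intro power_increasing) auto
    then have "(2 * w_plus i - phi ^ m) * phi ^ k \<ge> 0"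
      using mu_bounds[OF assms(1)] by (intro mult_nonneg_nonneg) auto
    ultimately show False
      unfolding twice_wythoff_minus_fib using half_error_bound[OF assms(1,2), of m] by linarith
  qed
qed

section \<open>Uniform geometric approximation\<close>

text \<open>Approximation that is uniform over all rows \<open>i\<close> and geometric in the distances \<open>k\<close> and \<open>j\<close> from the
  two ends of a row. It is stable under products and Lipschitz maps, so each factor of a summand
  can be treated separately.\<close>

definition near :: "real \<Rightarrow> (nat \<Rightarrow> nat \<Rightarrow> nat \<Rightarrow> real) \<Rightarrow> real \<Rightarrow> bool" where
  "near q X p \<longleftrightarrow> (\<exists>B\<ge>0. \<forall>i\<ge>1. \<forall>k\<ge>1. \<forall>j\<ge>1. \<bar>X i k j - p\<bar> \<le> B * (q ^ k + q ^ j))"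

lemma nearI:
  assumes "B \<ge> 0" "\<And>i k j. i \<ge> 1 \<Longrightarrow> k \<ge> 1 \<Longrightarrow> j \<ge> 1 \<Longrightarrow> \<bar>X i k j - p\<bar> \<le> B * (q ^ k + q ^ j)"
  shows "near q X p"
  unfolding near_def using assms by blast

lemma nearE:
  assumes "near q X p"
  obtains B where "B \<ge> 0" "\<And>i k j. i \<ge> 1 \<Longrightarrow> k \<ge> 1 \<Longrightarrow> j \<ge> 1 \<Longrightarrow> \<bar>X i k j - p\<bar> \<le> B * (q ^ k + q ^ j)"
  using assms unfolding near_def by blast

lemma near_bounded:
  assumes "near q X p" "0 \<le> q" "q \<le> 1"
  obtains M where "M \<ge> 0" "\<And>i k j. i \<ge> 1 \<Longrightarrow> k \<ge> 1 \<Longrightarrow> j \<ge> 1 \<Longrightarrow> \<bar>X i k j\<bar> \<le> M"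
proof -
  obtain B where B: "B \<ge> 0" "\<And>i k j. i \<ge> 1 \<Longrightarrow> k \<ge> 1 \<Longrightarrow> j \<ge> 1 \<Longrightarrow> \<bar>X i k j - p\<bar> \<le> B * (q ^ k + q ^ j)"
    using nearE[OF assms(1)] by metis
  show ?thesis
  proof (rule that[of "\<bar>p\<bar> + B * 2"])
    fix i k j :: nat assume a: "i \<ge> 1" "k \<ge> 1" "j \<ge> 1"
    have "q ^ k \<le> 1" "q ^ j \<le> 1" using assms by (auto intro: power_le_one)
    then have "B * (q ^ k + q ^ j) \<le> B * 2" using B(1) by (intro mult_left_mono) auto
    with B(2)[OF a] show "\<bar>X i k j\<bar> \<le> \<bar>p\<bar> + B * 2" by linarith
  qed (use B in auto)
qed

lemma near_mult:
  assumes "near q X p" "near q Y r" "0 \<le> q" "q \<le> 1"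
  shows "near q (\<lambda>i k j. X i k j * Y i k j) (p * r)"
proof -
  obtain B where B: "B \<ge> 0" "\<And>i k j. i \<ge> 1 \<Longrightarrow> k \<ge> 1 \<Longrightarrow> j \<ge> 1 \<Longrightarrow> \<bar>X i k j - p\<bar> \<le> B * (q ^ k + q ^ j)"
    using nearE[OF assms(1)] by metis
  obtain B' where B': "B' \<ge> 0" "\<And>i k j. i \<ge> 1 \<Longrightarrow> k \<ge> 1 \<Longrightarrow> j \<ge> 1 \<Longrightarrow> \<bar>Y i k j - r\<bar> \<le> B' * (q ^ k + q ^ j)"
    using nearE[OF assms(2)] by metis
  obtain M where M: "M \<ge> 0" "\<And>i k j. i \<ge> 1 \<Longrightarrow> k \<ge> 1 \<Longrightarrow> j \<ge> 1 \<Longrightarrow> \<bar>Y i k j\<bar> \<le> M"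
    using near_bounded[OF assms(2-4)] by metis
  show ?thesis
  proof (rule nearI[of "B * M + \<bar>p\<bar> * B'"])
    fix i k j :: nat assume a: "i \<ge> 1" "k \<ge> 1" "j \<ge> 1"
    have s: "q ^ k + q ^ j \<ge> 0" using assms by simp
    have "X i k j * Y i k j - p * r = (X i k j - p) * Y i k j + p * (Y i k j - r)"
      by (simp add: algebra_simps)
    then have "\<bar>X i k j * Y i k j - p * r\<bar> \<le> \<bar>X i k j - p\<bar> * \<bar>Y i k j\<bar> + \<bar>p\<bar> * \<bar>Y i k j - r\<bar>"
      using abs_triangle_ineq by (metis abs_mult)
    also have "\<dots> \<le> (B * (q ^ k + q ^ j)) * M + \<bar>p\<bar> * (B' * (q ^ k + q ^ j))"
      using B(2)[OF a] B'(2)[OF a] M(2)[OF a] M(1) B(1) s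
      by (intro add_mono mult_mono mult_left_mono) auto
    finally show "\<bar>X i k j * Y i k j - p * r\<bar> \<le> (B * M + \<bar>p\<bar> * B') * (q ^ k + q ^ j)"
      by (simp add: algebra_simps)
  qed (use B B' M in auto)
qed

lemma near_lipschitz:
  assumes "near q X p" "C \<ge> 0"
    and "\<And>i k j. i \<ge> 1 \<Longrightarrow> k \<ge> 1 \<Longrightarrow> j \<ge> 1 \<Longrightarrow> \<bar>F (X i k j) - r\<bar> \<le> C * \<bar>X i k j - p\<bar>"
  shows "near q (\<lambda>i k j. F (X i k j)) r"
proof -
  obtain B where B: "B \<ge> 0" "\<And>i k j. i \<ge> 1 \<Longrightarrow> k \<ge> 1 \<Longrightarrow> j \<ge> 1 \<Longrightarrow> \<bar>X i k j - p\<bar> \<le> B * (q ^ k + q ^ j)"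
    using nearE[OF assms(1)] by metis
  show ?thesis
  proof (rule nearI[of "C * B"])
    fix i k j :: nat assume a: "i \<ge> 1" "k \<ge> 1" "j \<ge> 1"
    show "\<bar>F (X i k j) - r\<bar> \<le> C * B * (q ^ k + q ^ j)"
      using assms(3)[OF a] mult_left_mono[OF B(2)[OF a] assms(2)] by (simp add: mult.assoc)
  qed (use B assms in auto)
qed

lemma near_mono:
  assumes "near q X p" "0 \<le> q" "q \<le> q'"
  shows "near q' X p"
proof -
  obtain B where B: "B \<ge> 0" "\<And>i k j. i \<ge> 1 \<Longrightarrow> k \<ge> 1 \<Longrightarrow> j \<ge> 1 \<Longrightarrow> \<bar>X i k j - p\<bar> \<le> B * (q ^ k + q ^ j)"
    using nearE[OF assms(1)] by metis
  show ?thesis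
  proof (rule nearI[of B])
    fix i k j :: nat assume a: "i \<ge> 1" "k \<ge> 1" "j \<ge> 1"
    have "q ^ k + q ^ j \<le> q' ^ k + q' ^ j" using assms by (intro add_mono power_mono) auto
    then show "\<bar>X i k j - p\<bar> \<le> B * (q' ^ k + q' ^ j)"
      using B(2)[OF a] mult_left_mono[OF _ B(1)] order_trans by blast
  qed (rule B)
qed

lemma near_inverse:
  assumes "near q X 1" "0 < a" "\<And>i k j. i \<ge> 1 \<Longrightarrow> k \<ge> 1 \<Longrightarrow> j \<ge> 1 \<Longrightarrow> a \<le> X i k j"
  shows "near q (\<lambda>i k j. 1 / X i k j) 1"
proof (rule near_lipschitz[where F = "\<lambda>x. 1 / x" and C = "1 / a", OF assms(1)])
  fix i k j :: nat assume a: "i \<ge> 1" "k \<ge> 1" "j \<ge> 1"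
  note x = assms(3)[OF a]
  have "1 / X i k j - 1 = (1 - X i k j) / X i k j" using x assms(2) by (simp add: field_simps)
  then have "\<bar>1 / X i k j - 1\<bar> = \<bar>X i k j - 1\<bar> / X i k j" using x assms(2) by (simp add: abs_minus_commute)
  also have "\<dots> \<le> \<bar>X i k j - 1\<bar> / a" using x assms(2) by (intro divide_left_mono) auto
  finally show "\<bar>1 / X i k j - 1\<bar> \<le> 1 / a * \<bar>X i k j - 1\<bar>" by simp
qed (use assms in auto)

text \<open>The exponent is at least 1, so the derivative of the power stays bounded near 0 and positivity of
  \<open>x\<close> suffices on that side.\<close>

lemma powr_lipschitz_at_1:
  fixes x b s :: real
  assumes "0 < x" "x \<le> b" "1 \<le> b" "1 \<le> s"
  shows "\<bar>x powr s - 1\<bar> \<le> s * b powr (s - 1) * \<bar>x - 1\<bar>"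
proof -
  have d: "((\<lambda>x. x powr s) has_field_derivative s * y powr (s - 1)) (at y within {0<..b})"
    if "y \<in> {0<..b}" for y
    by (rule has_field_derivative_at_within, rule has_real_derivative_powr) (use that in auto)
  have "norm (x powr s - 1 powr s) \<le> (s * b powr (s - 1)) * norm (x - 1)"
  proof (rule field_differentiable_bound[OF _ d])
    fix y assume "y \<in> {0<..b}"
    then show "norm (s * y powr (s - 1)) \<le> s * b powr (s - 1)"
      using assms by (auto simp: abs_mult intro!: mult_left_mono powr_mono2)
  qed (use assms in auto)
  then show ?thesis by simp
qed

lemma near_powr:
  assumes "near q X 1" "0 \<le> q" "q \<le> 1" "1 \<le> s"
    and "\<And>i k j. i \<ge> 1 \<Longrightarrow> k \<ge> 1 \<Longrightarrow> j \<ge> 1 \<Longrightarrow> 0 < X i k j"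
  shows "near q (\<lambda>i k j. X i k j powr s) 1"
proof -
  obtain M where M: "M \<ge> 0" "\<And>i k j. i \<ge> 1 \<Longrightarrow> k \<ge> 1 \<Longrightarrow> j \<ge> 1 \<Longrightarrow> \<bar>X i k j\<bar> \<le> M"
    using near_bounded[OF assms(1-3)] by metis
  define b where "b = max M 1"
  show ?thesis
  proof (rule near_lipschitz[where F = "\<lambda>x. x powr s" and C = "s * b powr (s - 1)", OF assms(1)])
    fix i k j :: nat assume a: "i \<ge> 1" "k \<ge> 1" "j \<ge> 1"
    show "\<bar>X i k j powr s - 1\<bar> \<le> s * b powr (s - 1) * \<bar>X i k j - 1\<bar>"
      by (rule powr_lipschitz_at_1) (use M(2)[OF a] assms(4) assms(5)[OF a] in \<open>auto simp: b_def\<close>)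
  qed (use assms in auto)
qed

section \<open>The sine\<close>

lemma sin_mvt:
  fixes t :: real
  assumes "0 < t"
  obtains z where "0 < z" "z < t" "sin t = t * cos z"
proof -
  have "\<exists>z>0. z < t \<and> sin t - sin 0 = (t - 0) * cos z"
    by (rule MVT2) (use assms in \<open>auto intro!: derivative_eq_intros\<close>)
  then show ?thesis using that by auto
qed

text \<open>Up to \<open>pi / 4\<close> the mean value theorem applies with a cosine of at least \<open>sqrt 2 / 2\<close>; from there to
  \<open>3 * pi / 4\<close> the sine itself is at least \<open>sqrt 2 / 2\<close>.\<close>

lemma sin_lower:
  fixes t :: real
  assumes "0 \<le> t" "t \<le> 3 / 4 * pi"
  shows "t / 6 \<le> sin t"
proof (cases "t \<le> pi / 4")
  case True
  show ?thesis
  proof (cases "t = 0")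
    case False
    with assms obtain z where z: "0 < z" "z < t" "sin t = t * cos z" using sin_mvt[of t] by auto
    have "cos (pi / 4) \<le> cos z" using z True by (intro cos_monotone_0_pi_le) auto
    moreover have "sqrt 2 \<ge> (1::real)" by simp
    ultimately have "1 / 6 \<le> cos z" unfolding cos_45 by linarith
    then have "t * (1 / 6) \<le> t * cos z" using assms by (intro mult_left_mono) auto
    with z show ?thesis by simp
  qed simp
next
  case False
  have s: "sin (pi / 4) \<le> sin t"
  proof (cases "t \<le> pi / 2")
    case True
    with False show ?thesis by (intro sin_monotone_2pi_le) auto
  next
    case f: False
    have "sin (pi / 4) \<le> sin (pi - t)" using f assms by (intro sin_monotone_2pi_le) auto
    then show ?thesis by simp
  qed
  have "t \<le> 3" using assms pi_less_4 by simp
  then have "t / 6 \<le> 1 / 2" by simp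
  also have "1 / 2 \<le> sin (pi / 4)" by (simp add: sin_45)
  finally show ?thesis using s by simp
qed

lemma sin_defect:
  fixes t :: real
  assumes "0 < t" shows "t - sin t \<le> t * t"
proof -
  obtain z where z: "0 < z" "z < t" "sin t = t * cos z" using sin_mvt[OF assms] .
  have "1 - cos z \<le> t"
  proof -
    have "cos z = cos (2 * (z / 2))" by simp
    then have "1 - cos z = 2 * (sin (z / 2) * sin (z / 2))"
      by (simp only: cos_double_sin power2_eq_square)
    also have "sin (z / 2) * sin (z / 2) \<le> \<bar>sin (z / 2)\<bar> * 1"
      using mult_left_mono[OF abs_sin_le_one[of "z / 2"] abs_ge_zero[of "sin (z / 2)"]] by simp
    also have "2 * (\<bar>sin (z / 2)\<bar> * 1) \<le> 2 * (z / 2)" using abs_sin_x_le_abs_x[of "z / 2"] z by simp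
    finally show ?thesis using z by simp
  qed
  then have "t * (1 - cos z) \<le> t * t" using assms by (intro mult_left_mono) auto
  with z show ?thesis by (simp add: algebra_simps)
qed

text \<open>The reciprocal of the cardinal sine of \<open>pi * x\<close>.\<close>

definition inv_sinc :: "real \<Rightarrow> real" where "inv_sinc x = pi * x / sin (pi * x)"

lemma inv_sinc_bound:
  assumes "0 < x" "x \<le> 3 / 4"
  shows "\<bar>inv_sinc x - 1\<bar> \<le> 6 * pi * \<bar>x\<bar>" and inv_sinc_pos: "0 < inv_sinc x" and sin_pix_pos: "0 < sin (pi * x)"
proof -
  define t where "t = pi * x"
  have t: "0 < t" using assms by (simp add: t_def)
  have "pi * x \<le> pi * (3 / 4)" using assms by (intro mult_left_mono) auto
  then have l: "t / 6 \<le> sin t" using t by (intro sin_lower) (auto simp: t_def)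
  with t have sp: "0 < sin t" by linarith
  show "0 < sin (pi * x)" using sp by (simp add: t_def)
  show "0 < inv_sinc x" unfolding inv_sinc_def using sp t by (simp add: t_def)
  have d: "0 \<le> t - sin t" using t sin_x_le_x[of t] by simp
  have "inv_sinc x - 1 = (t - sin t) / sin t" unfolding inv_sinc_def using sp by (simp add: t_def field_simps)
  also have "\<dots> \<le> (t * t) / (t / 6)" using sin_defect[OF t] l t d by (intro frac_le) auto
  also have "\<dots> = 6 * t" using t by simp
  finally have "inv_sinc x - 1 \<le> 6 * t" .
  moreover have "0 \<le> inv_sinc x - 1"
    unfolding inv_sinc_def using sp d by (simp add: t_def field_simps)
  ultimately show "\<bar>inv_sinc x - 1\<bar> \<le> 6 * pi * \<bar>x\<bar>" using assms by (simp add: t_def mult.assoc)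
qed

section \<open>Entries of a row relative to a Fibonacci number\<close>

text \<open>An entry and its dual are considered relative to \<open>F\<^sub>n\<close> with \<open>n = k + mu i + j\<close>. Both \<open>k\<close> and \<open>j\<close> start
  from 1, and they are the distances to the two ends of the row: \<open>yarg\<close> is small for large \<open>k\<close>, and
  \<open>xarg\<close> is small for large \<open>j\<close>.\<close>

definition xarg :: "nat \<Rightarrow> nat \<Rightarrow> nat \<Rightarrow> real" where
  "xarg i k j = of_int (wythoff i (int k)) / real (fib (k + (mu i + j)))"

definition yarg :: "nat \<Rightarrow> nat \<Rightarrow> nat \<Rightarrow> real" where
  "yarg i k j = of_int (wythoff_dual i (mu i + j)) / real (fib (k + (mu i + j)))"

text \<open>The correction factors \<open>ufac\<close>, \<open>vfac\<close> and \<open>zfac\<close> compare a Fibonacci number, an entry and a dual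
  entry with the leading terms of their closed forms.\<close>

definition ufac :: "nat \<Rightarrow> nat \<Rightarrow> nat \<Rightarrow> real" where
  "ufac i k j = 1 - (psi / phi) ^ (k + (mu i + j))"

definition vfac :: "nat \<Rightarrow> nat \<Rightarrow> nat \<Rightarrow> real" where
  "vfac i k j = 1 + w_plus_dual i / w_plus i * (psi / phi) ^ k"

definition zfac :: "nat \<Rightarrow> nat \<Rightarrow> nat \<Rightarrow> real" where
  "zfac i k j = 1 + w_plus i / w_plus_dual i * (psi / phi) ^ (mu i + j)"

lemma fib_ufac: "sqrt 5 * real (fib (k + (mu i + j))) = phi ^ (k + (mu i + j)) * ufac i k j"
  unfolding fib_closed ufac_def by (simp add: power_divide right_diff_distrib)

lemma wythoff_vfac: "i \<ge> 1 \<Longrightarrow> sqrt 5 * of_int (wythoff i (int k)) = w_plus i * phi ^ k * vfac i k j"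
  unfolding wythoff_closed vfac_def using w_plus_ge_phi[of i] phi_gt_1
  by (simp add: power_divide distrib_left)

lemma wythoff_dual_zfac:
  "i \<ge> 1 \<Longrightarrow> sqrt 5 * of_int (wythoff_dual i (mu i + j)) = w_plus_dual i * phi ^ (mu i + j) * zfac i k j"
  unfolding wythoff_dual_closed zfac_def using w_plus_dual_bounds[of i]
  by (simp add: power_divide distrib_left)

lemma abs_psi_phi_pow: "\<bar>(psi / phi) ^ n\<bar> = (1 / phi) ^ n * (1 / phi) ^ n"
  by (simp add: power_divide abs_psi_pow power_abs abs_psi flip: power_mult_distrib)

lemma inv_phi_pow_le_1: "(1 / phi) ^ n \<le> 1"
  using phi_gt_1 by (intro power_le_one) auto

lemma inv_phi_pow_antimono: "m \<le> n \<Longrightarrow> (1 / phi) ^ n \<le> (1 / phi) ^ m"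
  using phi_gt_1 by (intro power_decreasing) auto

lemma ufac_bound: "\<bar>ufac i k j - 1\<bar> \<le> (1 / phi) ^ k"
proof -
  have "(1 / phi) ^ (k + (mu i + j)) * (1 / phi) ^ (k + (mu i + j)) \<le> (1 / phi) ^ k * 1"
    by (intro mult_mono inv_phi_pow_le_1 inv_phi_pow_antimono) auto
  then show ?thesis unfolding ufac_def using abs_psi_phi_pow[of "k + (mu i + j)"] by simp
qed

text \<open>Here \<open>w_plus_dual i / w_plus i < 1 / phi\<close>, so the second term of the closed form never dominates.\<close>

lemma vfac_bound:
  assumes "i \<ge> 1" "k \<ge> 1"
  shows "\<bar>vfac i k j - 1\<bar> \<le> (1 / phi) ^ k" "1 / 2 \<le> vfac i k j" "vfac i k j \<le> 3 / 2"
proof -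
  note w = w_plus_dual_bounds[OF assms(1)] w_plus_ge_phi[OF assms(1)]
  have r: "0 \<le> w_plus_dual i / w_plus i" "w_plus_dual i / w_plus i \<le> 1 / phi"
    using w phi_gt_1 by (auto intro: frac_le)
  have e: "\<bar>vfac i k j - 1\<bar> = w_plus_dual i / w_plus i * ((1 / phi) ^ k * (1 / phi) ^ k)"
    unfolding vfac_def using abs_psi_phi_pow[of k] w phi_gt_1 by (simp add: abs_mult)
  also have "\<dots> \<le> 1 / phi * ((1 / phi) ^ k * (1 / phi) ^ 1)"
    by (intro mult_mono r inv_phi_pow_antimono assms) (use phi_gt_1 in auto)
  also have "\<dots> = (1 / phi ^ 2) * (1 / phi) ^ k" by (simp add: power2_eq_square)
  finally have b: "\<bar>vfac i k j - 1\<bar> \<le> (2 - phi) * (1 / phi) ^ k" unfolding inverse_phi2 .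
  also have "\<dots> \<le> 1 * (1 / phi) ^ k" using phi_gt_1 by (intro mult_right_mono) auto
  finally show "\<bar>vfac i k j - 1\<bar> \<le> (1 / phi) ^ k" by simp
  have "(2 - phi) * (1 / phi) ^ k \<le> (2 - phi) * 1"
    using phi_bounds by (intro mult_left_mono inv_phi_pow_le_1) auto
  with b have "\<bar>vfac i k j - 1\<bar> \<le> 2 - phi" by (rule order_trans[OF _ order_trans]) simp
  then have "vfac i k j - 1 \<le> 2 - phi" "1 - vfac i k j \<le> 2 - phi" by linarith+
  with phi_bounds show "1 / 2 \<le> vfac i k j" "vfac i k j \<le> 3 / 2" by simp_all
qed

lemma w_plus_mu: "i \<ge> 1 \<Longrightarrow> w_plus i * (1 / phi) ^ mu i \<le> phi / 2"
  using mu_bounds(2)[of i] by (simp add: field_simps power_divide)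

text \<open>The quotient \<open>w_plus i / w_plus_dual i\<close> is unbounded, but \<open>phi ^ mu i\<close> is of the same order as
  \<open>w_plus i\<close> and compensates for it.\<close>

lemma zfac_bound:
  assumes "i \<ge> 1" "j \<ge> 1"
  shows "\<bar>zfac i k j - 1\<bar> \<le> (1 / phi) ^ j" "1 / 2 \<le> zfac i k j" "zfac i k j \<le> 3 / 2"
proof -
  note w = w_plus_dual_bounds[OF assms(1)] w_plus_ge_phi[OF assms(1)]
  have inv: "0 \<le> 1 / w_plus_dual i" "1 / w_plus_dual i \<le> phi ^ 2"
    using w by (auto simp: field_simps)
  have b: "\<bar>zfac i k j - 1\<bar> = 1 / w_plus_dual i * ((w_plus i * (1 / phi) ^ mu i) * ((1 / phi) ^ j * (1 / phi) ^ (mu i + j)))"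
    unfolding zfac_def using abs_psi_phi_pow[of "mu i + j"] w phi_gt_1 by (simp add: abs_mult power_add algebra_simps)
  also have "\<dots> \<le> phi ^ 2 * ((phi / 2) * ((1 / phi) ^ j * (1 / phi) ^ 3))"
    using mu_ge_2[OF assms(1)] assms(2) w phi_gt_1
    by (intro mult_mono inv w_plus_mu assms inv_phi_pow_antimono order_refl mult_nonneg_nonneg) auto
  also have "\<dots> = 1 / 2 * (1 / phi) ^ j" by (simp add: power_divide eval_nat_numeral)
  finally have c: "\<bar>zfac i k j - 1\<bar> \<le> 1 / 2 * (1 / phi) ^ j" .
  also have "\<dots> \<le> 1 * (1 / phi) ^ j" by (intro mult_right_mono) auto
  finally show "\<bar>zfac i k j - 1\<bar> \<le> (1 / phi) ^ j" by simp
  show "1 / 2 \<le> zfac i k j" "zfac i k j \<le> 3 / 2"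
    using c inv_phi_pow_le_1[of j] by linarith+
qed

lemma inv_phi_cube: "(1 / phi) ^ 3 = 2 * phi - 3"
  unfolding inverse_phi by (simp add: eval_nat_numeral algebra_simps phi_sq phi_sq_left)

text \<open>The index \<open>k + mu i + j\<close> is at least 3, because \<open>mu i \<ge> 2\<close>. The precise lower bound matters only for
  the bound 3/4 on \<open>yarg\<close>.\<close>

lemma ufac_range:
  assumes "i \<ge> 1" "k \<ge> 1"
  shows "47 / 50 \<le> ufac i k j" "ufac i k j \<le> 2"
proof -
  let ?n = "k + (mu i + j)"
  have "?n \<ge> 3" using mu_ge_2[OF assms(1)] assms(2) by simp
  then have "(1 / phi) ^ ?n * (1 / phi) ^ ?n \<le> (1 / phi) ^ 3 * (1 / phi) ^ 3"
    by (intro mult_mono inv_phi_pow_antimono) auto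
  also have "\<dots> = 13 - 8 * phi" unfolding inv_phi_cube by (simp add: algebra_simps phi_sq_left)
  also have "\<dots> \<le> 3 / 50" using phi_bounds by simp
  finally have "\<bar>(psi / phi) ^ ?n\<bar> \<le> 3 / 50" unfolding abs_psi_phi_pow .
  then show "47 / 50 \<le> ufac i k j" "ufac i k j \<le> 2" unfolding ufac_def by linarith+
qed

lemma xarg_eq:
  assumes "i \<ge> 1"
  shows "xarg i k j = (w_plus i * (1 / phi) ^ mu i) * (1 / phi) ^ j * vfac i k j / ufac i k j"
proof -
  have "xarg i k j = (sqrt 5 * of_int (wythoff i (int k))) / (sqrt 5 * real (fib (k + (mu i + j))))"
    by (simp add: xarg_def)
  also have "\<dots> = (w_plus i * (1 / phi) ^ mu i) * (1 / phi) ^ j * vfac i k j / ufac i k j"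
    unfolding fib_ufac wythoff_vfac[OF assms, of k j] by (simp add: power_add power_divide)
  finally show ?thesis .
qed

lemma yarg_eq:
  assumes "i \<ge> 1"
  shows "yarg i k j = (1 / phi) ^ k * (w_plus_dual i * zfac i k j) / ufac i k j"
proof -
  have "yarg i k j = (sqrt 5 * of_int (wythoff_dual i (mu i + j))) / (sqrt 5 * real (fib (k + (mu i + j))))"
    by (simp add: yarg_def)
  also have "\<dots> = (1 / phi) ^ k * (w_plus_dual i * zfac i k j) / ufac i k j"
    unfolding fib_ufac wythoff_dual_zfac[OF assms, of j k] by (simp add: power_add power_divide)
  finally show ?thesis .
qed

text \<open>The sine in the denominator of a summand is harmless as long as its argument stays away from
  \<open>pi\<close>. For \<open>xarg\<close> even the bound 1/2 holds, but \<open>yarg\<close> can exceed 1/2 in the first column; both share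
  the bound 3/4.\<close>

lemma xarg_bounds:
  assumes "i \<ge> 1" "k \<ge> 1" "j \<ge> 1"
  shows "0 < xarg i k j" "xarg i k j \<le> 3 / 4" "xarg i k j \<le> 2 * (1 / phi) ^ j"
proof -
  have N: "real (fib (k + (mu i + j))) > 0" using assms by (simp add: fib_neq_0_nat)
  show "0 < xarg i k j" unfolding xarg_def using N wythoff_pos[OF assms(1), of k] by simp
  have "2 * wythoff i (int k) \<le> int (fib (k + (mu i + j)))"
    using assms by (intro wythoff_le_half) auto
  then have "2 * real_of_int (wythoff i (int k)) \<le> real (fib (k + (mu i + j)))" by linarith
  then show "xarg i k j \<le> 3 / 4" unfolding xarg_def using N by (simp add: field_simps)
  note u = ufac_range[OF assms(1,2), of j] and v = vfac_bound[OF assms(1,2), of j]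
  note w = w_plus_ge_phi[OF assms(1)]
  have "xarg i k j \<le> (phi / 2) * (1 / phi) ^ j * (3 / 2) / (47 / 50)"
    unfolding xarg_eq[OF assms(1)]
    using u v w phi_gt_1 by (intro frac_le mult_mono w_plus_mu assms mult_nonneg_nonneg) auto
  also have "\<dots> = (phi / 2 * (3 / 2) / (47 / 50)) * (1 / phi) ^ j" by simp
  also have "\<dots> \<le> 2 * (1 / phi) ^ j"
    using phi_bounds by (intro mult_right_mono) auto
  finally show "xarg i k j \<le> 2 * (1 / phi) ^ j" .
qed

lemma yarg_bounds:
  assumes "i \<ge> 1" "k \<ge> 1" "j \<ge> 1"
  shows "0 < yarg i k j" "yarg i k j \<le> 3 / 4" "yarg i k j \<le> 2 * (1 / phi) ^ k"
proof -
  note u = ufac_range[OF assms(1,2), of j] and z = zfac_bound[OF assms(1,3), of k]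
  note w = w_plus_dual_bounds[OF assms(1)] w_plus_ge_phi[OF assms(1)]
  show "0 < yarg i k j" unfolding yarg_eq[OF assms(1)] using w z u by (intro divide_pos_pos mult_pos_pos) auto
  have "w_plus_dual i * zfac i k j = w_plus_dual i + w_plus i * (psi / phi) ^ (mu i + j)"
    unfolding zfac_def using w by (simp add: distrib_left)
  also have "w_plus i * (psi / phi) ^ (mu i + j) \<le> \<bar>w_plus i * (psi / phi) ^ (mu i + j)\<bar>" by simp
  also have "\<dots> = (w_plus i * (1 / phi) ^ mu i) * ((1 / phi) ^ j * (1 / phi) ^ (mu i + j))"
    using w phi_gt_1 by (simp add: abs_mult abs_psi_phi_pow power_add mult.assoc)
  also have "\<dots> \<le> (phi / 2) * ((1 / phi) ^ 1 * (1 / phi) ^ 3)"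
    using mu_ge_2[OF assms(1)] assms w phi_gt_1
    by (intro mult_mono w_plus_mu assms inv_phi_pow_antimono mult_nonneg_nonneg) auto
  also have "\<dots> = (1 / phi) ^ 3 / 2" by simp
  also have "\<dots> = phi - 3 / 2" unfolding inv_phi_cube by simp
  finally have e: "w_plus_dual i * zfac i k j \<le> 1.12" using w phi_bounds by simp
  have e0: "w_plus_dual i * zfac i k j \<ge> 0" using w z by simp
  have y: "yarg i k j \<le> (1 / phi) ^ k * 1.12 / (47 / 50)"
    unfolding yarg_eq[OF assms(1)] using u e e0 by (intro frac_le mult_mono) auto
  also have "\<dots> \<le> (1 / phi) ^ 1 * 1.12 / (47 / 50)"
    using assms by (intro divide_right_mono mult_right_mono inv_phi_pow_antimono) auto
  also have "\<dots> \<le> 3 / 4" unfolding power_one_right inverse_phi using phi_bounds by simp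
  finally show "yarg i k j \<le> 3 / 4" .
  have "(1 / phi) ^ k * 1.12 / (47 / 50) = (1.12 / (47 / 50)) * (1 / phi) ^ k" by simp
  also have "\<dots> \<le> 2 * (1 / phi) ^ k" by (intro mult_right_mono) auto
  finally show "yarg i k j \<le> 2 * (1 / phi) ^ k" using y by linarith
qed

lemma abs_le_add_other: "\<bar>d\<bar> \<le> c * a \<Longrightarrow> 0 \<le> c \<Longrightarrow> 0 \<le> b \<Longrightarrow> \<bar>d\<bar> \<le> c * (a + b)" for a b c d :: real
  by (simp add: distrib_left add_increasing2)

lemma near_xarg: "near (1 / phi) xarg 0"
proof (rule nearI[of "2"])
  fix i k j :: nat assume a: "i \<ge> 1" "k \<ge> 1" "j \<ge> 1"
  have "\<bar>xarg i k j - 0\<bar> \<le> 2 * (1 / phi) ^ j"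
    using xarg_bounds[OF a] by simp
  then show "\<bar>xarg i k j - 0\<bar> \<le> 2 * ((1 / phi) ^ k + (1 / phi) ^ j)"
    unfolding add.commute[of "(1 / phi) ^ k"] by (rule abs_le_add_other) auto
qed simp

lemma near_yarg: "near (1 / phi) yarg 0"
proof (rule nearI[of "2"])
  fix i k j :: nat assume a: "i \<ge> 1" "k \<ge> 1" "j \<ge> 1"
  have "\<bar>yarg i k j - 0\<bar> \<le> 2 * (1 / phi) ^ k"
    using yarg_bounds[OF a] by simp
  then show "\<bar>yarg i k j - 0\<bar> \<le> 2 * ((1 / phi) ^ k + (1 / phi) ^ j)"
    by (rule abs_le_add_other) auto
qed simp

lemma near_ufac: "near (1 / phi) ufac 1"
proof (rule nearI[of "1"])
  fix i k j :: nat assume a: "i \<ge> 1" "k \<ge> 1" "j \<ge> 1"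
  have "\<bar>ufac i k j - 1\<bar> \<le> 1 * (1 / phi) ^ k"
    using ufac_bound[of i k j] by simp
  then show "\<bar>ufac i k j - 1\<bar> \<le> 1 * ((1 / phi) ^ k + (1 / phi) ^ j)"
    by (rule abs_le_add_other) auto
qed simp

lemma near_vfac: "near (1 / phi) vfac 1"
proof (rule nearI[of "1"])
  fix i k j :: nat assume a: "i \<ge> 1" "k \<ge> 1" "j \<ge> 1"
  have "\<bar>vfac i k j - 1\<bar> \<le> 1 * (1 / phi) ^ k"
    using vfac_bound[OF a(1,2), of j] by simp
  then show "\<bar>vfac i k j - 1\<bar> \<le> 1 * ((1 / phi) ^ k + (1 / phi) ^ j)"
    by (rule abs_le_add_other) auto
qed simp

lemma near_zfac: "near (1 / phi) zfac 1"
proof (rule nearI[of "1"])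
  fix i k j :: nat assume a: "i \<ge> 1" "k \<ge> 1" "j \<ge> 1"
  have "\<bar>zfac i k j - 1\<bar> \<le> 1 * (1 / phi) ^ j"
    using zfac_bound[OF a(1,3), of k] by simp
  then show "\<bar>zfac i k j - 1\<bar> \<le> 1 * ((1 / phi) ^ k + (1 / phi) ^ j)"
    unfolding add.commute[of "(1 / phi) ^ k"] by (rule abs_le_add_other) auto
qed simp

text \<open>The quotient of \<open>1 / (F\<^sub>n sin(\<pi>x) sin(\<pi>y))\<close> by its model value \<open>sqrt 5 / (pi\<^sup>2 * eta i)\<close>, see
  \<open>corr_eq\<close>.\<close>

definition corr :: "nat \<Rightarrow> nat \<Rightarrow> nat \<Rightarrow> real" where
  "corr i k j = ufac i k j * (1 / vfac i k j) * (1 / zfac i k j) * inv_sinc (xarg i k j) * inv_sinc (yarg i k j)"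

lemma near_inv_sinc:
  assumes "near q X 0" "\<And>i k j. i \<ge> 1 \<Longrightarrow> k \<ge> 1 \<Longrightarrow> j \<ge> 1 \<Longrightarrow> 0 < X i k j \<and> X i k j \<le> 3 / 4"
  shows "near q (\<lambda>i k j. inv_sinc (X i k j)) 1"
proof (rule near_lipschitz[OF assms(1), where C = "6 * pi"])
  fix i k j :: nat assume a: "i \<ge> 1" "k \<ge> 1" "j \<ge> 1"
  show "\<bar>inv_sinc (X i k j) - 1\<bar> \<le> 6 * pi * \<bar>X i k j - 0\<bar>"
    using inv_sinc_bound[of "X i k j"] assms(2)[OF a] by simp
qed auto

lemma near_corr: "near (1 / phi) corr 1"
proof -
  have q: "0 \<le> 1 / phi" "1 / phi \<le> 1" using phi_gt_1 by auto
  have "near (1 / phi) (\<lambda>i k j. ufac i k j * (1 / vfac i k j) * (1 / zfac i k j) * inv_sinc (xarg i k j) * inv_sinc (yarg i k j)) (1 * 1 * 1 * 1 * 1)"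
    by (intro near_mult q near_ufac near_inverse[where a = "1/2"] near_vfac near_zfac near_inv_sinc near_xarg near_yarg)
      (simp_all add: vfac_bound zfac_bound xarg_bounds yarg_bounds del: le_divide_eq_numeral1 divide_le_eq_numeral1)
  moreover have "(\<lambda>i k j. ufac i k j * (1 / vfac i k j) * (1 / zfac i k j) * inv_sinc (xarg i k j) * inv_sinc (yarg i k j)) = corr"
    by (intro ext) (simp add: corr_def)
  ultimately show ?thesis by simp
qed

lemma corr_pos:
  assumes "i \<ge> 1" "k \<ge> 1" "j \<ge> 1"
  shows "corr i k j > 0"
  unfolding corr_def
  using ufac_range[OF assms(1,2), of j] vfac_bound[OF assms(1,2), of j] zfac_bound[OF assms(1,3), of k]
    inv_sinc_pos[OF xarg_bounds(1,2)[OF assms]] inv_sinc_pos[OF yarg_bounds(1,2)[OF assms]]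
  by (intro mult_pos_pos) auto

lemma corr_eq:
  assumes "i \<ge> 1" "k \<ge> 1" "j \<ge> 1"
  shows "1 / (real (fib (k + (mu i + j))) * sin (pi * xarg i k j) * sin (pi * yarg i k j))
     = sqrt 5 / (pi\<^sup>2 * eta i) * corr i k j"
proof -
  define N W V where "N = real (fib (k + (mu i + j)))" and "W = real_of_int (wythoff i (int k))"
    and "V = real_of_int (wythoff_dual i (mu i + j))"
  define u v z where "u = ufac i k j" and "v = vfac i k j" and "z = zfac i k j"
  define P where "P = phi ^ (k + (mu i + j))"
  note uvz = u_def v_def z_def
  have pos: "u > 0" "v > 0" "z > 0" "P > 0"
    using ufac_range[OF assms(1,2), of j] vfac_bound[OF assms(1,2), of j] zfac_bound[OF assms(1,3), of k]
    by (auto simp: uvz P_def)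
  have w: "w_plus i > 0" "w_plus_dual i > 0"
    using w_plus_dual_bounds[OF assms(1)] w_plus_ge_phi[OF assms(1)] phi_gt_1 by auto
  define s where "s = sqrt 5"
  have s: "s > 0" "s * s = 5" by (auto simp: s_def)
  have N: "s * N = P * u" unfolding N_def uvz P_def s_def by (rule fib_ufac)
  have WV: "(s * W) * (s * V) = eta i * P * v * z"
    unfolding W_def V_def uvz P_def s_def eta_eq wythoff_vfac[OF assms(1), of k j] wythoff_dual_zfac[OF assms(1), of j k]
    by (simp add: power_add)
  have N0: "N > 0" using N s pos by (metis zero_less_mult_pos mult_pos_pos)
  have sx: "sin (pi * xarg i k j) > 0" "sin (pi * yarg i k j) > 0"
    using sin_pix_pos xarg_bounds[OF assms] yarg_bounds[OF assms] by auto
  have xy: "xarg i k j = W / N" "yarg i k j = V / N" by (simp_all add: xarg_def yarg_def N_def W_def V_def)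
  have wv0: "W > 0" "V > 0"
    using xarg_bounds(1)[OF assms] yarg_bounds(1)[OF assms] N0 unfolding xy by (auto simp: zero_less_divide_iff)
  have "s / (pi\<^sup>2 * eta i) * corr i k j
     = s * u / (eta i * v * z) * (W / N) * (V / N) / (sin (pi * xarg i k j) * sin (pi * yarg i k j))"
    unfolding corr_def inv_sinc_def uvz xy using pi_gt_zero by (simp add: power2_eq_square mult_ac)
  also have "s * u / (eta i * v * z) * (W / N) * (V / N) = 1 / N"
  proof -
    have "s * u * (W * V) = N * (eta i * v * z)"
    proof -
      have "P * (s * u * (W * V)) = (P * u) * (s * W * V)" by simp
      also have "\<dots> = N * ((s * W) * (s * V))" unfolding N[symmetric] by simp
      also have "\<dots> = P * (N * (eta i * v * z))" unfolding WV by simp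
      finally show ?thesis using pos by simp
    qed
    moreover have "eta i > 0" unfolding eta_eq using w by simp
    ultimately show ?thesis using pos N0 by (simp add: field_simps)
  qed
  finally show ?thesis unfolding N_def[symmetric] s_def[symmetric] by simp
qed

section \<open>Dominated convergence for series\<close>

lemma tannery:
  fixes a :: "nat \<Rightarrow> nat \<Rightarrow> real"
  assumes "\<And>k. (\<lambda>n. a k n) \<longlonglongrightarrow> b k" "\<And>k n. \<bar>a k n\<bar> \<le> M k" "summable M"
  shows "summable b" "(\<lambda>n. \<Sum>k. a k n) \<longlonglongrightarrow> (\<Sum>k. b k)"
proof -
  have "summable (\<lambda>n. norm (b n)) \<and> (\<lambda>n. \<Sum>k. a k n) \<longlonglongrightarrow> (\<Sum>k. b k)"
    using tannerys_theorem[of a b sequentially M] assms by (simp add: always_eventually)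
  then show "summable b" "(\<lambda>n. \<Sum>k. a k n) \<longlonglongrightarrow> (\<Sum>k. b k)"
    by (auto intro: summable_norm_cancel)
qed

text \<open>The antidiagonal sum is cut in the middle. In the half with \<open>k \<le> r - k\<close> the term \<open>q ^ k\<close> dominates
  and Tannery's theorem applies with \<open>k\<close> fixed; in the other half the roles are exchanged.\<close>

lemma two_sided_tannery:
  fixes A :: "nat \<Rightarrow> nat \<Rightarrow> real" and d e :: "nat \<Rightarrow> real" and q M :: real
  assumes q: "0 < q" "q < 1" and M: "0 \<le> M"
    and bound: "\<And>k j. \<bar>A k j\<bar> \<le> M * (q ^ k + q ^ j)"
    and d: "\<And>k. (\<lambda>j. A k j) \<longlonglongrightarrow> d k" and e: "\<And>j. (\<lambda>k. A k j) \<longlonglongrightarrow> e j"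
  shows "summable d" "summable e"
    and "(\<lambda>r. \<Sum>k\<le>r. A k (r - k)) \<longlonglongrightarrow> (\<Sum>k. d k) + (\<Sum>j. e j)"
    and "\<bar>\<Sum>k\<le>r. A k (r - k)\<bar> \<le> 2 * M / (1 - q)"
proof -
  define A1 where "A1 k r = (if 2 * k \<le> r then A k (r - k) else 0)" for k r
  define A2 where "A2 j r = (if 2 * j < r then A (r - j) j else 0)" for j r
  have s: "summable (\<lambda>k. 2 * M * q ^ k)" using q by (intro summable_mult summable_geometric) auto
  have "M * q ^ j \<le> M * q ^ k" if "k \<le> j" for k j :: nat
    using that q M by (intro mult_left_mono power_decreasing) auto
  note mq = this
  have b1: "\<bar>A1 k r\<bar> \<le> 2 * M * q ^ k" for k r
  proof (cases "2 * k \<le> r")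
    case True
    then have "M * q ^ (r - k) \<le> M * q ^ k" by (intro mq) simp
    with bound[of k "r - k"] True show ?thesis by (simp add: A1_def distrib_left)
  qed (use M q in \<open>simp add: A1_def\<close>)
  have b2: "\<bar>A2 j r\<bar> \<le> 2 * M * q ^ j" for j r
  proof (cases "2 * j < r")
    case True
    then have "M * q ^ (r - j) \<le> M * q ^ j" by (intro mq) simp
    with bound[of "r - j" j] True show ?thesis by (simp add: A2_def distrib_left)
  qed (use M q in \<open>simp add: A2_def\<close>)
  have sh: "filterlim (\<lambda>r. r - k) sequentially sequentially" for k :: nat
    by (rule filterlim_minus_const_nat_at_top)
  have l1: "(\<lambda>r. A1 k r) \<longlonglongrightarrow> d k" for k
  proof -
    have "(\<lambda>r. A k (r - k)) \<longlonglongrightarrow> d k" using filterlim_compose[OF d sh] .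
    moreover have "eventually (\<lambda>r. A k (r - k) = A1 k r) sequentially"
      using eventually_ge_at_top[of "2 * k"] by eventually_elim (simp add: A1_def)
    ultimately show ?thesis using tendsto_cong by fast
  qed
  have l2: "(\<lambda>r. A2 j r) \<longlonglongrightarrow> e j" for j
  proof -
    have "(\<lambda>r. A (r - j) j) \<longlonglongrightarrow> e j" using filterlim_compose[OF e sh] .
    moreover have "eventually (\<lambda>r. A (r - j) j = A2 j r) sequentially"
      using eventually_gt_at_top[of "2 * j"] by eventually_elim (simp add: A2_def)
    ultimately show ?thesis using tendsto_cong by fast
  qed
  show "summable d" using tannery(1)[OF l1 b1 s] .
  show "summable e" using tannery(1)[OF l2 b2 s] .
  have eq: "(\<Sum>k\<le>r. A k (r - k)) = (\<Sum>k. A1 k r) + (\<Sum>j. A2 j r)" for r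
  proof -
    have split: "{..r} = {k. 2 * k \<le> r} \<union> {k. k \<le> r \<and> r < 2 * k}" by auto
    have "(\<Sum>k\<le>r. A k (r - k)) = (\<Sum>k | 2 * k \<le> r. A k (r - k)) + (\<Sum>k | k \<le> r \<and> r < 2 * k. A k (r - k))"
      unfolding split by (rule sum.union_disjoint) (auto intro: finite_subset[of _ "{..r}"])
    also have "(\<Sum>k | 2 * k \<le> r. A k (r - k)) = (\<Sum>k. A1 k r)"
      by (subst suminf_finite[of "{k. 2 * k \<le> r}"]) (auto simp: A1_def intro: finite_subset[of _ "{..r}"])
    also have "(\<Sum>k | k \<le> r \<and> r < 2 * k. A k (r - k)) = (\<Sum>j | 2 * j < r. A (r - j) j)"
      by (rule sum.reindex_bij_witness[of _ "\<lambda>j. r - j" "\<lambda>k. r - k"]) auto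
    also have "\<dots> = (\<Sum>j. A2 j r)"
      by (subst suminf_finite[of "{k. 2 * k < r}"]) (auto simp: A2_def intro: finite_subset[of _ "{..r}"])
    finally show ?thesis .
  qed
  show "(\<lambda>r. \<Sum>k\<le>r. A k (r - k)) \<longlonglongrightarrow> (\<Sum>k. d k) + (\<Sum>j. e j)"
    unfolding eq by (intro tendsto_add tannery(2)[OF l1 b1 s] tannery(2)[OF l2 b2 s])
  have fin: "(\<Sum>k\<le>r. q ^ k) \<le> 1 / (1 - q)"
    using sum_le_suminf[OF summable_geometric, of q "{..r}"] q suminf_geometric[of q] by simp
  have "\<bar>\<Sum>k\<le>r. A k (r - k)\<bar> \<le> (\<Sum>k\<le>r. M * (q ^ k + q ^ (r - k)))"
    by (intro order_trans[OF sum_abs] sum_mono bound)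
  also have "\<dots> = M * ((\<Sum>k\<le>r. q ^ k) + (\<Sum>k\<le>r. q ^ (r - k)))"
    by (simp only: sum_distrib_left[symmetric] sum.distrib)
  also have "(\<Sum>k\<le>r. q ^ (r - k)) = (\<Sum>k\<le>r. q ^ k)"
    by (rule sum.reindex_bij_witness[of _ "\<lambda>j. r - j" "\<lambda>k. r - k"]) auto
  also have "M * ((\<Sum>k\<le>r. q ^ k) + (\<Sum>k\<le>r. q ^ k)) \<le> M * (1 / (1 - q) + 1 / (1 - q))"
    using fin M by (intro mult_left_mono add_mono) auto
  finally show "\<bar>\<Sum>k\<le>r. A k (r - k)\<bar> \<le> 2 * M / (1 - q)" by (simp add: mult.commute)
qed

section \<open>Summability over the rows\<close>

lemma eta_lower:
  assumes "i \<ge> 1" shows "eta i \<ge> real i / 2" "eta i > 0"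
proof -
  note w = w_plus_dual_bounds[OF assms]
  have "real i / 2 \<le> (phi * real i) * (1 / phi ^ 2)"
  proof -
    have "(phi * real i) * (1 / phi ^ 2) = (phi - 1) * real i"
      unfolding inverse_phi[symmetric] by (simp add: power2_eq_square)
    moreover have "1 / 2 * real i \<le> (phi - 1) * real i" using phi_bounds by (intro mult_right_mono) auto
    ultimately show ?thesis by simp
  qed
  also have "\<dots> \<le> eta i"
    unfolding eta_eq using w w_plus_ge[of i] assms phi_gt_1 w_plus_ge_phi[of i] by (intro mult_mono) auto
  finally show "eta i \<ge> real i / 2" .
  then show "eta i > 0" using assms by linarith
qed

lemma inv_eta_powr_le:
  assumes "i \<ge> 1" "0 < s" shows "1 / eta i powr s \<le> 2 powr s * real i powr (- s)"
proof -
  have "(real i / 2) powr s \<le> eta i powr s" using eta_lower[OF assms(1)] assms by (intro powr_mono2) auto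
  then have "1 / eta i powr s \<le> 1 / (real i / 2) powr s"
    using assms eta_lower[OF assms(1)] by (intro divide_left_mono mult_pos_pos) auto
  also have "\<dots> = 2 powr s * real i powr (- s)" by (simp add: powr_divide powr_minus field_simps)
  finally show ?thesis .
qed

lemma summable_inv_eta:
  assumes "1 < s" shows "summable (\<lambda>i. 1 / eta (Suc i) powr s)"
proof (rule summable_comparison_test)
  have "summable (\<lambda>n. real n powr (- s))" using assms by (simp add: summable_real_powr_iff)
  then have "summable (\<lambda>n. real (Suc n) powr (- s))" by (subst summable_Suc_iff)
  then show "summable (\<lambda>n. 2 powr s * real (Suc n) powr (- s))" by (rule summable_mult)
  show "\<exists>N. \<forall>n\<ge>N. norm (1 / eta (Suc n) powr s) \<le> 2 powr s * real (Suc n) powr (- s)"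
    using inv_eta_powr_le[of "Suc n" s for n] assms by auto
qed

text \<open>Since \<open>phi ^ mu i \<le> 2 * w_plus i \<le> 10 * i\<close>, the number \<open>mu i\<close> grows logarithmically and is at
  most a constant times any given positive power of \<open>i\<close>.\<close>

lemma mu_bound:
  assumes "i \<ge> 1" "0 < a"
  shows "real (mu i) + 1 \<le> (10 powr a / (a * ln phi) + 1) * real i powr a"
proof -
  have l: "ln phi > 0" using phi_gt_1 by simp
  have "phi ^ mu i \<le> 10 * real i" using mu_bounds(1)[OF assms(1)] w_plus_le[of i] by linarith
  then have "ln (phi ^ mu i) \<le> ln (10 * real i)" using assms by (subst ln_le_cancel_iff) auto
  then have "real (mu i) * ln phi \<le> ln (10 * real i)" by (simp add: ln_realpow)
  also have "\<dots> \<le> (10 * real i) powr a / a" using assms by (intro ln_powr_bound) auto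
  also have "\<dots> = 10 powr a * real i powr a / a" by (simp add: powr_mult)
  finally have "real (mu i) \<le> 10 powr a * real i powr a / a / ln phi" unfolding pos_le_divide_eq[OF l] .
  moreover have "1 \<le> real i powr a" using assms by (intro ge_one_powr_ge_zero) auto
  ultimately show ?thesis by (simp add: algebra_simps)
qed

text \<open>Half of the excess \<open>s - 1\<close> is spent on bounding \<open>mu\<close>, the other half gives convergence.\<close>

lemma summable_mu_eta:
  assumes "1 < s" shows "summable (\<lambda>i. (real (mu (Suc i)) + 1) / eta (Suc i) powr s)"
proof (rule summable_comparison_test)
  define a where "a = (s - 1) / 2"
  define C where "C = 10 powr a / (a * ln phi) + 1"
  have a: "a > 0" "a - s < - 1" using assms by (auto simp: a_def field_simps)
  have "ln phi > 0" using phi_gt_1 by simp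
  then have C: "C > 0" using a by (auto simp: C_def intro!: add_nonneg_pos)
  have "summable (\<lambda>n. real n powr (a - s))" using a by (simp add: summable_real_powr_iff)
  then have "summable (\<lambda>n. real (Suc n) powr (a - s))" by (subst summable_Suc_iff)
  then show "summable (\<lambda>n. (C * 2 powr s) * real (Suc n) powr (a - s))" by (rule summable_mult)
  have "norm ((real (mu (Suc n)) + 1) / eta (Suc n) powr s) \<le> (C * 2 powr s) * real (Suc n) powr (a - s)" for n
  proof -
    have "(real (mu (Suc n)) + 1) * (1 / eta (Suc n) powr s)
        \<le> (C * real (Suc n) powr a) * (2 powr s * real (Suc n) powr (- s))"
      using mu_bound[of "Suc n" a] inv_eta_powr_le[of "Suc n" s] a assms C
      by (intro mult_mono) (auto simp: C_def)
    also have "\<dots> = (C * 2 powr s) * real (Suc n) powr (a - s)"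
      by (simp add: powr_diff powr_minus divide_inverse)
    finally show ?thesis by simp
  qed
  then show "\<exists>N. \<forall>n\<ge>N. norm ((real (mu (Suc n)) + 1) / eta (Suc n) powr s) \<le> (C * 2 powr s) * real (Suc n) powr (a - s)"
    by blast
qed

section \<open>Limits of the arguments\<close>

lemma psi_phi_pow_lim: "(\<lambda>m. (psi / phi) ^ m) \<longlonglongrightarrow> 0"
proof (rule LIMSEQ_power_zero)
  have "1 / phi * (1 / phi) < 1 * 1" using phi_gt_1 by (intro mult_strict_mono) auto
  then show "norm (psi / phi) < 1" using abs_psi by simp
qed

lemma fib_at_top: "filterlim (\<lambda>n. real (fib n)) at_top sequentially"
proof (rule filterlim_at_top_mono)
  show "filterlim (\<lambda>n. real n - 1) at_top sequentially" by real_asymp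
  have "n \<le> fib n + 1" for n
  proof (induction n rule: fib.induct)
    case (3 n)
    show ?case
    proof (cases "n = 0")
      case False
      then have "fib n \<ge> 1" by (simp add: fib_neq_0_nat Suc_le_eq)
      with 3 show ?thesis by simp
    qed simp
  qed auto
  then show "eventually (\<lambda>n. real n - 1 \<le> real (fib n)) sequentially"
    by (intro always_eventually allI) (smt (verit) of_nat_1 of_nat_add of_nat_mono)
qed

lemma yarg_limit:
  "(\<lambda>m. of_int (wythoff_dual i m) / real (fib (k + m))) \<longlonglongrightarrow> w_plus_dual i / phi ^ k"
proof -
  have "(\<lambda>m. (w_plus_dual i + w_plus i * (psi / phi) ^ m) / (phi ^ k - psi ^ k * (psi / phi) ^ m))
     \<longlonglongrightarrow> (w_plus_dual i + w_plus i * 0) / (phi ^ k - psi ^ k * 0)"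
    by (intro tendsto_intros psi_phi_pow_lim) auto
  moreover have "(w_plus_dual i + w_plus i * (psi / phi) ^ m) / (phi ^ k - psi ^ k * (psi / phi) ^ m)
     = of_int (wythoff_dual i m) / real (fib (k + m))" for m
  proof -
    have "of_int (wythoff_dual i m) / real (fib (k + m)) = (sqrt 5 * of_int (wythoff_dual i m)) / (sqrt 5 * real (fib (k + m)))"
      by simp
    also have "\<dots> = (phi ^ m * (w_plus_dual i + w_plus i * (psi / phi) ^ m)) / (phi ^ m * (phi ^ k - psi ^ k * (psi / phi) ^ m))"
      unfolding wythoff_dual_closed fib_closed by (simp add: power_divide power_add algebra_simps)
    finally show ?thesis by simp
  qed
  ultimately show ?thesis by simp
qed

lemma xarg_limit:
  "(\<lambda>k. of_int (wythoff i (int k)) / real (fib (k + m))) \<longlonglongrightarrow> w_plus i / phi ^ m"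
proof -
  have "(\<lambda>k. (w_plus i + w_plus_dual i * (psi / phi) ^ k) / (phi ^ m - psi ^ m * (psi / phi) ^ k))
     \<longlonglongrightarrow> (w_plus i + w_plus_dual i * 0) / (phi ^ m - psi ^ m * 0)"
    by (intro tendsto_intros psi_phi_pow_lim) auto
  moreover have "(w_plus i + w_plus_dual i * (psi / phi) ^ k) / (phi ^ m - psi ^ m * (psi / phi) ^ k)
     = of_int (wythoff i (int k)) / real (fib (k + m))" for k
  proof -
    have "of_int (wythoff i (int k)) / real (fib (k + m)) = (sqrt 5 * of_int (wythoff i (int k))) / (sqrt 5 * real (fib (k + m)))"
      by simp
    also have "\<dots> = (phi ^ k * (w_plus i + w_plus_dual i * (psi / phi) ^ k)) / (phi ^ k * (phi ^ m - psi ^ m * (psi / phi) ^ k))"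
      unfolding wythoff_closed fib_closed by (simp add: power_divide power_add algebra_simps)
    finally show ?thesis by simp
  qed
  ultimately show ?thesis by simp
qed

section \<open>Summands and their uniform approximation\<close>

locale weight =
  fixes f :: "real \<Rightarrow> real" and \<sigma> \<alpha> L :: real
  assumes sigma: "1 < \<sigma>" and alpha: "0 < \<alpha>" "\<alpha> \<le> 1" and L: "0 \<le> L"
    and hoelder: "\<And>x y. x \<in> {0..<1} \<Longrightarrow> y \<in> {0..<1} \<Longrightarrow> \<bar>f x - f y\<bar> \<le> L * \<bar>x - y\<bar> powr \<alpha>"
    and periodic: "\<And>t. f (t + 1) = f t"
    and symmetric: "\<And>t. f t = f (1 - t)"
begin

definition q :: real where "q = (1 / phi) powr \<alpha>"

definition g :: "real \<Rightarrow> real" where "g x = f x / \<bar>sin (pi * x)\<bar> powr \<sigma>"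

text \<open>The contribution to the Fibonacci sum of index \<open>n = k + m\<close> of the entry in row \<open>i\<close> and column \<open>k\<close>, see
  \<open>T_wythoff\<close>.\<close>

definition summand :: "nat \<Rightarrow> nat \<Rightarrow> nat \<Rightarrow> real" where
  "summand i k m = 1 / real (fib (k + m)) powr \<sigma>
     * (g (of_int (wythoff i (int k)) / real (fib (k + m)))
        * g (of_int (wythoff_dual i m) / real (fib (k + m))))"

definition c :: "nat \<Rightarrow> real" where
  "c i = f 0 ^ 2 * 5 powr (\<sigma> / 2) / (pi powr (2 * \<sigma>) * eta i powr \<sigma>)"

lemma q: "0 < q" "q < 1" "1 / phi \<le> q"
proof -
  have p: "1 / phi < 1" using phi_gt_1 by simp
  show "0 < q" by (simp add: q_def)
  have "(1 / phi) powr \<alpha> < 1 powr \<alpha>" using p alpha by (intro powr_less_mono2) auto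
  then show "q < 1" by (simp add: q_def)
  have "(1 / phi) powr 1 \<le> (1 / phi) powr \<alpha>" using p alpha by (intro powr_mono') auto
  then show "1 / phi \<le> q" by (simp add: q_def)
qed

lemma q_pow: "q ^ n = ((1 / phi) ^ n) powr \<alpha>"
  unfolding q_def by (simp add: powr_powr powr_realpow[symmetric] mult.commute flip: powr_realpow)

text \<open>Hoelder continuity turns decay with ratio \<open>1 / phi\<close> into decay with ratio \<open>q\<close>.\<close>

lemma near_f:
  assumes "near (1 / phi) X 0" "\<And>i k j. i \<ge> 1 \<Longrightarrow> k \<ge> 1 \<Longrightarrow> j \<ge> 1 \<Longrightarrow> 0 < X i k j \<and> X i k j \<le> 3 / 4"
  shows "near q (\<lambda>i k j. f (X i k j)) (f 0)"
proof -
  obtain B where B: "B \<ge> 0" "\<And>i k j. i \<ge> 1 \<Longrightarrow> k \<ge> 1 \<Longrightarrow> j \<ge> 1 \<Longrightarrow> \<bar>X i k j - 0\<bar> \<le> B * ((1 / phi) ^ k + (1 / phi) ^ j)"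
    using nearE[OF assms(1)] by metis
  show ?thesis
  proof (rule nearI[of "L * (2 * B) powr \<alpha>"])
    fix i k j :: nat assume a: "i \<ge> 1" "k \<ge> 1" "j \<ge> 1"
    note X = assms(2)[OF a]
    define t where "t = max ((1 / phi) ^ k) ((1 / phi) ^ j)"
    have t: "t \<ge> 0" "(1 / phi) ^ k \<le> t" "(1 / phi) ^ j \<le> t" by (auto simp: t_def le_max_iff_disj)
    have "X i k j \<le> B * ((1 / phi) ^ k + (1 / phi) ^ j)" using B(2)[OF a] by linarith
    also have "\<dots> \<le> B * (t + t)" using t B(1) by (intro mult_left_mono add_mono) auto
    finally have Xt: "X i k j \<le> (2 * B) * t" by simp
    have "\<bar>f (X i k j) - f 0\<bar> \<le> L * \<bar>X i k j - 0\<bar> powr \<alpha>" using X by (intro hoelder) auto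
    also have "\<dots> \<le> L * ((2 * B) * t) powr \<alpha>"
      using X Xt L alpha by (intro mult_left_mono powr_mono2) auto
    also have "\<dots> = L * (2 * B) powr \<alpha> * t powr \<alpha>" using B(1) t by (simp add: powr_mult)
    also have "t powr \<alpha> \<le> q ^ k + q ^ j"
      unfolding t_def q_pow by (auto simp: max_def)
    finally show "\<bar>f (X i k j) - f 0\<bar> \<le> L * (2 * B) powr \<alpha> * (q ^ k + q ^ j)"
      using L by (simp add: mult_left_mono)
  qed (use L in auto)
qed

lemma g_pos_arg: "0 < sin (pi * x) \<Longrightarrow> g x = f x / sin (pi * x) powr \<sigma>"
  by (simp add: g_def)

lemma summand_eq:
  assumes "i \<ge> 1" "k \<ge> 1" "j \<ge> 1"
  shows "summand i k (mu i + j) = 5 powr (\<sigma> / 2) / (pi powr (2 * \<sigma>) * eta i powr \<sigma>)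
     * (f (xarg i k j) * f (yarg i k j) * corr i k j powr \<sigma>)"
proof -
  let ?N = "real (fib (k + (mu i + j)))" and ?sx = "sin (pi * xarg i k j)" and ?sy = "sin (pi * yarg i k j)"
  have s: "?sx > 0" "?sy > 0"
    using sin_pix_pos xarg_bounds[OF assms] yarg_bounds[OF assms] by auto
  have N: "?N > 0" using assms by (simp add: fib_neq_0_nat)
  have "summand i k (mu i + j) = f (xarg i k j) * f (yarg i k j) * (1 / (?N * ?sx * ?sy)) powr \<sigma>"
    unfolding summand_def xarg_def[symmetric] yarg_def[symmetric] g_pos_arg[OF s(1)] g_pos_arg[OF s(2)]
    using s N by (simp add: powr_divide powr_mult)
  also have "(1 / (?N * ?sx * ?sy)) powr \<sigma> = (sqrt 5 / (pi\<^sup>2 * eta i) * corr i k j) powr \<sigma>"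
    unfolding corr_eq[OF assms] ..
  also have "\<dots> = 5 powr (\<sigma> / 2) / (pi powr (2 * \<sigma>) * eta i powr \<sigma>) * corr i k j powr \<sigma>"
  proof -
    have "sqrt 5 powr \<sigma> = 5 powr (\<sigma> / 2)" by (simp add: powr_powr flip: powr_half_sqrt)
    moreover have "(pi\<^sup>2) powr \<sigma> = pi powr (2 * \<sigma>)"
      by (simp add: powr_powr flip: powr_numeral)
    ultimately show ?thesis
      using eta_lower(2)[OF assms(1)] corr_pos[OF assms] by (simp add: powr_divide powr_mult)
  qed
  finally show ?thesis by simp
qed

text \<open>The model value \<open>c i\<close> is approached at a rate that depends on the row only through
  \<open>1 / eta i powr \<sigma>\<close>; this uniformity allows the later summation over all rows.\<close>

lemma summand_bound:
  obtains B where "B \<ge> 0" "\<And>i k j. i \<ge> 1 \<Longrightarrow> k \<ge> 1 \<Longrightarrow> j \<ge> 1 \<Longrightarrow>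
    \<bar>summand i k (mu i + j) - c i\<bar> \<le> B / eta i powr \<sigma> * (q ^ k + q ^ j)"
proof -
  define X where "X i k j = f (xarg i k j) * f (yarg i k j) * corr i k j powr \<sigma>" for i k j
  have "near q (\<lambda>i k j. f (xarg i k j) * f (yarg i k j) * corr i k j powr \<sigma>) (f 0 * f 0 * 1)"
    using xarg_bounds yarg_bounds corr_pos q sigma
    by (intro near_mult near_f near_powr near_mono[OF near_corr] near_xarg near_yarg conjI) auto
  then have "near q X (f 0 * f 0 * 1)" unfolding X_def .
  then obtain B where B: "B \<ge> 0" "\<And>i k j. i \<ge> 1 \<Longrightarrow> k \<ge> 1 \<Longrightarrow> j \<ge> 1 \<Longrightarrow> \<bar>X i k j - f 0 * f 0 * 1\<bar> \<le> B * (q ^ k + q ^ j)"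
    by (rule nearE) metis
  define K where "K = 5 powr (\<sigma> / 2) / pi powr (2 * \<sigma>)"
  have K: "K \<ge> 0" by (simp add: K_def)
  show ?thesis
  proof (rule that[of "K * B"])
    fix i k j :: nat assume a: "i \<ge> 1" "k \<ge> 1" "j \<ge> 1"
    have "summand i k (mu i + j) - c i = K / eta i powr \<sigma> * (X i k j - f 0 * f 0 * 1)"
      unfolding summand_eq[OF a] c_def X_def K_def by (simp add: power2_eq_square right_diff_distrib)
    also have "\<bar>\<dots>\<bar> = K / eta i powr \<sigma> * \<bar>X i k j - f 0 * f 0 * 1\<bar>"
      using K by (simp add: abs_mult)
    also have "\<dots> \<le> K / eta i powr \<sigma> * (B * (q ^ k + q ^ j))"
      using K B(2)[OF a] by (intro mult_left_mono) auto
    finally show "\<bar>summand i k (mu i + j) - c i\<bar> \<le> K * B / eta i powr \<sigma> * (q ^ k + q ^ j)" by simp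
  qed (use K B in auto)
qed

section \<open>Limits of single summands\<close>

lemma f_limit:
  fixes y :: "nat \<Rightarrow> real"
  assumes "y \<longlonglongrightarrow> l" "0 \<le> l" "l < 1" "\<And>n. 0 \<le> y n"
  shows "(\<lambda>n. f (y n)) \<longlonglongrightarrow> f l"
proof (rule LIM_zero_cancel, rule Lim_null_comparison)
  have "eventually (\<lambda>n. y n < 1) sequentially" using order_tendstoD(2)[OF assms(1,3)] .
  then show "eventually (\<lambda>n. norm (f (y n) - f l) \<le> L * \<bar>y n - l\<bar> powr \<alpha>) sequentially"
    by eventually_elim (use hoelder assms in auto)
  have "(\<lambda>n. L * \<bar>y n - l\<bar> powr \<alpha>) \<longlonglongrightarrow> L * \<bar>l - l\<bar> powr \<alpha>"
    using alpha assms by (intro tendsto_intros) auto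
  then show "(\<lambda>n. L * \<bar>y n - l\<bar> powr \<alpha>) \<longlonglongrightarrow> 0" using alpha by simp
qed

text \<open>Both ends of a row have this form: one argument has a fixed numerator and tends to 0, so that
  the factor \<open>N n powr \<sigma>\<close> cancels against its sine, and the other one converges inside the open unit
  interval.\<close>

lemma g_product_limit:
  fixes N y :: "nat \<Rightarrow> real" and a l :: real
  assumes N: "filterlim N at_top sequentially" "\<And>n. N n > 0" and a: "0 < a"
    and y: "y \<longlonglongrightarrow> l" "0 < l" "l < 1" "\<And>n. 0 < y n"
  shows "(\<lambda>n. 1 / N n powr \<sigma> * (g (a / N n) * g (y n)))
    \<longlonglongrightarrow> f 0 / (pi powr \<sigma> * a powr \<sigma>) * (f l / sin (pi * l) powr \<sigma>)"
proof -
  have x0: "(\<lambda>n. a / N n) \<longlonglongrightarrow> 0" by (rule real_tendsto_divide_at_top[OF tendsto_const N(1)])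
  have f1: "(\<lambda>n. f (a / N n)) \<longlonglongrightarrow> f 0"
    by (rule f_limit[OF x0]) (use a N(2) in \<open>auto simp: less_imp_le\<close>)
  have f2: "(\<lambda>n. f (y n)) \<longlonglongrightarrow> f l"
    by (rule f_limit[OF y(1)]) (use y in \<open>auto simp: less_imp_le\<close>)
  have "((\<lambda>t::real. sin t / t) \<longlongrightarrow> 1) (at 0)" by real_asymp
  moreover have "filterlim (\<lambda>n. pi * (a / N n)) (at 0) sequentially"
  proof -
    have "(\<lambda>n. pi * (a / N n)) \<longlonglongrightarrow> pi * 0" by (intro tendsto_intros x0)
    moreover have "eventually (\<lambda>n. pi * (a / N n) \<noteq> 0) sequentially"
      using a N(2) by (intro always_eventually) (auto simp: order_less_imp_not_eq2)
    ultimately show ?thesis by (simp add: filterlim_at)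
  qed
  ultimately have "(\<lambda>n. sin (pi * (a / N n)) / (pi * (a / N n))) \<longlonglongrightarrow> 1"
    by (rule filterlim_compose)
  then have "(\<lambda>n. pi * a * (sin (pi * (a / N n)) / (pi * (a / N n)))) \<longlonglongrightarrow> pi * a * 1"
    by (intro tendsto_intros)
  moreover have "pi * a * (sin (pi * (a / N n)) / (pi * (a / N n))) = N n * sin (pi * (a / N n))" for n
    using a N(2)[of n] by simp
  ultimately have s1: "(\<lambda>n. N n * sin (pi * (a / N n))) \<longlonglongrightarrow> pi * a" by simp
  have s2: "(\<lambda>n. sin (pi * y n)) \<longlonglongrightarrow> sin (pi * l)" by (intro tendsto_intros y)
  have sl: "sin (pi * l) > 0" using y by (intro sin_gt_zero) auto
  have "(\<lambda>n. f (a / N n) * f (y n) / ((N n * sin (pi * (a / N n))) * sin (pi * y n)) powr \<sigma>)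
    \<longlonglongrightarrow> f 0 * f l / ((pi * a) * sin (pi * l)) powr \<sigma>"
    using sl a by (intro tendsto_intros f1 f2 s1 s2) auto
  moreover have "eventually (\<lambda>n. f (a / N n) * f (y n) / ((N n * sin (pi * (a / N n))) * sin (pi * y n)) powr \<sigma>
     = 1 / N n powr \<sigma> * (g (a / N n) * g (y n))) sequentially"
  proof -
    have "eventually (\<lambda>n. a / N n < 1) sequentially" using order_tendstoD(2)[OF x0, of 1] by simp
    moreover have "eventually (\<lambda>n. y n < 1) sequentially" using order_tendstoD(2)[OF y(1,3)] .
    ultimately show ?thesis
    proof eventually_elim
      case (elim n)
      have p: "0 < a / N n" using a N(2) by simp
      then have "0 < sin (pi * (a / N n))"
        using mult_strict_left_mono[OF elim(1) pi_gt_zero] mult_pos_pos[OF pi_gt_zero p]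
        by (intro sin_gt_zero) simp_all
      moreover have "0 < sin (pi * y n)" using elim y(4)[of n] by (intro sin_gt_zero) auto
      ultimately show ?case using N(2)[of n] unfolding g_def by (simp add: powr_mult)
    qed
  qed
  ultimately have "(\<lambda>n. 1 / N n powr \<sigma> * (g (a / N n) * g (y n)))
     \<longlonglongrightarrow> f 0 * f l / ((pi * a) * sin (pi * l)) powr \<sigma>"
    using tendsto_cong by fast
  then show ?thesis using a sl by (simp add: powr_mult)
qed

end

context weight
begin

section \<open>Sums over one row\<close>

lemma delta_term_limit:
  assumes i: "i \<ge> 1" "k \<ge> 1"
  shows "(\<lambda>j. summand i k (mu i + Suc j) - c i) \<longlonglongrightarrow> delta_term f \<sigma> i k"
proof -
  note w = w_plus_dual_bounds[OF i(1)]
  have N: "filterlim (\<lambda>j. k + (mu i + Suc j)) sequentially sequentially"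
    by (rule filterlim_subseq) (auto simp: strict_mono_def)
  have M: "filterlim (\<lambda>j. mu i + Suc j) sequentially sequentially"
    by (rule filterlim_subseq) (auto simp: strict_mono_def)
  have "phi ^ k \<ge> phi ^ 1" using i phi_gt_1 by (intro power_increasing) auto
  then have "w_plus_dual i / phi ^ k < 1" using w phi_gt_1 by simp
  then have "(\<lambda>j. 1 / real (fib (k + (mu i + Suc j))) powr \<sigma>
      * (g (of_int (wythoff i (int k)) / real (fib (k + (mu i + Suc j))))
         * g (of_int (wythoff_dual i (mu i + Suc j)) / real (fib (k + (mu i + Suc j))))))
    \<longlonglongrightarrow> f 0 / (pi powr \<sigma> * of_int (wythoff i (int k)) powr \<sigma>)
      * (f (w_plus_dual i / phi ^ k) / sin (pi * (w_plus_dual i / phi ^ k)) powr \<sigma>)"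
    using w wythoff_pos[OF i(1), of k] yarg_bounds(1)[OF i, of "Suc _"]
    by (intro g_product_limit filterlim_compose[OF fib_at_top N] filterlim_compose[OF yarg_limit M])
      (auto simp: fib_neq_0_nat yarg_def)
  then show ?thesis unfolding summand_def[symmetric] delta_term_def c_def by (intro tendsto_intros)
qed

lemma delta_dual_term_limit:
  assumes i: "i \<ge> 1" "j \<ge> 1"
  shows "(\<lambda>k. summand i (Suc k) (mu i + j) - c i) \<longlonglongrightarrow> delta_dual_term f \<sigma> i j"
proof -
  have wp: "w_plus i > 0" using w_plus_ge_phi[OF i(1)] phi_gt_1 by linarith
  have N: "filterlim (\<lambda>k. Suc k + (mu i + j)) sequentially sequentially"
    by (rule filterlim_subseq) (auto simp: strict_mono_def)
  have M: "filterlim (\<lambda>k. Suc k) sequentially sequentially"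
    by (rule filterlim_subseq) (auto simp: strict_mono_def)
  have "phi ^ (mu i + j) \<ge> phi ^ Suc (mu i)" using i phi_gt_1 by (intro power_increasing) auto
  then have l1: "w_plus i / phi ^ (mu i + j) < 1" using mu_bounds(2)[OF i(1)] wp by simp
  have V: "real_of_int (wythoff_dual i (mu i + j)) > 0"
    using yarg_bounds(1)[OF i(1) order_refl i(2)] by (simp add: yarg_def zero_less_divide_iff)
  have "(\<lambda>k. 1 / real (fib (Suc k + (mu i + j))) powr \<sigma>
      * (g (of_int (wythoff_dual i (mu i + j)) / real (fib (Suc k + (mu i + j))))
         * g (of_int (wythoff i (int (Suc k))) / real (fib (Suc k + (mu i + j))))))
    \<longlonglongrightarrow> f 0 / (pi powr \<sigma> * of_int (wythoff_dual i (mu i + j)) powr \<sigma>)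
      * (f (w_plus i / phi ^ (mu i + j)) / sin (pi * (w_plus i / phi ^ (mu i + j))) powr \<sigma>)"
    using wp wythoff_pos[OF i(1)] l1 V
    by (intro g_product_limit filterlim_compose[OF fib_at_top N] filterlim_compose[OF xarg_limit M])
      (auto simp: fib_neq_0_nat simp del: of_nat_Suc fib.simps)
  then have "(\<lambda>k. summand i (Suc k) (mu i + j)) \<longlonglongrightarrow>
      f (w_plus i / phi ^ (mu i + j)) / sin (pi * (w_plus i / phi ^ (mu i + j))) powr \<sigma>
      * (f 0 / (pi powr \<sigma> * of_int (wythoff_dual i (mu i + j)) powr \<sigma>))"
    by (simp only: summand_def ac_simps)
  then show ?thesis unfolding delta_dual_term_def c_def by (intro tendsto_intros)
qed

definition rowsum :: "nat \<Rightarrow> nat \<Rightarrow> real" where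
  "rowsum i n = (\<Sum>k\<in>{1..<n - mu i}. summand i k (n - k) - c i)"

lemma rowsum_eq:
  "rowsum i (mu i + 2 + r) = (\<Sum>k\<le>r. summand i (Suc k) (mu i + Suc (r - k)) - c i)"
  unfolding rowsum_def
  by (rule sum.reindex_bij_witness[of _ Suc "\<lambda>k. k - 1"]) (auto simp: Suc_diff_le algebra_simps)

lemma rowsum_empty: "n < mu i + 2 \<Longrightarrow> rowsum i n = 0"
  by (simp add: rowsum_def)

text \<open>The errors decay from both ends of the row, so their sum is bounded independently of the length
  of the row, and in the limit each end contributes its own series.\<close>

lemma row_analysis:
  obtains B where "B \<ge> 0" "\<And>i n. i \<ge> 1 \<Longrightarrow> \<bar>rowsum i n\<bar> \<le> B * (1 / eta i powr \<sigma>)"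
    "\<And>i. i \<ge> 1 \<Longrightarrow> summable (\<lambda>k. delta_term f \<sigma> i (Suc k))"
    "\<And>i. i \<ge> 1 \<Longrightarrow> summable (\<lambda>j. delta_dual_term f \<sigma> i (Suc j))"
    "\<And>i. i \<ge> 1 \<Longrightarrow> rowsum i \<longlonglongrightarrow> delta f \<sigma> i + delta_dual f \<sigma> i"
proof -
  obtain B where B: "B \<ge> 0" "\<And>i k j. i \<ge> 1 \<Longrightarrow> k \<ge> 1 \<Longrightarrow> j \<ge> 1 \<Longrightarrow>
    \<bar>summand i k (mu i + j) - c i\<bar> \<le> B / eta i powr \<sigma> * (q ^ k + q ^ j)"
    using summand_bound by metis
  have "\<bar>summand i (Suc k) (mu i + Suc j) - c i\<bar> \<le> B / eta i powr \<sigma> * (q ^ k + q ^ j)"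
    if "i \<ge> 1" for i k j
  proof -
    have "q ^ Suc k + q ^ Suc j \<le> q ^ k + q ^ j"
      using q by (intro add_mono power_decreasing) auto
    then have "B / eta i powr \<sigma> * (q ^ Suc k + q ^ Suc j) \<le> B / eta i powr \<sigma> * (q ^ k + q ^ j)"
      using B(1) by (intro mult_left_mono) auto
    with B(2)[OF that, of "Suc k" "Suc j"] show ?thesis by simp
  qed
  note bd = this
  have M: "B / eta i powr \<sigma> \<ge> 0" for i using B(1) by simp
  have d: "(\<lambda>j. summand i (Suc k) (mu i + Suc j) - c i) \<longlonglongrightarrow> delta_term f \<sigma> i (Suc k)" if "i \<ge> 1" for i k
    using that by (intro delta_term_limit) auto
  have e: "(\<lambda>k. summand i (Suc k) (mu i + Suc j) - c i) \<longlonglongrightarrow> delta_dual_term f \<sigma> i (Suc j)" if "i \<ge> 1" for i j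
    using that by (intro delta_dual_term_limit) auto
  show ?thesis
  proof (rule that[of "2 * B / (1 - q)"])
    show "2 * B / (1 - q) \<ge> 0" using B q by simp
    fix i :: nat assume i: "i \<ge> 1"
    note Ti = two_sided_tannery[where A = "\<lambda>k j. summand i (Suc k) (mu i + Suc j) - c i"
        and M = "B / eta i powr \<sigma>" and d = "\<lambda>k. delta_term f \<sigma> i (Suc k)"
        and e = "\<lambda>j. delta_dual_term f \<sigma> i (Suc j)", OF q(1,2) M bd[OF i] d[OF i] e[OF i]]
    show "summable (\<lambda>k. delta_term f \<sigma> i (Suc k))" by (rule Ti(1))
    show "summable (\<lambda>j. delta_dual_term f \<sigma> i (Suc j))" by (rule Ti(2))
    show "\<bar>rowsum i n\<bar> \<le> 2 * B / (1 - q) * (1 / eta i powr \<sigma>)" for n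
    proof (cases "n < mu i + 2")
      case True
      then show ?thesis using B q by (simp add: rowsum_empty)
    next
      case False
      then obtain r where r: "n = mu i + 2 + r" using le_Suc_ex not_less by blast
      have "\<bar>rowsum i n\<bar> \<le> 2 * (B / eta i powr \<sigma>) / (1 - q)"
        unfolding r rowsum_eq by (rule Ti(4))
      then show ?thesis by (simp add: mult.commute)
    qed
    have "(\<lambda>r. rowsum i (r + (mu i + 2))) \<longlonglongrightarrow> delta f \<sigma> i + delta_dual f \<sigma> i"
      using Ti(3) unfolding delta_def delta_dual_def rowsum_eq[symmetric] by (simp add: add.commute)
    then show "rowsum i \<longlonglongrightarrow> delta f \<sigma> i + delta_dual f \<sigma> i" by (rule LIMSEQ_offset)
  qed
qed

section \<open>Reduction of the Fibonacci sum to the rows\<close>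

definition T :: "nat \<Rightarrow> nat \<Rightarrow> real" where
  "T n m = 1 / real (fib n) powr \<sigma> * (g (real m / real (fib n)) * g (real (fib (n - 1)) * real m / real (fib n)))"

lemma fib_sum_eq: "fib_sum f \<sigma> n = (\<Sum>m = 1..fib n - 1. T n m)"
  unfolding fib_sum_def T_def g_def by (simp add: sum_distrib_left mult.assoc)

lemma f_minus: "f (- x) = f x"
  using symmetric[of "- x"] periodic[of x] by (simp add: add.commute)

lemma g_minus: "g (- x) = g x"
  by (simp add: g_def f_minus)

lemma g_plus_1: "g (x + 1) = g x"
  by (simp add: g_def periodic distrib_left sin_add)

lemma g_plus_int: "g (x + of_int z) = g x"
proof (induction z rule: int_induct[where k = 0])
  case (step1 z)
  then show ?case using g_plus_1[of "x + of_int z"] by (simp add: add.assoc)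
next
  case (step2 z)
  then show ?case using g_plus_1[of "x + of_int (z - 1)"] by (simp add: add.assoc)
qed simp

lemma g_int_minus: "g (of_int z - x) = g x"
  using g_plus_int[of "- x" z] by (simp add: g_minus add.commute)

lemma T_reflect:
  assumes "m \<le> fib n" "fib n > 0"
  shows "T n (fib n - m) = T n m"
proof -
  let ?N = "real (fib n)"
  have "real (fib n - m) / ?N = of_int 1 - real m / ?N"
    using assms by (simp add: of_nat_diff field_simps)
  moreover have "real (fib (n - 1)) * real (fib n - m) / ?N
      = of_int (int (fib (n - 1))) - real (fib (n - 1)) * real m / ?N"
    using assms by (simp add: of_nat_diff field_simps)
  ultimately show ?thesis unfolding T_def by (simp only: g_int_minus)
qed

text \<open>By \<open>fib_wythoff\<close> the second argument equals, up to sign and an integer, the dual entry over \<open>F\<^sub>n\<close>;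
  and \<open>g\<close> is even and periodic.\<close>

lemma T_wythoff:
  assumes "i \<ge> 1" "k \<ge> 1"
  shows "T (k + m) (nat (wythoff i (int k))) = summand i k m"
proof -
  obtain l where l: "k = Suc l" using assms by (cases k) auto
  let ?N = "real (fib (k + m))"
  have N: "?N > 0" using assms by (simp add: fib_neq_0_nat)
  have W: "real (nat (wythoff i (int k))) = of_int (wythoff i (int k))"
    using wythoff_pos[OF assms(1), of k] by simp
  have e: "int (fib (k + m - 1)) * wythoff i (int k) = int (fib (k + m)) * wythoff i (int l) + (-1) ^ k * wythoff_dual i m"
    using fib_wythoff[of l m i] by (simp add: l add.commute)
  have "real (fib (k + m - 1)) * of_int (wythoff i (int k)) = of_int (int (fib (k + m - 1)) * wythoff i (int k))"
    by simp
  also have "\<dots> = ?N * of_int (wythoff i (int l)) + (-1) ^ k * of_int (wythoff_dual i m)"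
    unfolding e by simp
  finally have "real (fib (k + m - 1)) * of_int (wythoff i (int k)) / ?N
      = (-1) ^ k * (of_int (wythoff_dual i m) / ?N) + of_int (wythoff i (int l))"
    using N by (simp add: field_simps)
  then have "g (real (fib (k + m - 1)) * of_int (wythoff i (int k)) / ?N) = g ((-1) ^ k * (of_int (wythoff_dual i m) / ?N))"
    by (simp only: g_plus_int)
  also have "\<dots> = g (of_int (wythoff_dual i m) / ?N)"
    by (cases "even k") (simp_all add: g_minus)
  finally show ?thesis unfolding T_def summand_def W by simp
qed

lemma g_half_bound: "\<bar>g (of_int z / 2)\<bar> \<le> \<bar>g 0\<bar> + \<bar>g (1 / 2)\<bar>"
proof (cases "even z")
  case True
  then obtain a where "z = 2 * a" by blast
  then have "g (of_int z / 2) = g 0" using g_plus_int[of 0 a] by simp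
  then show ?thesis by simp
next
  case False
  then obtain a where "z = 2 * a + 1" by (elim oddE)
  then have "real_of_int z / 2 = 1 / 2 + of_int a" by simp
  then have "g (of_int z / 2) = g (1 / 2)" by (simp only: g_plus_int)
  then show ?thesis by simp
qed

text \<open>If \<open>F\<^sub>n\<close> is even, the index \<open>F\<^sub>n / 2\<close> is its own mirror image and has to be treated separately;
  otherwise this sum is empty.\<close>

definition midterm :: "nat \<Rightarrow> real" where
  "midterm n = (\<Sum>m | 1 \<le> m \<and> 2 * m = fib n. T n m)"

lemma midterm_bound: "\<bar>midterm n\<bar> \<le> (\<bar>g 0\<bar> + \<bar>g (1 / 2)\<bar>)\<^sup>2 / real (fib n) powr \<sigma>"
proof (cases "\<exists>m\<ge>1. 2 * m = fib n")
  case True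
  then obtain m where m: "m \<ge> 1" "2 * m = fib n" by blast
  then have "{m. 1 \<le> m \<and> 2 * m = fib n} = {m}" by auto
  then have "midterm n = T n m" by (simp add: midterm_def)
  moreover have "real m / real (fib n) = of_int 1 / 2" "real (fib (n - 1)) * real m / real (fib n) = of_int (int (fib (n - 1))) / 2"
    using m by (auto simp: field_simps simp flip: m(2))
  ultimately have "\<bar>midterm n\<bar> = 1 / real (fib n) powr \<sigma> * (\<bar>g (of_int 1 / 2)\<bar> * \<bar>g (of_int (int (fib (n - 1))) / 2)\<bar>)"
    unfolding T_def by (simp only: abs_mult) simp
  also have "\<dots> \<le> 1 / real (fib n) powr \<sigma> * ((\<bar>g 0\<bar> + \<bar>g (1 / 2)\<bar>) * (\<bar>g 0\<bar> + \<bar>g (1 / 2)\<bar>))"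
    by (intro mult_left_mono mult_mono g_half_bound) auto
  finally show ?thesis by (simp add: power2_eq_square)
next
  case False
  then have e: "{m. 1 \<le> m \<and> 2 * m = fib n} = {}" by auto
  show ?thesis unfolding midterm_def e by simp
qed

lemma midterm_limit: "midterm \<longlonglongrightarrow> 0"
proof (rule Lim_null_comparison)
  have "filterlim (\<lambda>n. real (fib n) powr \<sigma>) at_top sequentially"
    using sigma by (intro filterlim_compose[OF _ fib_at_top]) real_asymp
  then show "(\<lambda>n. (\<bar>g 0\<bar> + \<bar>g (1 / 2)\<bar>)\<^sup>2 / real (fib n) powr \<sigma>) \<longlonglongrightarrow> 0"
    by (intro real_tendsto_divide_at_top[OF tendsto_const])
qed (use midterm_bound in auto)

definition halfsum :: "nat \<Rightarrow> real" where
  "halfsum n = (\<Sum>m | 1 \<le> m \<and> 2 * m < fib n. T n m)"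

lemma fib_sum_halves: "fib n > 0 \<Longrightarrow> fib_sum f \<sigma> n = 2 * halfsum n + midterm n"
proof -
  assume N: "fib n > 0"
  let ?H = "{m. 1 \<le> m \<and> 2 * m < fib n}" and ?M = "{m. 1 \<le> m \<and> 2 * m = fib n}"
    and ?U = "{m. m < fib n \<and> fib n < 2 * m}"
  have fin: "finite ?H" "finite ?M" "finite ?U" by (rule finite_subset[of _ "{..fib n}"]; auto)+
  have "{1..fib n - 1} = ?H \<union> (?M \<union> ?U)" using N by auto
  then have "fib_sum f \<sigma> n = (\<Sum>m\<in>?H \<union> (?M \<union> ?U). T n m)" by (simp add: fib_sum_eq)
  also have "\<dots> = (\<Sum>m\<in>?H. T n m) + ((\<Sum>m\<in>?M. T n m) + (\<Sum>m\<in>?U. T n m))"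
    using fin by (subst sum.union_disjoint; (subst sum.union_disjoint)?) auto
  also have "(\<Sum>m\<in>?U. T n m) = (\<Sum>m\<in>?H. T n m)"
    by (rule sum.reindex_bij_witness[of _ "\<lambda>m. fib n - m" "\<lambda>m. fib n - m"])
      (auto simp: T_reflect[OF _ N] less_imp_le)
  finally show ?thesis by (simp add: halfsum_def midterm_def)
qed

definition rows :: "nat \<Rightarrow> nat set" where "rows n = {i. 1 \<le> i \<and> mu i + 1 < n}"

lemma finite_rows: "finite (rows n)"
proof (rule finite_subset)
  show "rows n \<subseteq> {..nat \<lceil>phi ^ n\<rceil>}"
  proof
    fix i assume "i \<in> rows n"
    then have i: "1 \<le> i" "Suc (mu i) \<le> n" by (auto simp: rows_def)
    have "1 * real i \<le> phi * real i" using phi_gt_1 by (intro mult_right_mono) auto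
    also have "\<dots> \<le> w_plus i" by (rule w_plus_ge)
    also have "\<dots> \<le> phi ^ Suc (mu i)" using mu_bounds(2)[OF i(1)] w_plus_ge_phi[OF i(1)] phi_gt_1 by linarith
    also have "\<dots> \<le> phi ^ n" using i phi_gt_1 by (intro power_increasing) auto
    finally have "real i \<le> real_of_int \<lceil>phi ^ n\<rceil>" using le_of_int_ceiling[of "phi ^ n"] by linarith
    then show "i \<in> {..nat \<lceil>phi ^ n\<rceil>}" by simp
  qed
qed simp

definition wsum :: "nat \<Rightarrow> real" where
  "wsum n = (\<Sum>i\<in>rows n. \<Sum>k\<in>{1..<n - mu i}. summand i k (n - k))"

text \<open>The entries with \<open>k + mu i < n\<close> are the positive integers below \<open>F\<^sub>n / 2\<close>, and possibly the middle
  index itself.\<close>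

lemma wsum_halfsum: "\<bar>wsum n - halfsum n\<bar> \<le> \<bar>midterm n\<bar>"
proof -
  define A where "A = Sigma (rows n) (\<lambda>i. {1..<n - mu i})"
  define w where "w = (\<lambda>(i, k). nat (wythoff i (int k)))"
  have A: "i \<ge> 1 \<and> k \<ge> 1 \<and> k < n \<and> n - k > mu i \<and> k + (n - k) = n" if "(i, k) \<in> A" for i k
    using that by (auto simp: A_def rows_def)
  have "wsum n = (\<Sum>(i, k)\<in>A. summand i k (n - k))"
    unfolding wsum_def A_def by (rule sum.Sigma) (auto simp: finite_rows)
  also have "\<dots> = (\<Sum>x\<in>A. T n (w x))"
  proof (rule sum.cong)
    fix x assume "x \<in> A"
    then obtain i k where x: "x = (i, k)" "(i, k) \<in> A" by (cases x) auto
    show "(case x of (i, k) \<Rightarrow> summand i k (n - k)) = T n (w x)"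
      using T_wythoff[of i k "n - k"] A[OF x(2)] by (simp add: x w_def)
  qed simp
  also have "\<dots> = (\<Sum>m\<in>w ` A. T n m)"
  proof (rule sum.reindex[symmetric, unfolded o_def])
    show "inj_on w A"
    proof (rule inj_onI)
      fix x y assume xy: "x \<in> A" "y \<in> A" "w x = w y"
      obtain i k j l where e: "x = (i, k)" "y = (j, l)" by (cases x, cases y) auto
      have "wythoff i (int k) = wythoff j (int l)"
        using xy A[of i k] A[of j l] wythoff_pos[of i k] wythoff_pos[of j l] by (auto simp: e w_def)
      with wythoff_inj[of i j k l] A[of i k] A[of j l] xy show "x = y" by (auto simp: e)
    qed
  qed
  finally have ws: "wsum n = (\<Sum>m\<in>w ` A. T n m)" .
  let ?H = "{m. 1 \<le> m \<and> 2 * m < fib n}" and ?M = "{m. 1 \<le> m \<and> 2 * m = fib n}"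
  have up: "w ` A \<subseteq> ?H \<union> ?M"
  proof
    fix m assume "m \<in> w ` A"
    then obtain i k where ik: "(i, k) \<in> A" "m = nat (wythoff i (int k))" by (auto simp: w_def)
    note a = A[OF ik(1)]
    have "wythoff i (int k) > 0" using a wythoff_pos by auto
    moreover have "2 * wythoff i (int k) \<le> int (fib n)"
      using wythoff_le_half[of i k "n - k"] a by auto
    ultimately show "m \<in> ?H \<union> ?M" using ik(2) by auto
  qed
  have lo: "?H \<subseteq> w ` A"
  proof
    fix m assume m: "m \<in> ?H"
    then have "int m \<ge> 1" by auto
    from wythoff_surj[OF this] obtain i k where ik: "i \<ge> 1" "k \<ge> 1" "wythoff i (int k) = int m" by blast
    have "\<not> n \<le> k + mu i"
    proof
      assume "n \<le> k + mu i"
      from wythoff_ge_half[OF ik(1,2) this] ik(3) m show False by auto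
    qed
    then have "(i, k) \<in> A" using ik by (auto simp: A_def rows_def)
    moreover have "w (i, k) = m" using ik(3) by (simp add: w_def)
    ultimately show "m \<in> w ` A" by (metis imageI)
  qed
  have finH: "finite ?H" "finite ?M" by (rule finite_subset[of _ "{..fib n}"]; auto)+
  define E where "E = w ` A \<inter> ?M"
  have wA: "w ` A = ?H \<union> E" using up lo by (auto simp: E_def)
  have "?H \<inter> E = {}" by (auto simp: E_def)
  moreover have "finite E" using finH by (simp add: E_def)
  ultimately have "wsum n = halfsum n + (\<Sum>m\<in>E. T n m)"
    unfolding ws halfsum_def wA using finH by (intro sum.union_disjoint)
  moreover have "E = {} \<or> E = ?M"
  proof -
    have "a = b" if "a \<in> ?M" "b \<in> ?M" for a b using that by auto
    then show ?thesis unfolding E_def by blast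
  qed
  ultimately show ?thesis unfolding midterm_def by auto
qed

lemma fib_sum_wsum: "(\<lambda>n. fib_sum f \<sigma> n - 2 * wsum n) \<longlonglongrightarrow> 0"
proof (rule Lim_null_comparison)
  show "(\<lambda>n. 3 * \<bar>midterm n\<bar>) \<longlonglongrightarrow> 0"
    using tendsto_mult[OF tendsto_const tendsto_rabs[OF midterm_limit], of 3] by simp
  show "eventually (\<lambda>n. norm (fib_sum f \<sigma> n - 2 * wsum n) \<le> 3 * \<bar>midterm n\<bar>) sequentially"
    using eventually_gt_at_top[of 0]
  proof eventually_elim
    case (elim n)
    have "fib_sum f \<sigma> n = 2 * halfsum n + midterm n" using elim by (intro fib_sum_halves fib_neq_0_nat)
    then show ?case using wsum_halfsum[of n] by simp
  qed
qed

section \<open>Summation over the rows\<close>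

lemma sum_rows_suminf:
  fixes F :: "nat \<Rightarrow> real"
  assumes "\<And>i. i \<ge> 1 \<Longrightarrow> i \<notin> rows n \<Longrightarrow> F i = 0"
  shows "summable (\<lambda>i. F (Suc i))" "(\<Sum>i. F (Suc i)) = (\<Sum>i\<in>rows n. F i)"
proof -
  let ?J = "{i. Suc i \<in> rows n}"
  have J: "rows n = Suc ` ?J"
  proof
    show "rows n \<subseteq> Suc ` ?J"
    proof
      fix i assume i: "i \<in> rows n"
      then have "i = Suc (i - 1)" by (auto simp: rows_def)
      with i show "i \<in> Suc ` ?J" by (metis imageI mem_Collect_eq)
    qed
  qed auto
  have fJ: "finite ?J" using finite_vimageI[OF finite_rows[of n] inj_Suc] by (simp add: vimage_def)
  have z: "F (Suc i) = 0" if "i \<notin> ?J" for i using assms[of "Suc i"] that by simp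
  show "summable (\<lambda>i. F (Suc i))" using summable_finite[OF fJ z] .
  have "(\<Sum>i. F (Suc i)) = (\<Sum>i\<in>?J. F (Suc i))" using suminf_finite[OF fJ z] .
  also have "\<dots> = (\<Sum>i\<in>Suc ` ?J. F i)" by (simp add: sum.reindex)
  finally show "(\<Sum>i. F (Suc i)) = (\<Sum>i\<in>rows n. F i)" by (simp only: J[symmetric])
qed

lemma c_eq: "c i = f 0 ^ 2 * 5 powr (\<sigma> / 2) / pi powr (2 * \<sigma>) * (1 / eta i powr \<sigma>)"
  by (simp add: c_def)

lemma summable_c: "summable (\<lambda>i. c (Suc i))"
  unfolding c_eq by (intro summable_mult summable_inv_eta sigma)

lemma summable_mu_c: "summable (\<lambda>i. (real (mu (Suc i)) + 1) * c (Suc i))"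
proof -
  have "summable (\<lambda>i. f 0 ^ 2 * 5 powr (\<sigma> / 2) / pi powr (2 * \<sigma>) * ((real (mu (Suc i)) + 1) / eta (Suc i) powr \<sigma>))"
    by (intro summable_mult summable_mu_eta sigma)
  then show ?thesis by (simp add: c_eq field_simps)
qed

lemma c_nonneg: "c i \<ge> 0" by (simp add: c_def)

text \<open>A row has \<open>n - mu i - 1\<close> columns, or none if this is negative. Written as
  \<open>n - (mu i + 1)\<close> plus the truncated difference \<open>mu i + 1 - n\<close>, this separates the terms linear and
  constant in \<open>n\<close> from a rest that vanishes in the limit.\<close>

lemma wsum_split:
  "wsum n = (\<Sum>i. rowsum (Suc i) n) + (real n * (\<Sum>i. c (Suc i)) - (\<Sum>i. (real (mu (Suc i)) + 1) * c (Suc i))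
     + (\<Sum>i. real (mu (Suc i) + 1 - n) * c (Suc i)))"
proof -
  have inner: "(\<Sum>k\<in>{1..<n - mu i}. summand i k (n - k)) = rowsum i n + real (n - (mu i + 1)) * c i" for i
    unfolding rowsum_def by (simp add: sum_subtractf of_nat_diff)
  have z1: "rowsum i n = 0" if "i \<ge> 1" "i \<notin> rows n" for i
    using that by (intro rowsum_empty) (auto simp: rows_def)
  have z2: "real (n - (mu i + 1)) * c i = 0" if "i \<ge> 1" "i \<notin> rows n" for i
    using that by (auto simp: rows_def)
  have "wsum n = (\<Sum>i\<in>rows n. rowsum i n) + (\<Sum>i\<in>rows n. real (n - (mu i + 1)) * c i)"
    unfolding wsum_def inner by (rule sum.distrib)
  also have "(\<Sum>i\<in>rows n. rowsum i n) = (\<Sum>i. rowsum (Suc i) n)"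
    by (rule sum_rows_suminf(2)[OF z1, symmetric])
  also have "(\<Sum>i\<in>rows n. real (n - (mu i + 1)) * c i) = (\<Sum>i. real (n - (mu (Suc i) + 1)) * c (Suc i))"
    by (rule sum_rows_suminf(2)[OF z2, symmetric])
  also have "\<dots> = (\<Sum>i. real n * c (Suc i) - (real (mu (Suc i)) + 1) * c (Suc i) + real (mu (Suc i) + 1 - n) * c (Suc i))"
  proof (rule arg_cong[where f = suminf], rule ext)
    fix i
    have "real (n - (mu (Suc i) + 1)) = real n - (real (mu (Suc i)) + 1) + real (mu (Suc i) + 1 - n)"
      by (cases "n \<le> mu (Suc i) + 1") (auto simp: of_nat_diff)
    then show "real (n - (mu (Suc i) + 1)) * c (Suc i) = real n * c (Suc i) - (real (mu (Suc i)) + 1) * c (Suc i) + real (mu (Suc i) + 1 - n) * c (Suc i)"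
      by (simp only: distrib_right left_diff_distrib)
  qed
  also have "\<dots> = real n * (\<Sum>i. c (Suc i)) - (\<Sum>i. (real (mu (Suc i)) + 1) * c (Suc i)) + (\<Sum>i. real (mu (Suc i) + 1 - n) * c (Suc i))"
  proof -
    have s3: "summable (\<lambda>i. real (mu (Suc i) + 1 - n) * c (Suc i))"
      by (rule summable_comparison_test[OF _ summable_mu_c])
        (auto simp: abs_mult c_nonneg intro!: exI[of _ 0] mult_right_mono)
    have s1: "summable (\<lambda>i. real n * c (Suc i))" by (intro summable_mult summable_c)
    show ?thesis
      using suminf_add[OF summable_diff[OF s1 summable_mu_c] s3] suminf_diff[OF s1 summable_mu_c]
        suminf_mult[OF summable_c, of "real n"] by simp
  qed
  finally show ?thesis .
qed

text \<open>By dominated convergence over the rows, with majorants from \<open>row_analysis\<close> and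
  \<open>summable_mu_c\<close>.\<close>

theorem fib_sum_asymptotics:
  defines "K \<equiv> f 0 ^ 2 * 5 powr (\<sigma> / 2) / pi powr (2 * \<sigma>)"
  defines "d \<equiv> \<lambda>i. delta f \<sigma> i + delta_dual f \<sigma> i - K * ((real (mu i) + 1) / eta i powr \<sigma>)"
  shows "\<And>i. i \<ge> 1 \<Longrightarrow> summable (\<lambda>k. delta_term f \<sigma> i (Suc k))"
    and "\<And>i. i \<ge> 1 \<Longrightarrow> summable (\<lambda>j. delta_dual_term f \<sigma> i (Suc j))"
    and "summable (\<lambda>i. d (Suc i))"
    and "(\<lambda>n. fib_sum f \<sigma> n - (2 * K * (\<Sum>i. 1 / eta (Suc i) powr \<sigma>) * real n + 2 * (\<Sum>i. d (Suc i)))) \<longlonglongrightarrow> 0"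
proof -
  obtain B where B: "B \<ge> 0" "\<And>i n. i \<ge> 1 \<Longrightarrow> \<bar>rowsum i n\<bar> \<le> B * (1 / eta i powr \<sigma>)"
    and s: "\<And>i. i \<ge> 1 \<Longrightarrow> summable (\<lambda>k. delta_term f \<sigma> i (Suc k))"
    "\<And>i. i \<ge> 1 \<Longrightarrow> summable (\<lambda>j. delta_dual_term f \<sigma> i (Suc j))"
    and l: "\<And>i. i \<ge> 1 \<Longrightarrow> rowsum i \<longlonglongrightarrow> delta f \<sigma> i + delta_dual f \<sigma> i"
    using row_analysis by metis
  show "summable (\<lambda>k. delta_term f \<sigma> i (Suc k))" "summable (\<lambda>j. delta_dual_term f \<sigma> i (Suc j))"
    if "i \<ge> 1" for i using s that by auto
  have l': "(\<lambda>n. rowsum (Suc i) n) \<longlonglongrightarrow> delta f \<sigma> (Suc i) + delta_dual f \<sigma> (Suc i)" for i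
    using l[of "Suc i"] by simp
  have b': "\<bar>rowsum (Suc i) n\<bar> \<le> B * (1 / eta (Suc i) powr \<sigma>)" for i n using B(2)[of "Suc i"] by simp
  note t1 = tannery[OF l' b' summable_mult[OF summable_inv_eta[OF sigma]]]
  have t2: "(\<lambda>n. \<Sum>i. real (mu (Suc i) + 1 - n) * c (Suc i)) \<longlonglongrightarrow> (\<Sum>i. 0)"
  proof (rule tannery(2)[OF _ _ summable_mu_c])
    fix i
    have "eventually (\<lambda>n. 0 = real (mu (Suc i) + 1 - n) * c (Suc i)) sequentially"
      using eventually_ge_at_top[of "mu (Suc i) + 1"] by eventually_elim simp
    then show "(\<lambda>n. real (mu (Suc i) + 1 - n) * c (Suc i)) \<longlonglongrightarrow> 0"
      using tendsto_cong tendsto_const by fast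
    show "\<bar>real (mu (Suc i) + 1 - n) * c (Suc i)\<bar> \<le> (real (mu (Suc i)) + 1) * c (Suc i)" for n
      by (auto simp: abs_mult c_nonneg intro!: mult_right_mono)
  qed
  have dd: "d i = delta f \<sigma> i + delta_dual f \<sigma> i - (real (mu i) + 1) * c i" for i
    by (simp add: d_def K_def c_eq)
  show sd: "summable (\<lambda>i. d (Suc i))" unfolding dd by (intro summable_diff t1(1) summable_mu_c)
  have sumd: "(\<Sum>i. d (Suc i)) = (\<Sum>i. delta f \<sigma> (Suc i) + delta_dual f \<sigma> (Suc i)) - (\<Sum>i. (real (mu (Suc i)) + 1) * c (Suc i))"
    unfolding dd by (rule suminf_diff[OF t1(1) summable_mu_c, symmetric])
  have sumc: "(\<Sum>i. c (Suc i)) = K * (\<Sum>i. 1 / eta (Suc i) powr \<sigma>)"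
    unfolding c_eq K_def by (rule suminf_mult[OF summable_inv_eta[OF sigma]])
  have "(\<lambda>n. (fib_sum f \<sigma> n - 2 * wsum n) + 2 * ((\<Sum>i. rowsum (Suc i) n) - (\<Sum>i. delta f \<sigma> (Suc i) + delta_dual f \<sigma> (Suc i))
      + (\<Sum>i. real (mu (Suc i) + 1 - n) * c (Suc i)))) \<longlonglongrightarrow>
      0 + 2 * ((\<Sum>i. delta f \<sigma> (Suc i) + delta_dual f \<sigma> (Suc i)) - (\<Sum>i. delta f \<sigma> (Suc i) + delta_dual f \<sigma> (Suc i)) + (\<Sum>i::nat. 0))"
    by (intro tendsto_intros fib_sum_wsum t1(2) t2)
  then show "(\<lambda>n. fib_sum f \<sigma> n - (2 * K * (\<Sum>i. 1 / eta (Suc i) powr \<sigma>) * real n + 2 * (\<Sum>i. d (Suc i)))) \<longlonglongrightarrow> 0"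
    unfolding wsum_split sumd sumc by (simp add: algebra_simps)
qed

end

section \<open>The ring of integers\<close>

definition emb :: "int \<Rightarrow> int \<Rightarrow> real" where "emb a b = of_int a + of_int b * phi"

text \<open>The conjugate embedding.\<close>

definition emb' :: "int \<Rightarrow> int \<Rightarrow> real" where "emb' a b = of_int a + of_int b * psi"

text \<open>The norm of \<open>a + b * phi\<close>.\<close>

definition nm :: "int \<Rightarrow> int \<Rightarrow> int" where "nm a b = a * a + a * b - b * b"

lemma emb_nm: "emb a b * emb' a b = of_int (nm a b)"
proof -
  have "emb a b * emb' a b = of_int a * of_int a + of_int a * of_int b * (phi + psi) + of_int b * of_int b * (phi * psi)"
    by (simp add: emb_def emb'_def algebra_simps)
  then show ?thesis by (simp add: phi_psi nm_def) (simp add: psi_def)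
qed

lemma emb_mult: "emb a b * emb c d = emb (a * c + b * d) (a * d + b * c + b * d)"
  by (simp add: emb_def algebra_simps phi_sq phi_sq_left)

lemma emb'_mult: "emb' a b * emb' c d = emb' (a * c + b * d) (a * d + b * c + b * d)"
proof -
  have "emb' a b * emb' c d = of_int a * of_int c + (of_int a * of_int d + of_int b * of_int c) * psi + of_int b * of_int d * (psi * psi)"
    by (simp add: emb'_def algebra_simps)
  then show ?thesis unfolding psi_sq by (simp add: emb'_def algebra_simps)
qed

lemma emb_inj: "emb a b = emb c d \<longleftrightarrow> a = c \<and> b = d"
proof
  assume "emb a b = emb c d"
  then have "real_of_int (a - c) + real_of_int (b - d) * phi = 0" by (simp add: emb_def algebra_simps)
  from phi_irrational[OF this] show "a = c \<and> b = d" by simp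
qed auto

lemma emb_add: "emb a b + emb c d = emb (a + c) (b + d)"
  and emb_diff: "emb a b - emb c d = emb (a - c) (b - d)"
  and emb_minus: "- emb a b = emb (- a) (- b)"
  by (simp_all add: emb_def algebra_simps)

lemma nm_mult: "nm (a * c + b * d) (a * d + b * c + b * d) = nm a b * nm c d"
  by (simp add: nm_def algebra_simps)

lemma nm_eq_0: "nm a b = 0 \<longleftrightarrow> a = 0 \<and> b = 0"
proof
  assume "nm a b = 0"
  then have "emb a b = 0 \<or> emb' a b = 0" using emb_nm[of a b] by auto
  then show "a = 0 \<and> b = 0"
  proof
    assume "emb a b = 0"
    then show ?thesis using phi_irrational[of a b] by (simp add: emb_def)
  next
    assume "emb' a b = 0"
    then show ?thesis using phi_irrational[of "a + b" "- b"] by (simp add: emb'_def psi_def algebra_simps)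
  qed
qed (simp add: nm_def)

lemma carrier_Z_phi: "carrier Z_phi = {emb a b | a b. True}"
  by (simp add: Z_phi_def emb_def)

lemma emb_carrier [simp]: "emb a b \<in> carrier Z_phi"
  by (auto simp: carrier_Z_phi)

lemma Z_phi_simps [simp]:
  "x \<otimes>\<^bsub>Z_phi\<^esub> y = x * y" "x \<oplus>\<^bsub>Z_phi\<^esub> y = x + y" "\<zero>\<^bsub>Z_phi\<^esub> = 0" "\<one>\<^bsub>Z_phi\<^esub> = 1"
  by (simp_all add: Z_phi_def)

interpretation Z: cring Z_phi by (rule cring_Z_phi)

lemma Z_minus: "x \<in> carrier Z_phi \<Longrightarrow> y \<in> carrier Z_phi \<Longrightarrow> x \<ominus>\<^bsub>Z_phi\<^esub> y = x - y"
proof -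
  assume x: "x \<in> carrier Z_phi" and y: "y \<in> carrier Z_phi"
  have "y + (\<ominus>\<^bsub>Z_phi\<^esub> y) = 0" using Z.r_neg[OF y] by simp
  then show ?thesis using x y by (simp add: a_minus_def)
qed

section \<open>Euclidean division and principal ideals\<close>

lemma nearest_multiple:
  fixes p N :: int
  assumes "N \<noteq> 0" shows "\<exists>x. 2 * \<bar>p - N * x\<bar> \<le> \<bar>N\<bar>"
proof -
  define x where "x = round (of_int p / of_int N :: real)"
  have "\<bar>of_int x - of_int p / of_int N\<bar> \<le> (1/2 :: real)" unfolding x_def by (rule of_int_round_abs_le)
  then have "\<bar>of_int x - of_int p / of_int N\<bar> * \<bar>of_int N\<bar> \<le> 1/2 * \<bar>of_int N :: real\<bar>" by (intro mult_right_mono) auto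
  also have "\<bar>of_int x - of_int p / of_int N\<bar> * \<bar>of_int N\<bar> = \<bar>of_int p - of_int N * of_int x :: real\<bar>"
  proof -
    have "(of_int x - of_int p / of_int N) * of_int N = - (of_int p - of_int N * of_int x :: real)"
      using assms by (simp add: left_diff_distrib)
    then show ?thesis unfolding abs_mult[symmetric] by (simp only: abs_minus_cancel)
  qed
  finally have "real_of_int (2 * \<bar>p - N * x\<bar>) \<le> of_int \<bar>N\<bar>" by simp
  then have "2 * \<bar>p - N * x\<bar> \<le> \<bar>N\<bar>" unfolding of_int_le_iff .
  then show ?thesis by blast
qed

lemma nm_small:
  fixes s t N :: int
  assumes "2 * \<bar>s\<bar> \<le> \<bar>N\<bar>" "2 * \<bar>t\<bar> \<le> \<bar>N\<bar>"
  shows "2 * \<bar>nm s t\<bar> \<le> N * N"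
proof -
  have a: "(2 * \<bar>s\<bar>) * (2 * \<bar>s\<bar>) \<le> \<bar>N\<bar> * \<bar>N\<bar>" "(2 * \<bar>s\<bar>) * (2 * \<bar>t\<bar>) \<le> \<bar>N\<bar> * \<bar>N\<bar>" "(2 * \<bar>t\<bar>) * (2 * \<bar>t\<bar>) \<le> \<bar>N\<bar> * \<bar>N\<bar>"
    using assms by (intro mult_mono; simp)+
  have "\<bar>s * t\<bar> = \<bar>s\<bar> * \<bar>t\<bar>" "s * s = \<bar>s\<bar> * \<bar>s\<bar>" "t * t = \<bar>t\<bar> * \<bar>t\<bar>" by (simp_all add: abs_mult)
  then have "4 * (s * s) \<le> N * N" "4 * \<bar>s * t\<bar> \<le> N * N" "4 * (t * t) \<le> N * N" using a by auto
  moreover have "0 \<le> s * s" "0 \<le> t * t" by auto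
  moreover have "s * t \<le> \<bar>s * t\<bar>" "- (s * t) \<le> \<bar>s * t\<bar>" by auto
  moreover have "2 * (A + B - C) \<le> M \<and> - (2 * (A + B - C)) \<le> M"
    if "4 * A \<le> M" "4 * b \<le> M" "4 * C \<le> M" "0 \<le> A" "0 \<le> C" "B \<le> b" "- B \<le> b"
    for A B C M b :: int using that by auto
  ultimately have "2 * nm s t \<le> N * N \<and> - (2 * nm s t) \<le> N * N" unfolding nm_def by blast
  then show ?thesis by (simp add: abs_if)
qed

text \<open>The quotient is computed in \<open>\<rat>(\<phi>)\<close> and both coordinates are rounded to nearest integers. The
  remainder has relative norm at most \<open>1/4 + 1/4\<close>. To stay in the integers, everything is multiplied
  by the conjugate of the divisor, whose coordinates are \<open>c + d\<close> and \<open>- d\<close>.\<close>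

lemma euclidean_division:
  assumes "\<not> (c = 0 \<and> d = 0)"
  shows "\<exists>x y r s. emb a b - emb c d * emb x y = emb r s \<and> \<bar>nm r s\<bar> < \<bar>nm c d\<bar>"
proof -
  define N where "N = nm c d"
  have N: "N \<noteq> 0" using assms nm_eq_0 by (simp add: N_def)
  define p where "p = a * (c + d) + b * (- d)"
  define t where "t = a * (- d) + b * (c + d) + b * (- d)"
  obtain x where x: "2 * \<bar>p - N * x\<bar> \<le> \<bar>N\<bar>" using nearest_multiple[OF N] by blast
  obtain y where y: "2 * \<bar>t - N * y\<bar> \<le> \<bar>N\<bar>" using nearest_multiple[OF N] by blast
  define r where "r = a - (c * x + d * y)"
  define s where "s = b - (c * y + d * x + d * y)"
  have 1: "emb a b - emb c d * emb x y = emb r s" by (simp add: emb_mult emb_diff r_def s_def)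
  have nc: "nm (c + d) (- d) = N" by (simp add: nm_def N_def algebra_simps)
  have e1: "r * (c + d) + s * (- d) = p - N * x" by (simp add: r_def s_def p_def N_def nm_def algebra_simps)
  have e2: "r * (- d) + s * (c + d) + s * (- d) = t - N * y" by (simp add: r_def s_def t_def N_def nm_def algebra_simps)
  have "nm r s * N = nm (p - N * x) (t - N * y)"
    using nm_mult[of r "c + d" s "- d"] unfolding e1 e2 nc by simp
  then have "(2 * \<bar>nm r s\<bar>) * \<bar>N\<bar> \<le> \<bar>N\<bar> * \<bar>N\<bar>"
    using nm_small[OF x y] by (simp add: mult.assoc abs_mult[symmetric])
  then have "2 * \<bar>nm r s\<bar> \<le> \<bar>N\<bar>" by (rule mult_right_le_imp_le) (use N in simp)
  then have "\<bar>nm r s\<bar> < \<bar>N\<bar>" using N by linarith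
  with 1 show ?thesis unfolding N_def by blast
qed

abbreviation pid :: "int \<Rightarrow> int \<Rightarrow> real set" where "pid a b \<equiv> PIdl\<^bsub>Z_phi\<^esub> (emb a b)"

lemma pid_mem: "z \<in> pid a b \<longleftrightarrow> (\<exists>x y. z = emb x y * emb a b)"
  by (auto simp: cgenideal_def carrier_Z_phi)

lemma pid_ideal: "ideal (pid a b) Z_phi"
  by (rule Z.cgenideal_ideal) simp

lemma ideal_principal:
  assumes I: "ideal I Z_phi" "I \<noteq> {0}"
  shows "\<exists>c d. \<not> (c = 0 \<and> d = 0) \<and> I = pid c d"
proof -
  interpret I: ideal I Z_phi by (rule I(1))
  define S where "S = {(c, d). emb c d \<in> I \<and> \<not> (c = 0 \<and> d = 0)}"
  have "0 \<in> I" using I.zero_closed by simp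
  with I(2) obtain z where z: "z \<in> I" "z \<noteq> 0" by blast
  then have "z \<in> carrier Z_phi" using I.a_subset by blast
  then obtain a b where "z = emb a b" by (auto simp: carrier_Z_phi)
  with z have "(a, b) \<in> S" by (auto simp: S_def emb_def)
  then obtain x where x: "x \<in> S" "\<And>y. y \<in> S \<Longrightarrow> nat \<bar>nm (fst x) (snd x)\<bar> \<le> nat \<bar>nm (fst y) (snd y)\<bar>"
    using ex_has_least_nat[of "\<lambda>x. x \<in> S" _ "\<lambda>x. nat \<bar>nm (fst x) (snd x)\<bar>"] by blast
  obtain c d where cd: "x = (c, d)" by (cases x)
  have cdI: "emb c d \<in> I" "\<not> (c = 0 \<and> d = 0)" using x(1) by (auto simp: S_def cd)
  have "I \<subseteq> pid c d"
  proof
    fix z assume zI: "z \<in> I"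
    then have "z \<in> carrier Z_phi" using I.a_subset by blast
    then obtain a b where ab: "z = emb a b" by (auto simp: carrier_Z_phi)
    obtain x' y' r s where q: "emb a b - emb c d * emb x' y' = emb r s" "\<bar>nm r s\<bar> < \<bar>nm c d\<bar>"
      using euclidean_division[OF cdI(2)] by blast
    have m: "emb c d * emb x' y' \<in> I" using I.I_r_closed[OF cdI(1), of "emb x' y'"] by simp
    have "z \<ominus>\<^bsub>Z_phi\<^esub> (emb c d * emb x' y') \<in> I"
      unfolding a_minus_def by (rule I.a_closed[OF zI I.a_inv_closed[OF m]])
    then have "emb r s \<in> I" using q(1) ab by (subst (asm) Z_minus) (auto simp: emb_mult)
    have "r = 0 \<and> s = 0"
    proof (rule ccontr)
      assume "\<not> (r = 0 \<and> s = 0)"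
      with \<open>emb r s \<in> I\<close> have "(r, s) \<in> S" by (auto simp: S_def)
      from x(2)[OF this] q(2) show False by (simp add: cd)
    qed
    then have "z = emb x' y' * emb c d" using q(1) ab by (simp add: emb_def mult.commute)
    then show "z \<in> pid c d" unfolding pid_mem by blast
  qed
  moreover have "pid c d \<subseteq> I"
    using Z.cgenideal_minimal[OF I(1) cdI(1)] .
  ultimately show ?thesis using cdI(2) by blast
qed

section \<open>The norm of a principal ideal\<close>

text \<open>The position of the lattice \<open>pid p q\<close> relative to the basis \<open>1, phi\<close>: its second coordinates are the
  multiples of \<open>g\<close>, and its elements on the first axis are the multiples of a number \<open>e\<close> with
  \<open>g * e = \<bar>nm p q\<bar>\<close>. The boxes of size \<open>e\<close> by \<open>g\<close> thus represent the cosets.\<close>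

lemma pid_coordinates:
  fixes p q :: int
  defines "g \<equiv> gcd p q"
  assumes nz: "\<not> (p = 0 \<and> q = 0)"
  shows "g > 0" "nm p q = g * g * nm (p div g) (q div g)" "nm (p div g) (q div g) \<noteq> 0"
    and "emb x y \<in> pid p q \<Longrightarrow> g dvd y"
    and "emb x 0 \<in> pid p q \<longleftrightarrow> g * nm (p div g) (q div g) dvd x"
    and "\<exists>r. emb r g \<in> pid p q"
proof -
  show g0: "g > 0" using nz by (simp add: g_def)
  define p' where "p' = p div g"
  define q' where "q' = q div g"
  have pq: "p = g * p'" "q = g * q'" by (auto simp: g_def p'_def q'_def)
  have fold: "p div g = p'" "q div g = q'" by (auto simp: p'_def q'_def)
  show "nm p q = g * g * nm (p div g) (q div g)" unfolding fold unfolding nm_def pq by (simp add: algebra_simps)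
  then show "nm (p div g) (q div g) \<noteq> 0" using nz nm_eq_0[of p q] by auto
  obtain u v where uv: "u * p + v * q = g" using bezout_int[of p q] unfolding g_def by blast
  then have "g * (u * p' + v * q') = g * 1" by (simp add: pq algebra_simps)
  then have uv': "u * p' + v * q' = 1" using g0 by simp
  have mem: "emb x y \<in> pid p q \<longleftrightarrow> (\<exists>c d. x = c * p + d * q \<and> y = c * q + d * p + d * q)" for x y
    unfolding pid_mem by (simp add: emb_mult emb_inj)
  show "g dvd y" if "emb x y \<in> pid p q"
    using that unfolding mem by (auto simp: g_def)
  show "\<exists>r. emb r g \<in> pid p q"
  proof -
    have "g = (v - u) * q + u * p + u * q" using uv by (simp add: algebra_simps)
    then show ?thesis unfolding mem by blast
  qed
  show "emb x 0 \<in> pid p q \<longleftrightarrow> g * nm (p div g) (q div g) dvd x"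
    unfolding fold
  proof
    assume "emb x 0 \<in> pid p q"
    then obtain c d where cd: "x = c * p + d * q" "0 = c * q + d * p + d * q" unfolding mem by blast
    then have "g * (c * q' + d * p' + d * q') = 0" by (simp add: pq algebra_simps)
    then have z: "c * q' + d * p' + d * q' = 0" using g0 by simp
    \<comment> \<open>\<open>(d, - c - d)\<close> is a multiple of \<open>(q', p')\<close>, as these are coprime; the Bezout coefficients give the factor\<close>
    define s where "s = v * d - u * (c + d)"
    have sd: "q' * s = d"
    proof -
      have "q' * s = d * (u * p' + v * q') - u * (c * q' + d * p' + d * q')" by (simp add: s_def algebra_simps)
      then show ?thesis by (simp add: z uv')
    qed
    have sc: "p' * s = - (c + d)"
    proof -
      have "p' * s = v * (c * q' + d * p' + d * q') - (c + d) * (u * p' + v * q')" by (simp add: s_def algebra_simps)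
      then show ?thesis by (simp add: z uv')
    qed
    have c: "c = - (p' * s) - q' * s" using sc sd by simp
    have "x = g * nm p' q' * (- s)"
      unfolding cd(1) c sd[symmetric] pq by (simp add: nm_def algebra_simps)
    then show "g * nm p' q' dvd x" by simp
  next
    assume "g * nm p' q' dvd x"
    then obtain t where t: "x = g * nm p' q' * t" by blast
    have "x = ((p' + q') * t) * p + (- q' * t) * q \<and> 0 = ((p' + q') * t) * q + (- q' * t) * p + (- q' * t) * q"
      unfolding t pq by (simp add: nm_def algebra_simps)
    then show "emb x 0 \<in> pid p q" unfolding mem by blast
  qed
qed

lemma ideal_norm_pid:
  assumes nz: "\<not> (p = 0 \<and> q = 0)"
  shows "ideal_norm Z_phi (pid p q) = nat \<bar>nm p q\<bar>"
proof -
  define g where "g = gcd p q"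
  define e where "e = g * \<bar>nm (p div g) (q div g)\<bar>"
  note C = pid_coordinates[OF nz, folded g_def]
  have e: "e > 0" "g * e = \<bar>nm p q\<bar>" using C(1-3) by (auto simp: e_def abs_mult)
  have C5: "emb x 0 \<in> pid p q \<longleftrightarrow> e dvd x" for x
    unfolding C(5) e_def using C(1) by (simp add: dvd_abs_iff abs_mult flip: abs_dvd_iff[of "g * nm (p div g) (q div g)"])
  obtain r where r: "emb r g \<in> pid p q" using C(6) by blast
  interpret P: ideal "pid p q" Z_phi by (rule pid_ideal)
  have diffP: "a - b \<in> pid p q" if "a \<in> pid p q" "b \<in> pid p q" for a b
  proof -
    have "a \<in> carrier Z_phi" "b \<in> carrier Z_phi" using that P.a_subset by auto
    moreover have "a \<ominus>\<^bsub>Z_phi\<^esub> b \<in> pid p q"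
      unfolding a_minus_def by (rule P.a_closed[OF that(1) P.a_inv_closed[OF that(2)]])
    ultimately show ?thesis by (simp add: Z_minus)
  qed
  have same: "(pid p q +>\<^bsub>Z_phi\<^esub> emb a b = pid p q +>\<^bsub>Z_phi\<^esub> emb c d) \<longleftrightarrow> emb (a - c) (b - d) \<in> pid p q" for a b c d
    using Z.quotient_eq_iff_same_a_r_cos[OF pid_ideal, of "emb a b" "emb c d"] by (simp add: Z_minus emb_diff)
  have "bij_betw (\<lambda>(x, y). pid p q +>\<^bsub>Z_phi\<^esub> emb x y) ({0..<e} \<times> {0..<g}) (carrier (Z_phi Quot pid p q))"
  proof (rule bij_betw_imageI)
    show "inj_on (\<lambda>(x, y). pid p q +>\<^bsub>Z_phi\<^esub> emb x y) ({0..<e} \<times> {0..<g})"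
    proof (rule inj_onI, clarify)
      fix x y x2 y2
      assume r: "x \<in> {0..<e}" "y \<in> {0..<g}" "x2 \<in> {0..<e}" "y2 \<in> {0..<g}"
        and eq: "pid p q +>\<^bsub>Z_phi\<^esub> emb x y = pid p q +>\<^bsub>Z_phi\<^esub> emb x2 y2"
      have m: "emb (x - x2) (y - y2) \<in> pid p q" using eq by (simp only: same)
      have small: "a = b" if "k dvd a - b" "a \<in> {0..<k}" "b \<in> {0..<k}" for a b k :: int
      proof -
        have "a mod k = b mod k" using that(1) by (simp add: mod_eq_dvd_iff)
        then show ?thesis using that by simp
      qed
      have y: "y = y2" using small[OF C(4)[OF m]] r by blast
      then have "emb (x - x2) 0 \<in> pid p q" using m by simp
      then have "x = x2" using small[of e x x2] r C5 by blast
      with y show "x = x2 \<and> y = y2" by simp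
    qed
    show "(\<lambda>(x, y). pid p q +>\<^bsub>Z_phi\<^esub> emb x y) ` ({0..<e} \<times> {0..<g}) = carrier (Z_phi Quot pid p q)"
    proof -
      have car: "carrier (Z_phi Quot pid p q) = (\<Union>z\<in>carrier Z_phi. {pid p q +>\<^bsub>Z_phi\<^esub> z})"
        by (simp add: FactRing_def A_RCOSETS_def')
      show ?thesis
      proof
        show "(\<lambda>(x, y). pid p q +>\<^bsub>Z_phi\<^esub> emb x y) ` ({0..<e} \<times> {0..<g}) \<subseteq> carrier (Z_phi Quot pid p q)"
          unfolding car using emb_carrier by fast
        show "carrier (Z_phi Quot pid p q) \<subseteq> (\<lambda>(x, y). pid p q +>\<^bsub>Z_phi\<^esub> emb x y) ` ({0..<e} \<times> {0..<g})"
        proof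
          fix A assume "A \<in> carrier (Z_phi Quot pid p q)"
          then obtain X Y where A: "A = pid p q +>\<^bsub>Z_phi\<^esub> emb X Y" unfolding car by (auto simp: carrier_Z_phi)
          define t where "t = Y div g"
          define y where "y = Y mod g"
          define X' where "X' = X - t * r"
          define x where "x = X' mod e"
          have Y: "Y - y = t * g" unfolding t_def y_def by (simp add: minus_mod_eq_div_mult)
          have "emb t 0 * emb r g \<in> pid p q" using P.I_l_closed[OF r, of "emb t 0"] by simp
          then have m1: "emb (t * r) (t * g) \<in> pid p q" by (simp add: emb_mult)
          have "e dvd X' - x" unfolding x_def by (simp add: minus_mod_eq_div_mult)
          then have m2: "emb (X' - x) 0 \<in> pid p q" by (simp add: C5)
          have "emb (t * r) (t * g) + emb (X' - x) 0 \<in> pid p q"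
            using P.a_closed[OF m1 m2] by simp
          then have "emb (X - x) (Y - y) \<in> pid p q" by (simp add: emb_add X'_def Y)
          then have "A = pid p q +>\<^bsub>Z_phi\<^esub> emb x y" unfolding A same .
          moreover have "(x, y) \<in> {0..<e} \<times> {0..<g}" using e C(1) by (simp add: x_def y_def)
          ultimately show "A \<in> (\<lambda>(x, y). pid p q +>\<^bsub>Z_phi\<^esub> emb x y) ` ({0..<e} \<times> {0..<g})"
            by (intro image_eqI[of _ _ "(x, y)"]) auto
        qed
      qed
    qed
  qed
  from bij_betw_same_card[OF this] have "ideal_norm Z_phi (pid p q) = nat e * nat g"
    unfolding ideal_norm_def by (simp add: card_cartesian_product)
  also have "\<dots> = nat (g * e)" using nat_mult_distrib[of g e] C(1) by (metis less_imp_le mult.commute)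
  finally show ?thesis unfolding e(2) .
qed

section \<open>Rows and ideals\<close>

lemma pid_unit:
  assumes "emb u v * emb u' v' = 1" "emb c d = emb a b * emb u v"
  shows "pid c d = pid a b"
proof -
  have sub: "pid c d \<subseteq> pid a b" if "emb c d = emb a b * emb u v" for a b c d u v
  proof
    fix z assume "z \<in> pid c d"
    then obtain x y where "z = emb x y * emb c d" unfolding pid_mem by blast
    then have "z = (emb x y * emb u v) * emb a b" using that by simp
    then show "z \<in> pid a b" unfolding emb_mult[of x y u v] pid_mem by blast
  qed
  have "emb a b = emb c d * emb u' v'" using assms by (simp add: mult.assoc)
  from sub[OF assms(2)] sub[OF this] show ?thesis by blast
qed

lemma psi_emb: "psi = emb 1 (- 1)" by (simp add: emb_def psi_def)

lemma times_psi: "emb (a - b) (- a) = emb a b * psi" "pid (a - b) (- a) = pid a b" "nm (a - b) (- a) = - nm a b"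
proof -
  show 1: "emb (a - b) (- a) = emb a b * psi" by (simp add: psi_emb emb_mult)
  have "emb 1 (- 1) * emb 0 (- 1) = 1" by (simp add: emb_mult) (simp add: emb_def)
  then show "pid (a - b) (- a) = pid a b" by (rule pid_unit) (simp add: 1 psi_emb)
  show "nm (a - b) (- a) = - nm a b" by (simp add: nm_def algebra_simps)
qed

lemma times_phi2: "emb (a + b) (a + 2 * b) = emb a b * phi ^ 2" "pid (a + b) (a + 2 * b) = pid a b" "nm (a + b) (a + 2 * b) = nm a b"
proof -
  have p: "phi ^ 2 = emb 1 1" by (simp add: emb_def phi_pow2)
  show 1: "emb (a + b) (a + 2 * b) = emb a b * phi ^ 2" unfolding p by (simp add: emb_mult algebra_simps)
  have "emb 1 1 * emb 2 (- 1) = 1" by (simp add: emb_mult) (simp add: emb_def)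
  then show "pid (a + b) (a + 2 * b) = pid a b" by (rule pid_unit) (simp add: 1 p)
  show "nm (a + b) (a + 2 * b) = nm a b" by (simp add: nm_def algebra_simps)
qed

lemma times_psi_pow: "\<exists>c d. emb c d = emb a b * psi ^ l \<and> pid c d = pid a b"
proof (induction l)
  case (Suc l)
  then obtain c d where "emb c d = emb a b * psi ^ l" "pid c d = pid a b" by blast
  then have "emb (c - d) (- c) = emb a b * psi ^ Suc l \<and> pid (c - d) (- c) = pid a b"
    using times_psi[of c d] by simp
  then show ?case by blast
qed auto

lemma times_phi_pow: "\<exists>c d. emb c d = emb a b * (phi ^ 2) ^ l \<and> pid c d = pid a b \<and> nm c d = nm a b"
proof (induction l)
  case (Suc l)
  then obtain c d where "emb c d = emb a b * (phi ^ 2) ^ l" "pid c d = pid a b" "nm c d = nm a b" by blast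
  then have "emb (c + d) (c + 2 * d) = emb a b * (phi ^ 2) ^ Suc l \<and> pid (c + d) (c + 2 * d) = pid a b \<and> nm (c + d) (c + 2 * d) = nm a b"
    using times_phi2[of c d] by simp
  then show ?case by blast
qed auto

text \<open>Multiplying by powers of \<open>psi\<close> makes the generator at most 1 in absolute value and its norm
  negative. Multiplying by powers of \<open>phi ^ 2\<close>, which preserve the norm, moves it into the window,
  and a final change of sign makes it negative.\<close>

lemma pid_normalised:
  assumes nz: "\<not> (a = 0 \<and> b = 0)"
  shows "\<exists>c d. pid c d = pid a b \<and> nm c d < 0 \<and> 1 / phi ^ 2 < - emb c d \<and> - emb c d \<le> 1"
proof -
  have emb0: "emb c d \<noteq> 0" if "nm c d \<noteq> 0" for c d using emb_nm[of c d] that by auto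
  have nm_same: "nm c d \<noteq> 0" if "pid c d = pid a b" for c d
  proof
    assume "nm c d = 0"
    then have "emb c d = 0" by (simp add: nm_eq_0 emb_def)
    have "emb a b \<in> pid c d" unfolding that pid_mem by (rule exI[of _ 1], rule exI[of _ 0]) (simp add: emb_def)
    then have "emb a b = 0" unfolding pid_mem using \<open>emb c d = 0\<close> by auto
    then show False using nz phi_irrational[of a b] by (simp add: emb_def)
  qed
  have "(\<lambda>l. \<bar>emb a b\<bar> * (1 / phi) ^ l) \<longlonglongrightarrow> \<bar>emb a b\<bar> * 0"
    using phi_gt_1 by (intro tendsto_intros LIMSEQ_power_zero) auto
  then have "eventually (\<lambda>l. \<bar>emb a b\<bar> * (1 / phi) ^ l < 1) sequentially"
    by (intro order_tendstoD(2)) auto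
  then obtain l where l: "\<bar>emb a b\<bar> * (1 / phi) ^ l < 1" by (auto simp: eventually_sequentially)
  obtain a1 b1 where 1: "emb a1 b1 = emb a b * psi ^ l" "pid a1 b1 = pid a b" using times_psi_pow by blast
  have s1: "\<bar>emb a1 b1\<bar> \<le> 1" using l by (simp add: 1 abs_mult abs_psi_pow power_divide)
  obtain a2 b2 where 2: "pid a2 b2 = pid a b" "nm a2 b2 < 0" "\<bar>emb a2 b2\<bar> \<le> 1"
  proof (cases "nm a1 b1 < 0")
    case True
    with 1 s1 that show ?thesis by blast
  next
    case False
    with nm_same[OF 1(2)] have p: "nm a1 b1 > 0" by simp
    have "\<bar>emb (a1 - b1) (- a1)\<bar> = \<bar>emb a1 b1\<bar> * (1 / phi)" by (simp add: times_psi(1) abs_mult abs_psi)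
    also have "\<dots> \<le> 1 * 1" using s1 phi_gt_1 by (intro mult_mono) auto
    finally show ?thesis using that[of "a1 - b1" "- a1"] times_psi[of a1 b1] 1 p by simp
  qed
  define Q where "Q = 1 / phi ^ 2"
  have Q: "0 < Q" "Q < 1" using phi_bounds unfolding Q_def inverse_phi2 by auto
  have "\<bar>emb a2 b2\<bar> > 0" using emb0[of a2 b2] 2 by simp
  then obtain t where t: "Q ^ Suc t < \<bar>emb a2 b2\<bar>" "\<bar>emb a2 b2\<bar> \<le> Q ^ t"
    using geometric_window[OF Q _ 2(3)] by blast
  obtain a3 b3 where 3: "emb a3 b3 = emb a2 b2 * (phi ^ 2) ^ t" "pid a3 b3 = pid a2 b2" "nm a3 b3 = nm a2 b2"
    using times_phi_pow by blast
  have e3: "\<bar>emb a3 b3\<bar> = \<bar>emb a2 b2\<bar> / Q ^ t" by (simp add: 3 abs_mult Q_def power_divide)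
  have w3: "Q < \<bar>emb a3 b3\<bar>" "\<bar>emb a3 b3\<bar> \<le> 1" unfolding e3 using t Q by (auto simp: field_simps)
  show ?thesis
  proof (cases "emb a3 b3 < 0")
    case True
    with w3 2 3 show ?thesis unfolding Q_def by (intro exI[of _ a3] exI[of _ b3]) auto
  next
    case False
    have "pid (- a3) (- b3) = pid a3 b3"
    proof (rule pid_unit)
      show "emb (- 1) 0 * emb (- 1) 0 = 1" by (simp add: emb_def)
      show "emb (- a3) (- b3) = emb a3 b3 * emb (- 1) 0" by (simp add: emb_def)
    qed
    moreover have "nm (- a3) (- b3) = nm a3 b3" by (simp add: nm_def)
    moreover have "emb (- a3) (- b3) = - emb a3 b3" by (simp add: emb_minus)
    ultimately show ?thesis using w3 2 3 False unfolding Q_def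
      by (intro exI[of _ "- a3"] exI[of _ "- b3"]) auto
  qed
qed

text \<open>The generator is \<open>w_minus i\<close>, which equals \<open>- w_plus_dual i\<close>.\<close>

definition row_ideal :: "nat \<Rightarrow> real set" where
  "row_ideal i = pid (wythoff i 1) (- wythoff i 0)"

lemma emb_row: "emb (wythoff i 1) (- wythoff i 0) = - w_plus_dual i" "emb' (wythoff i 1) (- wythoff i 0) = w_plus i"
  by (simp_all add: emb_def emb'_def psi_def w_plus_dual_eq w_plus_eq algebra_simps)

lemma nm_row: "real_of_int (nm (wythoff i 1) (- wythoff i 0)) = - eta i"
  using emb_nm[of "wythoff i 1" "- wythoff i 0"] by (simp add: emb_row eta_eq mult.commute)

lemma row_nonzero: "i \<ge> 1 \<Longrightarrow> \<not> (wythoff i 1 = 0 \<and> - wythoff i 0 = 0)"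
  using wythoff_1_ge[of i] by auto

lemma ideal_norm_row:
  assumes "i \<ge> 1" shows "real (ideal_norm Z_phi (row_ideal i)) = eta i"
proof -
  have "eta i \<ge> 0"
    unfolding eta_eq using w_plus_dual_bounds[OF assms] w_plus_ge_phi[OF assms] phi_gt_1 by simp
  then have "nm (wythoff i 1) (- wythoff i 0) \<le> 0" using nm_row[of i] by linarith
  then show ?thesis
    unfolding row_ideal_def ideal_norm_pid[OF row_nonzero[OF assms]] using nm_row[of i] by simp
qed

lemma row_ideal_surj:
  assumes "I \<in> nonzero_ideals Z_phi" shows "\<exists>i\<ge>1. I = row_ideal i"
proof -
  have "ideal I Z_phi" "I \<noteq> {0}" using assms by (auto simp: nonzero_ideals_def)
  from ideal_principal[OF this] obtain a b where ab: "\<not> (a = 0 \<and> b = 0)" "I = pid a b" by blast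
  from pid_normalised[OF ab(1)] obtain c d where
    cd: "pid c d = pid a b" "nm c d < 0" "1 / phi ^ 2 < - emb c d" "- emb c d \<le> 1" by blast
  have e: "- emb c d = phi * of_int (- d) - of_int c" by (simp add: emb_def)
  have "1 / phi ^ 2 > 0" by simp
  then have "emb c d < 0" using cd(3) by linarith
  moreover have "emb c d * emb' c d < 0" unfolding emb_nm using cd(2) by simp
  ultimately have pos: "emb' c d > 0" by (simp add: mult_less_0_iff)
  have "- d > 0 \<or> c > 0"
  proof (rule ccontr)
    assume a: "\<not> ?thesis"
    then have "real_of_int d * psi \<le> 0"
      by (intro mult_nonneg_nonpos) (use phi_gt_1 in \<open>auto simp: psi_def\<close>)
    with a pos show False by (simp add: emb'_def)
  qed
  from row_exists[OF cd(3,4)[unfolded e] this] obtain i where "i \<ge> 1" "wythoff i 0 = - d" "wythoff i 1 = c" by blast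
  then have "row_ideal i = pid c d" "i \<ge> 1" by (simp_all add: row_ideal_def)
  with cd ab show ?thesis by blast
qed

text \<open>The quotient of two generators is a unit \<open>u\<close> of norm 1, and both \<open>u\<close> and its conjugate lie
  strictly between \<open>phi\<^bsup>-2\<^esup>\<close> and \<open>phi ^ 2\<close>. Their difference is a multiple of \<open>sqrt 5\<close> and smaller
  than \<open>phi ^ 2 - 1 / phi ^ 2 = sqrt 5\<close>; so it vanishes and \<open>u = 1\<close>.\<close>

lemma row_ideal_inj:
  assumes "i \<ge> 1" "j \<ge> 1" "row_ideal i = row_ideal j" shows "i = j"
proof -
  define a b c d where "a = wythoff i 1" and "b = - wythoff i 0" and "c = wythoff j 1" and "d = - wythoff j 0"
  have eq: "pid a b = pid c d" using assms(3) by (simp add: row_ideal_def a_def b_def c_def d_def)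
  have mem: "emb a b \<in> pid a b" for a b unfolding pid_mem by (rule exI[of _ 1], rule exI[of _ 0]) (simp add: emb_def)
  from mem[of a b] eq obtain p r where pr: "emb a b = emb p r * emb c d" using pid_mem by blast
  from mem[of c d] eq obtain s t where st: "emb c d = emb s t * emb a b" using pid_mem by blast
  have ea: "emb a b = - w_plus_dual i" "emb c d = - w_plus_dual j" "emb' a b = w_plus i" "emb' c d = w_plus j"
    by (simp_all add: a_def b_def c_def d_def emb_row)
  note wi = w_plus_dual_bounds[OF assms(1)] w_plus_ge_phi[OF assms(1)]
    and wj = w_plus_dual_bounds[OF assms(2)] w_plus_ge_phi[OF assms(2)]
  have wp: "w_plus i > 0" "w_plus j > 0" using wi wj phi_gt_1 by linarith+
  have u: "w_plus_dual i = emb p r * w_plus_dual j" using pr ea by simp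
  have "a = p * c + r * d \<and> b = p * d + r * c + r * d" using pr unfolding emb_mult emb_inj by simp
  then have u': "w_plus i = emb' p r * w_plus j" using emb'_mult[of p r c d] ea by simp
  have up: "emb p r > 0" using u wi wj by (metis zero_less_mult_pos2)
  have up': "emb' p r > 0" using u' wp by (metis zero_less_mult_pos2)
  have "emb p r * emb s t = 1"
  proof -
    have "emb a b = (emb p r * emb s t) * emb a b" using pr st by simp
    moreover have "emb a b \<noteq> 0" using ea wi by simp
    ultimately show ?thesis by simp
  qed
  then have "emb (p * s + r * t) (p * t + r * s + r * t) = emb 1 0" unfolding emb_mult by (simp add: emb_def)
  then have "nm p r * nm s t = 1" unfolding emb_inj nm_mult[symmetric] by (simp add: nm_def)
  then have "nm p r = 1 \<or> nm p r = - 1" using zmult_eq_1_iff by blast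
  moreover have "real_of_int (nm p r) > 0" unfolding emb_nm[symmetric] using up up' by simp
  ultimately have n1: "nm p r = 1" by auto
  have inv: "emb' p r = 1 / emb p r" using emb_nm[of p r] up by (simp add: n1 field_simps)
  have w: "x / y < phi ^ 2" if "1 / phi ^ 2 < y" "x < 1" "0 < x" "0 < y" for x y
  proof -
    have "1 < y * phi ^ 2" using that(1) by (simp add: divide_less_eq)
    then have "x < phi ^ 2 * y" using that by (simp add: mult.commute)
    then show ?thesis using that by (simp add: divide_less_eq)
  qed
  have e1: "emb p r = w_plus_dual i / w_plus_dual j" and e2: "emb' p r = w_plus_dual j / w_plus_dual i"
    using u wi wj up by (simp_all add: inv)
  have b: "emb p r < phi ^ 2" "emb' p r < phi ^ 2"
    unfolding e1 e2 using w[of "w_plus_dual j" "w_plus_dual i"] w[of "w_plus_dual i" "w_plus_dual j"] wi wj by auto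
  have low: "1 / phi ^ 2 < emb p r" "1 / phi ^ 2 < emb' p r"
  proof -
    have "emb p r = 1 / emb' p r" using inv up by simp
    then show "1 / phi ^ 2 < emb p r" using b(2) up' by (simp add: frac_less2)
    show "1 / phi ^ 2 < emb' p r" unfolding inv using b(1) up by (simp add: frac_less2)
  qed
  have "emb p r - emb' p r = of_int r * sqrt 5" by (simp add: emb_def emb'_def psi_def sqrt5_eq algebra_simps)
  moreover have "phi ^ 2 - 1 / phi ^ 2 = sqrt 5" unfolding inverse_phi2 by (simp add: phi_pow2 sqrt5_eq)
  ultimately have "of_int r * sqrt 5 < sqrt 5" "- (of_int r * sqrt 5) < sqrt 5" using b low by linarith+
  then have "\<bar>of_int r * sqrt 5\<bar> < 1 * sqrt 5" by (simp only: abs_less_iff mult_1 minus_less_iff)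
  then have "\<bar>real_of_int r\<bar> < 1" unfolding abs_mult by simp
  then have r0: "r = 0" by linarith
  then have "p * p = 1" using n1 by (simp add: nm_def)
  moreover have "p > 0" using up r0 by (simp add: emb_def)
  ultimately have "p = 1" using zmult_eq_1_iff by force
  with u r0 have "w_plus_dual i = w_plus_dual j" by (simp add: emb_def)
  then show ?thesis by (rule row_inj[OF assms(1,2)])
qed

lemma row_ideal_nonzero:
  assumes "i \<ge> 1" shows "row_ideal i \<in> nonzero_ideals Z_phi"
proof -
  have "emb (wythoff i 1) (- wythoff i 0) \<in> row_ideal i"
    unfolding row_ideal_def pid_mem by (rule exI[of _ 1], rule exI[of _ 0]) (simp add: emb_def)
  moreover have "emb (wythoff i 1) (- wythoff i 0) \<noteq> 0" 
    unfolding emb_row using w_plus_dual_bounds(3)[OF assms] by simp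
  ultimately show ?thesis using pid_ideal by (auto simp: nonzero_ideals_def row_ideal_def)
qed

lemma row_ideal_bij: "bij_betw (\<lambda>i. row_ideal (Suc i)) UNIV (nonzero_ideals Z_phi)"
proof (rule bij_betw_imageI)
  show "inj (\<lambda>i. row_ideal (Suc i))"
  proof (rule injI)
    fix x y assume "row_ideal (Suc x) = row_ideal (Suc y)"
    from row_ideal_inj[OF _ _ this] show "x = y" by simp
  qed
  show "range (\<lambda>i. row_ideal (Suc i)) = nonzero_ideals Z_phi"
  proof
    show "range (\<lambda>i. row_ideal (Suc i)) \<subseteq> nonzero_ideals Z_phi" using row_ideal_nonzero by auto
    show "nonzero_ideals Z_phi \<subseteq> range (\<lambda>i. row_ideal (Suc i))"
    proof
      fix I assume "I \<in> nonzero_ideals Z_phi"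
      then obtain i where i: "i \<ge> 1" "I = row_ideal i" using row_ideal_surj by blast
      then have "I = row_ideal (Suc (i - 1))" by simp
      then show "I \<in> range (\<lambda>i. row_ideal (Suc i))" by blast
    qed
  qed
qed

theorem zeta_rows:
  assumes "summable (\<lambda>i. 1 / eta (Suc i) powr s)"
  shows "(\<lambda>I. real (ideal_norm Z_phi I) powr (- s)) summable_on nonzero_ideals Z_phi"
    and "dedekind_zeta_sqrt5 s = (\<Sum>i. 1 / eta (Suc i) powr s)"
proof -
  have "(\<lambda>i. 1 / eta (Suc i) powr s) sums (\<Sum>i. 1 / eta (Suc i) powr s)" using assms by (rule summable_sums)
  then have "((\<lambda>i. 1 / eta (Suc i) powr s) has_sum (\<Sum>i. 1 / eta (Suc i) powr s)) UNIV"
    by (rule sums_nonneg_imp_has_sum) simp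
  moreover have "1 / eta (Suc i) powr s = real (ideal_norm Z_phi (row_ideal (Suc i))) powr (- s)" for i
    by (subst ideal_norm_row) (auto simp: powr_minus divide_inverse)
  ultimately have "((\<lambda>i. real (ideal_norm Z_phi (row_ideal (Suc i))) powr (- s)) has_sum (\<Sum>i. 1 / eta (Suc i) powr s)) UNIV"
    by simp
  then have h: "((\<lambda>I. real (ideal_norm Z_phi I) powr (- s)) has_sum (\<Sum>i. 1 / eta (Suc i) powr s)) (nonzero_ideals Z_phi)"
    using has_sum_reindex_bij_betw[OF row_ideal_bij, of "\<lambda>I. real (ideal_norm Z_phi I) powr (- s)"] by simp
  then show "(\<lambda>I. real (ideal_norm Z_phi I) powr (- s)) summable_on nonzero_ideals Z_phi"
    by (rule has_sum_imp_summable)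
  show "dedekind_zeta_sqrt5 s = (\<Sum>i. 1 / eta (Suc i) powr s)"
    unfolding dedekind_zeta_sqrt5_def using h by (rule infsumI)
qed

section \<open>Comparison of the expansions\<close>

lemma tendsto_0_linear_imp_0:
  fixes a b :: real
  assumes "(\<lambda>n. a * real n + b) \<longlonglongrightarrow> 0"
  shows "a = 0 \<and> b = 0"
proof -
  have "(\<lambda>n. (a * real (Suc n) + b) - (a * real n + b)) \<longlonglongrightarrow> 0 - 0"
    by (intro tendsto_diff assms LIMSEQ_Suc[OF assms])
  then have "(\<lambda>n. a) \<longlonglongrightarrow> 0" by (simp add: algebra_simps)
  then have a: "a = 0" by (simp add: LIMSEQ_const_iff)
  with assms show ?thesis by (simp add: LIMSEQ_const_iff)
qed

theorem mainTheorem3: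
  fixes f :: "real \<Rightarrow> real" and \<sigma> \<alpha> C D :: real
  assumes "\<sigma> > 1"
    and "0 < \<alpha>" and "\<alpha> \<le> 1"
    and periodic: "\<And>t. f (t + 1) = f t"
    and symmetric: "\<And>t. f t = f (1 - t)"
    and "holder \<alpha> f"
    and "(\<lambda>n. fib_sum f \<sigma> n - (C * real n + D))
           \<in> O[sequentially](\<lambda>n. real n ^ 2 / phi powr (min \<alpha> (\<sigma> - 1) * real n / 2))"
  shows "summable (\<lambda>i. 1 / eta (Suc i) powr \<sigma>)
    \<and> C = 2 * (f 0 ^ 2 * 5 powr (\<sigma> / 2) / pi powr (2 * \<sigma>))
               * (\<Sum>i. 1 / eta (Suc i) powr \<sigma>)
    \<and> (\<lambda>I. real (ideal_norm Z_phi I) powr (- \<sigma>)) summable_on nonzero_ideals Z_phi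
    \<and> C = 2 * f 0 ^ 2 * (5 powr (\<sigma> / 2) / pi powr (2 * \<sigma>)) * dedekind_zeta_sqrt5 \<sigma>
    \<and> (\<forall>i\<ge>1. summable (\<lambda>k. delta_term f \<sigma> i (Suc k))
              \<and> summable (\<lambda>j. delta_dual_term f \<sigma> i (Suc j)))
    \<and> summable (\<lambda>i. delta f \<sigma> (Suc i) + delta_dual f \<sigma> (Suc i)
           - f 0 ^ 2 * 5 powr (\<sigma> / 2) / pi powr (2 * \<sigma>)
               * ((real (mu (Suc i)) + 1) / eta (Suc i) powr \<sigma>))
    \<and> D = 2 * (\<Sum>i. delta f \<sigma> (Suc i) + delta_dual f \<sigma> (Suc i)
           - f 0 ^ 2 * 5 powr (\<sigma> / 2) / pi powr (2 * \<sigma>)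
               * ((real (mu (Suc i)) + 1) / eta (Suc i) powr \<sigma>))"
proof -
  obtain L where L: "L \<ge> 0" "\<And>x y. x \<in> {0..<1} \<Longrightarrow> y \<in> {0..<1} \<Longrightarrow> \<bar>f x - f y\<bar> \<le> L * \<bar>x - y\<bar> powr \<alpha>"
    using assms(6) unfolding holder_def by blast
  interpret weight f \<sigma> \<alpha> L
    by unfold_locales (use assms L in auto)
  let ?K = "f 0 ^ 2 * 5 powr (\<sigma> / 2) / pi powr (2 * \<sigma>)"
  let ?S = "\<Sum>i. 1 / eta (Suc i) powr \<sigma>"
  let ?D = "2 * (\<Sum>i. delta f \<sigma> (Suc i) + delta_dual f \<sigma> (Suc i) - ?K * ((real (mu (Suc i)) + 1) / eta (Suc i) powr \<sigma>))"
  note A = fib_sum_asymptotics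
  note S = summable_inv_eta[OF assms(1)]
  define b where "b = min \<alpha> (\<sigma> - 1) / 2 * ln phi"
  have "b > 0" using assms(1,2) phi_gt_1 by (simp add: b_def)
  then have "(\<lambda>n. real n ^ 2 / exp (b * real n)) \<longlonglongrightarrow> 0" by real_asymp
  then have rate: "(\<lambda>n. real n ^ 2 / phi powr (min \<alpha> (\<sigma> - 1) * real n / 2)) \<longlonglongrightarrow> 0"
    by (simp add: b_def powr_def mult_ac)
  obtain c where c: "eventually (\<lambda>n. norm (fib_sum f \<sigma> n - (C * real n + D))
      \<le> c * norm (real n ^ 2 / phi powr (min \<alpha> (\<sigma> - 1) * real n / 2))) sequentially"
    using assms(7) by (elim landau_o.bigE)
  have err: "(\<lambda>n. fib_sum f \<sigma> n - (C * real n + D)) \<longlonglongrightarrow> 0"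
  proof (rule Lim_null_comparison[OF c])
    show "(\<lambda>n. c * norm (real n ^ 2 / phi powr (min \<alpha> (\<sigma> - 1) * real n / 2))) \<longlonglongrightarrow> 0"
      using tendsto_mult[OF tendsto_const tendsto_norm[OF rate], of c] by simp
  qed
  have "(\<lambda>n. (fib_sum f \<sigma> n - (2 * ?K * ?S * real n + ?D)) - (fib_sum f \<sigma> n - (C * real n + D))) \<longlonglongrightarrow> 0 - 0"
    by (intro tendsto_diff A(4) err)
  then have "(\<lambda>n. (C - 2 * ?K * ?S) * real n + (D - ?D)) \<longlonglongrightarrow> 0"
    by (simp add: algebra_simps)
  from tendsto_0_linear_imp_0[OF this] have CD: "C = 2 * ?K * ?S" "D = ?D" by auto
  have "C = 2 * f 0 ^ 2 * (5 powr (\<sigma> / 2) / pi powr (2 * \<sigma>)) * dedekind_zeta_sqrt5 \<sigma>"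
    unfolding zeta_rows(2)[OF S] CD(1) by simp
  then show ?thesis
    by (intro conjI allI impI) (rule S CD zeta_rows(1)[OF S] A(1-3) | assumption)+
qed

end
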